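(* Let $0<a<1$ and let $C_a$ be the Chebyshev's method of $p_a(z)=(z^2-1)(z^2-a)$. If the Fatou set of $C_a$ consists only of the basins of attraction of the superattracting fixed points of $C_a$, then $\Sigma p_a=\Sigma C_a$.
   Context: For a polynomial $p$, the Chebyshev's method of $p$ is the rational map $C_p(z)=z-\left[1+\frac12 L_p(z)\right]\frac{p(z)}{p'(z)}$ with $L_p(z)=\frac{p(z)p''(z)}{(p'(z))^2}$, regarded as a self-map of the Riemann sphere $\widehat{\mathbb C}$. For $p_a(z)=(z^2-1)(z^2-a)$ write $C_a:=C_{p_a}$. The superattracting fixed points of $C_a$ are the roots $\pm1,\pm\sqrt a$ of $p_a$. The basin of attraction of such a fixed point $\zeta$ is the set of all $z$ with $C_a^n(z)\to\zeta$ as $n\to\infty$. For a rational map $R$ (in particular for a polynomial) with Julia set $\mathcal J(R)$, the symmetry group is $\Sigma R=\{\sigma:\sigma\text{ is a holomorphic Euclidean isometry of }\mathbb C\text{ and }\sigma(\mathcal J(R))=\mathcal J(R)\}$, where holomorphic Euclidean isometries are the maps $z\mapsto \alpha z+\beta$ with $|\alpha|=1$. *)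

theory Defs
  imports
    "HOL-Complex_Analysis.Complex_Analysis"
    "HOL-Computational_Algebra.Computational_Algebra"
    "HOL-Computational_Algebra.Field_as_Ring"
begin

section \<open>The Riemann sphere\<close>

datatype rsphere = Fin complex | Infty

text \<open>
  Inverse stereographic projection onto the unit sphere of
  \<open>\<complex> \<times> \<real>\<close>; the metric it induces is the chordal metric
  (lemmas \<open>dist_rsphere_Fin_Fin\<close> and \<open>dist_rsphere_Fin_Infty\<close> below).
\<close>

primrec stereo :: "rsphere \<Rightarrow> complex \<times> real" where
  "stereo (Fin z) =
     (of_real (2 / (1 + (cmod z)\<^sup>2)) * z, ((cmod z)\<^sup>2 - 1) / ((cmod z)\<^sup>2 + 1))"
| "stereo Infty = (0, 1)"

lemma stereo_Fin_neq_Infty: "stereo (Fin z) \<noteq> stereo Infty"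
proof
  assume "stereo (Fin z) = stereo Infty"
  then have "((cmod z)\<^sup>2 - 1) / ((cmod z)\<^sup>2 + 1) = 1" by simp
  moreover have "(cmod z)\<^sup>2 + 1 > 0" by (simp add: add_nonneg_pos)
  ultimately show False by (simp add: field_simps)
qed

lemma stereo_Fin_inj:
  assumes "stereo (Fin z) = stereo (Fin w)"
  shows "z = w"
proof -
  have pos: "(cmod u)\<^sup>2 + 1 > 0" for u :: complex by (simp add: add_nonneg_pos)
  have "((cmod z)\<^sup>2 - 1) / ((cmod z)\<^sup>2 + 1) = ((cmod w)\<^sup>2 - 1) / ((cmod w)\<^sup>2 + 1)"
    using assms by simp
  then have eq: "(cmod z)\<^sup>2 = (cmod w)\<^sup>2"
    using pos[of z] pos[of w] by (simp add: frac_eq_eq algebra_simps)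
  have "of_real (2 / (1 + (cmod z)\<^sup>2)) * z = of_real (2 / (1 + (cmod z)\<^sup>2)) * w"
    using assms by (simp add: eq)
  moreover have "2 / (1 + (cmod z)\<^sup>2) \<noteq> 0" using pos[of z] by (simp add: add.commute)
  ultimately show ?thesis by (metis mult_left_cancel of_real_eq_0_iff)
qed

lemma inj_stereo: "inj stereo"
proof (rule injI)
  fix x y assume "stereo x = stereo y"
  then show "x = y"
    by (cases x; cases y) (metis stereo_Fin_inj stereo_Fin_neq_Infty)+
qed

instantiation rsphere :: metric_space
begin

definition dist_rsphere :: "rsphere \<Rightarrow> rsphere \<Rightarrow> real" where
  "dist_rsphere x y = dist (stereo x) (stereo y)"

definition uniformity_rsphere :: "(rsphere \<times> rsphere) filter" where
  "uniformity_rsphere = (INF e\<in>{0<..}. principal {(x, y). dist x y < e})"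

definition open_rsphere :: "rsphere set \<Rightarrow> bool" where
  "open_rsphere U \<longleftrightarrow> (\<forall>x\<in>U. eventually (\<lambda>(x', y). x' = x \<longrightarrow> y \<in> U) uniformity)"

instance
proof
  fix x y z :: rsphere
  show "dist x y = 0 \<longleftrightarrow> x = y"
    using inj_stereo by (auto simp: dist_rsphere_def inj_eq)
  show "dist x y \<le> dist x z + dist y z"
    by (simp add: dist_rsphere_def dist_triangle2)
qed (simp_all add: uniformity_rsphere_def open_rsphere_def)

end

lemma dist_rsphere_Fin_Fin:
  "dist (Fin z) (Fin w) = 2 * cmod (z - w) / (sqrt (1 + (cmod z)\<^sup>2) * sqrt (1 + (cmod w)\<^sup>2))"
proof -
  define A B where "A = 1 + (cmod z)\<^sup>2" and "B = 1 + (cmod w)\<^sup>2"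
  have pos: "A > 0" "B > 0" by (simp_all add: A_def B_def add_pos_nonneg)
  have A: "(Re z)\<^sup>2 + (Im z)\<^sup>2 = A - 1" and B: "(Re w)\<^sup>2 + (Im w)\<^sup>2 = B - 1"
    by (simp_all add: A_def B_def cmod_power2)
  have "(dist (Fin z) (Fin w))\<^sup>2 =
      (cmod (of_real (2 / A) * z - of_real (2 / B) * w))\<^sup>2 + ((A - 2) / A - (B - 2) / B)\<^sup>2"
    by (simp add: dist_rsphere_def norm_Pair dist_norm A_def B_def add.commute)
  also have "\<dots> = (2 / A * Re z - 2 / B * Re w)\<^sup>2 + (2 / A * Im z - 2 / B * Im w)\<^sup>2
      + ((A - 2) / A - (B - 2) / B)\<^sup>2"
    by (simp add: cmod_power2)
  also have "\<dots> = 4 / A\<^sup>2 * ((Re z)\<^sup>2 + (Im z)\<^sup>2) + 4 / B\<^sup>2 * ((Re w)\<^sup>2 + (Im w)\<^sup>2)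
      - 8 / (A * B) * (Re z * Re w + Im z * Im w) + (2 / B - 2 / A)\<^sup>2"
  proof -
    have "(A - 2) / A - (B - 2) / B = 2 / B - 2 / A"
      using pos by (simp add: field_simps)
    then show ?thesis by (simp only:) (simp add: power2_eq_square algebra_simps)
  qed
  also have "\<dots> = 4 * ((A - 1) + (B - 1) - 2 * (Re z * Re w + Im z * Im w)) / (A * B)"
    unfolding A B using pos by (simp add: field_simps power2_eq_square)
  also have "\<dots> = 4 * (cmod (z - w))\<^sup>2 / (A * B)"
    unfolding A [symmetric] B [symmetric] cmod_power2 by (simp add: power2_eq_square algebra_simps)
  also have "\<dots> = (2 * cmod (z - w) / (sqrt A * sqrt B))\<^sup>2"
    using pos by (simp add: power_divide power_mult_distrib)
  finally have "dist (Fin z) (Fin w) = 2 * cmod (z - w) / (sqrt A * sqrt B)"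
    using pos by (subst (asm) power2_eq_iff_nonneg) simp_all
  then show ?thesis by (simp add: A_def B_def)
qed

lemma dist_rsphere_Fin_Infty: "dist (Fin z) Infty = 2 / sqrt (1 + (cmod z)\<^sup>2)"
proof -
  define A where "A = 1 + (cmod z)\<^sup>2"
  have pos: "A > 0" by (simp add: A_def add_pos_nonneg)
  have A: "(cmod z)\<^sup>2 = A - 1" by (simp add: A_def)
  have "(dist (Fin z) Infty)\<^sup>2 = (cmod (of_real (2 / A) * z))\<^sup>2 + ((A - 2) / A - 1)\<^sup>2"
    by (simp add: dist_rsphere_def norm_Pair dist_norm A_def add.commute)
  also have "\<dots> = 4 / A\<^sup>2 * (A - 1) + ((A - 2) / A - 1)\<^sup>2"
    by (simp add: norm_mult power_mult_distrib norm_divide power_divide A)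
  also have "\<dots> = (2 / sqrt A)\<^sup>2"
    using pos by (simp add: power_divide) (simp add: field_simps power2_eq_square)
  finally have "dist (Fin z) Infty = 2 / sqrt A"
    using pos by (subst (asm) power2_eq_iff_nonneg) simp_all
  then show ?thesis by (simp add: A_def)
qed


section \<open>Rational maps of the sphere\<close>

text \<open>
  A rational map is an element of the field \<open>\<complex>(X)\<close>.  Its action on the sphere is read
  off from a reduced fraction \<open>P/Q\<close> (\<open>quot_of_fract\<close> returns coprime \<open>P\<close> and monic \<open>Q\<close>), so
  \<open>P\<close> and \<open>Q\<close> have no common zero and \<open>Q z = 0\<close> means a pole at \<open>z\<close>.  The value at \<open>Infty\<close> is
  the limit of \<open>P z / Q z\<close>, i.e. the quotient of the coefficients of degree
  \<open>max (degree P) (degree Q)\<close>.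
\<close>

definition rat_map :: "complex poly fract \<Rightarrow> rsphere \<Rightarrow> rsphere" where
  "rat_map R x =
     (let (P, Q) = quot_of_fract R; d = max (degree P) (degree Q) in
      case x of
        Fin z \<Rightarrow> if poly Q z = 0 then Infty else Fin (poly P z / poly Q z)
      | Infty \<Rightarrow> if coeff Q d = 0 then Infty else Fin (coeff P d / coeff Q d))"

lemma rat_map_divide_Fin:
  assumes "poly q z \<noteq> 0"
  shows "rat_map (to_fract p / to_fract q) (Fin z) = Fin (poly p z / poly q z)"
proof -
  have q: "q \<noteq> 0" using assms by auto
  have "to_fract p / to_fract q = quot_to_fract (p, q)"
    by (simp add: to_fract_def quot_to_fract_def)
  then have quot: "quot_of_fract (to_fract p / to_fract q) = normalize_quot (p, q)"
    using q by (simp add: quot_of_fract_quot_to_fract)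
  obtain d where d: "p = fst (normalize_quot (p, q)) * d" "q = snd (normalize_quot (p, q)) * d"
    using normalize_quotE [OF q] by metis
  define P Q where "P = fst (normalize_quot (p, q))" and "Q = snd (normalize_quot (p, q))"
  have pq: "p = P * d" "q = Q * d" using d by (simp_all add: P_def Q_def)
  then have "poly Q z \<noteq> 0" "poly d z \<noteq> 0" using assms by auto
  moreover have "quot_of_fract (to_fract p / to_fract q) = (P, Q)"
    by (simp add: quot P_def Q_def)
  ultimately show ?thesis by (simp add: rat_map_def Let_def pq)
qed

lemma rat_map_to_fract_Fin [simp]: "rat_map (to_fract p) (Fin z) = Fin (poly p z)"
  using rat_map_divide_Fin [of 1 z p] by simp

text \<open>The coordinate change \<open>z \<mapsto> 1/z\<close> of the sphere.\<close>

primrec rsphere_inv :: "rsphere \<Rightarrow> rsphere" where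
  "rsphere_inv (Fin z) = (if z = 0 then Infty else Fin (1 / z))"
| "rsphere_inv Infty = Fin 0"

text \<open>The value of \<open>fin_part\<close> at \<open>Infty\<close> is irrelevant: it is only used near points of \<open>\<complex>\<close>.\<close>

primrec fin_part :: "rsphere \<Rightarrow> complex" where
  "fin_part (Fin z) = z"
| "fin_part Infty = 0"

text \<open>Fixed points with multiplier \<open>0\<close>; at \<open>Infty\<close> the multiplier is computed in the
  coordinate \<open>1/z\<close>.\<close>

definition superattracting_fixed_point :: "(rsphere \<Rightarrow> rsphere) \<Rightarrow> rsphere \<Rightarrow> bool" where
  "superattracting_fixed_point f x \<longleftrightarrow> f x = x \<and>
     (case x of
        Fin z \<Rightarrow> ((\<lambda>w. fin_part (f (Fin w))) has_field_derivative 0) (at z)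
      | Infty \<Rightarrow> ((\<lambda>w. fin_part (rsphere_inv (f (rsphere_inv (Fin w)))))
                    has_field_derivative 0) (at 0))"

definition basin :: "(rsphere \<Rightarrow> rsphere) \<Rightarrow> rsphere \<Rightarrow> rsphere set" where
  "basin f x = {y. (\<lambda>n. (f ^^ n) y) \<longlonglongrightarrow> x}"


section \<open>Fatou and Julia sets\<close>

definition iterates_equicontinuous_at :: "(rsphere \<Rightarrow> rsphere) \<Rightarrow> rsphere \<Rightarrow> bool" where
  "iterates_equicontinuous_at f x \<longleftrightarrow>
     (\<forall>e>0. \<exists>d>0. \<forall>n. \<forall>y. dist y x < d \<longrightarrow> dist ((f ^^ n) y) ((f ^^ n) x) < e)"

definition Fatou_set :: "(rsphere \<Rightarrow> rsphere) \<Rightarrow> rsphere set" where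
  "Fatou_set f =
     {x. \<exists>U. open U \<and> x \<in> U \<and> (\<forall>y\<in>U. iterates_equicontinuous_at f y)}"

definition Julia_set :: "(rsphere \<Rightarrow> rsphere) \<Rightarrow> rsphere set" where
  "Julia_set f = - Fatou_set f"


section \<open>Symmetry groups\<close>

definition hol_isometry :: "(complex \<Rightarrow> complex) \<Rightarrow> bool" where
  "hol_isometry \<sigma> \<longleftrightarrow> (\<exists>\<alpha> \<beta>. cmod \<alpha> = 1 \<and> \<sigma> = (\<lambda>z. \<alpha> * z + \<beta>))"

text \<open>An isometry of \<open>\<complex>\<close> acts on the sphere by fixing \<open>Infty\<close>, which may lie in the Julia set.\<close>

primrec extend :: "(complex \<Rightarrow> complex) \<Rightarrow> rsphere \<Rightarrow> rsphere" where
  "extend \<sigma> (Fin z) = Fin (\<sigma> z)"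
| "extend \<sigma> Infty = Infty"

definition symmetry_group :: "complex poly fract \<Rightarrow> (complex \<Rightarrow> complex) set" where
  "symmetry_group R =
     {\<sigma>. hol_isometry \<sigma> \<and> extend \<sigma> ` Julia_set (rat_map R) = Julia_set (rat_map R)}"


section \<open>Chebyshev's method\<close>

definition L_fract :: "complex poly \<Rightarrow> complex poly fract" where
  "L_fract p = to_fract p * to_fract (pderiv (pderiv p)) / (to_fract (pderiv p))\<^sup>2"

definition chebyshev :: "complex poly \<Rightarrow> complex poly fract" where
  "chebyshev p =
     to_fract [:0, 1:] - (1 + 1 / 2 * L_fract p) * (to_fract p / to_fract (pderiv p))"

lemma rat_map_chebyshev_Fin:
  assumes "poly (pderiv p) z \<noteq> 0"
  defines "L \<equiv> poly p z * poly (pderiv (pderiv p)) z / (poly (pderiv p) z)\<^sup>2"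
  shows "rat_map (chebyshev p) (Fin z) =
    Fin (z - (1 + 1 / 2 * L) * (poly p z / poly (pderiv p) z))"
proof -
  define q r where "q = pderiv p" and "r = pderiv q"
  have q: "poly q z \<noteq> 0" using assms(1) by (simp add: q_def)
  then have q': "to_fract q \<noteq> 0" by auto
  have "chebyshev p = to_fract (2 * [:0, 1:] * q ^ 3 - (2 * q\<^sup>2 + p * r) * p) / to_fract (2 * q ^ 3)"
  proof -
    have two: "to_fract (2 :: complex poly) = 2"
      by (metis one_add_one to_fract_1 to_fract_add)
    have nz: "(2 :: complex poly fract) \<noteq> 0"
      using two by (metis to_fract_eq_0_iff zero_neq_numeral)
    define X where "X = ([:0, 1:] :: complex poly)"
    show ?thesis
      unfolding chebyshev_def L_fract_def q_def [symmetric] r_def [symmetric] X_def [symmetric]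
      using q' nz by (simp add: two power3_eq_cube power2_eq_square divide_simps)
  qed
  moreover have "poly (2 * q ^ 3) z \<noteq> 0" using q by simp
  ultimately have "rat_map (chebyshev p) (Fin z) =
      Fin (poly (2 * [:0, 1:] * q ^ 3 - (2 * q\<^sup>2 + p * r) * p) z / poly (2 * q ^ 3) z)"
    by (metis rat_map_divide_Fin)
  then show ?thesis
    using q by (simp add: L_def field_simps eval_nat_numeral add: q_def r_def)
qed

definition p_poly :: "real \<Rightarrow> complex poly" where
  "p_poly a = ([:0, 1:]\<^sup>2 - 1) * ([:0, 1:]\<^sup>2 - [:of_real a:])"

end

theory Submission
  imports Defs
begin

text \<open>
  Both symmetry groups are \<open>{z \<mapsto> z, z \<mapsto> -z}\<close>.

  For the polynomial \<open>p\<close>, the maximum principle shows that a symmetry \<open>\<sigma>\<close> of the Julia set maps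
  the filled Julia set into itself, and a Bernstein--Walsh argument then compares escape rates:
  \<open>|p (\<sigma> z)| \<le> (1 + O(|z|\<^sup>-\<^sup>6)) |p z|\<close> near infinity.  As \<open>p (\<sigma> z) / p z\<close> is a rational function of
  \<open>1 / z\<close>, its first two coefficients can satisfy this in every direction only if \<open>\<sigma> z = \<plusminus>z\<close>.

  For Chebyshev's method \<open>C\<close> the hypothesis makes the Julia set \<open>J\<close> the complement of the basins, so
  it is completely invariant, contains the imaginary axis (which \<open>C\<close> preserves and which carries no
  superattracting fixed point), but no real \<open>x\<close> with \<open>|x| > 1\<close>.  Infinity is a repelling fixed point
  of \<open>C\<close>.  In its linearizing coordinate \<open>w\<close>, \<open>J\<close> becomes a closed set \<open>S\<close> invariant under scaling by
  the multiplier, and a symmetry \<open>z \<mapsto> \<alpha> z + \<beta>\<close> of \<open>J\<close> becomes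
  \<open>w \<mapsto> w/\<alpha> (1 - (\<beta>/\<alpha>) w + \<dots>)\<close>, or, for \<open>\<beta> = 0\<close>, \<open>w \<mapsto> w/\<alpha> (1 + b (\<alpha>\<^sup>-\<^sup>2 - 1) w\<^sup>2 + \<dots>)\<close> with \<open>b > 0\<close>.
  Rescaling shows that \<open>S\<close> is invariant under \<open>w \<mapsto> w/\<alpha>\<close>, so the remaining factor must not push the
  ray of \<open>S\<close> closest to the real axis any closer.  Applied to that ray and its mirror images this
  forces \<open>\<alpha> = \<plusminus>1\<close> if \<open>\<beta> = 0\<close>.  If \<open>\<beta> \<noteq> 0\<close>, it forces \<open>S\<close> and hence \<open>J\<close> near infinity into the
  imaginary axis, which is absurd because \<open>J\<close> contains a real pole of \<open>C\<close> and is invariant under a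
  translation.
\<close>

section \<open>Topology of the sphere and symmetries of Julia sets\<close>

lemma dist_stereo: "dist (stereo x) (stereo y) = dist x y"
  by (simp add: dist_rsphere_def)

lemma continuous_on_stereo [continuous_intros]: "continuous_on A stereo"
  by (auto simp: continuous_on_iff dist_stereo)

text \<open>This is projection from the north pole. Written through \<open>stereo\<close> it yields
  continuity of \<open>fin_part\<close> on the finite points; at \<open>Infty\<close> both sides are
  0, the right one by division by zero.\<close>

lemma fin_part_stereo: "fin_part x = fst (stereo x) / of_real (1 - snd (stereo x))"
proof (cases x)
  case (Fin z)
  have pos: "1 + (cmod z)\<^sup>2 > 0" by (simp add: add_pos_nonneg)
  have "1 - ((cmod z)\<^sup>2 - 1) / ((cmod z)\<^sup>2 + 1) = 2 / (1 + (cmod z)\<^sup>2)"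
    using pos by (simp add: divide_simps add.commute)
  moreover have "complex_of_real (2 / (1 + (cmod z)\<^sup>2)) \<noteq> 0"
    using pos by (metis divide_eq_0_iff less_irrefl of_real_eq_0_iff zero_neq_numeral)
  ultimately show ?thesis using Fin
    by (simp only: stereo.simps fst_conv snd_conv fin_part.simps) simp
qed simp

lemma dist_Fin_le: "dist (Fin z) (Fin w) \<le> 2 * dist z w"
proof -
  have "1 \<le> sqrt (1 + (cmod z)\<^sup>2) * sqrt (1 + (cmod w)\<^sup>2)"
    using mult_mono[of 1 "sqrt (1 + (cmod z)\<^sup>2)" 1 "sqrt (1 + (cmod w)\<^sup>2)"] by simp
  then show ?thesis
    unfolding dist_rsphere_Fin_Fin dist_norm
    by (simp add: divide_le_eq mult_left_mono mult_le_cancel_left1 mult_ac)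
qed

lemma continuous_on_Fin: "continuous_on A Fin"
proof -
  have "2-lipschitz_on A Fin"
    by (rule lipschitz_onI) (auto intro: dist_Fin_le)
  then show ?thesis by (rule lipschitz_on_continuous_on)
qed

lemma isCont_Fin: "isCont Fin z"
  using continuous_on_Fin[of UNIV] continuous_on_eq_continuous_at by blast

lemma tendsto_Fin: "(f \<longlongrightarrow> z) F \<Longrightarrow> ((\<lambda>x. Fin (f x)) \<longlongrightarrow> Fin z) F"
  using isCont_Fin isCont_tendsto_compose by blast

lemma open_range_Fin: "open (range Fin)"
proof -
  have "range Fin = - {Infty}"
    by (auto) (metis rangeI rsphere.exhaust)
  then show ?thesis using open_Compl[OF closed_singleton] by metis
qed

lemma continuous_on_fin_part: "continuous_on (range Fin) fin_part"
proof -
  have "snd (stereo x) \<noteq> 1" if x: "x \<in> range Fin" for x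
  proof -
    obtain z where [simp]: "x = Fin z" using x by auto
    have "(cmod z)\<^sup>2 + 1 > 0" by (simp add: add_nonneg_pos)
    then show ?thesis by (simp add: divide_simps)
  qed
  then show ?thesis
    unfolding fin_part_stereo
    by (intro continuous_intros) (auto simp: of_real_eq_0_iff[of "1 - _", simplified])
qed

lemma open_Fin_image: "open U \<Longrightarrow> open (Fin ` U)"
proof -
  assume "open U"
  then have "open (fin_part -` U \<inter> range Fin)"
    using continuous_on_fin_part open_range_Fin continuous_on_open_vimage by blast
  moreover have "fin_part -` U \<inter> range Fin = Fin ` U" by auto
  ultimately show ?thesis by simp
qed

lemma open_Fatou_set: "open (Fatou_set f)"
proof -
  have "Fatou_set f = \<Union> {U. open U \<and> (\<forall>y\<in>U. iterates_equicontinuous_at f y)}"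
    by (auto simp: Fatou_set_def)
  then show ?thesis by auto
qed

text \<open>The condition on the iterates concerns distances between orbits, so it covers both maps
  that commute with \<tau> and maps with \<open>f (\<tau> x) = f x\<close>; the odd map C and the
  even polynomial p are of these two kinds.\<close>

lemma equicontinuous_isometry:
  assumes iso: "\<And>x y. dist (\<tau> x) (\<tau> y) = dist x y" and surj: "\<And>x. \<tau> (\<tau> x) = x"
    and it: "\<And>n x y. dist ((f ^^ n) (\<tau> x)) ((f ^^ n) (\<tau> y)) = dist ((f ^^ n) x) ((f ^^ n) y)"
    and "iterates_equicontinuous_at f x"
  shows "iterates_equicontinuous_at f (\<tau> x)"
  unfolding iterates_equicontinuous_at_def
proof (intro allI impI)
  fix e :: real assume "e > 0"
  then obtain d where d: "d > 0"
    "\<And>n y. dist y x < d \<Longrightarrow> dist ((f ^^ n) y) ((f ^^ n) x) < e"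
    using assms(4) unfolding iterates_equicontinuous_at_def by meson
  have "dist ((f ^^ n) y) ((f ^^ n) (\<tau> x)) < e" if "dist y (\<tau> x) < d" for n y
    using d(2)[of "\<tau> y" n] that it[of n "\<tau> y" x] iso[of "\<tau> y" x] surj[of y] by simp
  then show "\<exists>d>0. \<forall>n y. dist y (\<tau> x) < d \<longrightarrow> dist ((f ^^ n) y) ((f ^^ n) (\<tau> x)) < e"
    using d(1) by blast
qed

text \<open>An isometry pulls a neighbourhood of equicontinuity back to another one. As \<tau> is an
  involution, one inclusion of Fatou sets gives both.\<close>

lemma Julia_set_isometry:
  assumes iso: "\<And>x y. dist (\<tau> x) (\<tau> y) = dist x y" and surj: "\<And>x. \<tau> (\<tau> x) = x"
    and it: "\<And>n x y. dist ((f ^^ n) (\<tau> x)) ((f ^^ n) (\<tau> y)) = dist ((f ^^ n) x) ((f ^^ n) y)"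
  shows "\<tau> x \<in> Julia_set f \<longleftrightarrow> x \<in> Julia_set f"
proof -
  have *: "\<tau> x \<in> Fatou_set f" if x: "x \<in> Fatou_set f" for x
  proof -
    obtain U where U: "open U" "x \<in> U" "\<forall>y\<in>U. iterates_equicontinuous_at f y"
      using x by (auto simp: Fatou_set_def)
    have "continuous_on UNIV \<tau>" by (auto simp: continuous_on_iff iso)
    then have "open (\<tau> -` U)" using U(1) open_vimage by blast
    moreover have "\<tau> x \<in> \<tau> -` U" using U surj by simp
    moreover have "iterates_equicontinuous_at f y" if "y \<in> \<tau> -` U" for y
      using equicontinuous_isometry[OF iso surj it, of "\<tau> y"] U(3) that surj by fastforce
    ultimately show ?thesis unfolding Fatou_set_def by blast
  qed
  show ?thesis using *[of x] *[of "\<tau> x"] surj[of x] by (auto simp: Julia_set_def)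
qed

lemma extend_involution: "(\<And>z. \<tau> (\<tau> z) = z) \<Longrightarrow> extend \<tau> (extend \<tau> x) = x"
  by (cases x) auto

lemma dist_extend:
  assumes "\<And>z w. cmod (\<tau> z - \<tau> w) = cmod (z - w)" "\<And>z. cmod (\<tau> z) = cmod z"
  shows "dist (extend \<tau> x) (extend \<tau> y) = dist x y"
  by (cases x; cases y)
     (simp_all add: dist_rsphere_Fin_Fin dist_rsphere_Fin_Infty assms dist_commute[of Infty])

lemma dist_extend_uminus: "dist (extend uminus x) (extend uminus y) = dist x y"
  by (rule dist_extend) (simp_all add: norm_minus_commute)

lemma dist_extend_cnj: "dist (extend cnj x) (extend cnj y) = dist x y"
  by (rule dist_extend) (metis complex_cnj_diff complex_mod_cnj, simp)

text \<open>\<open>extend\<close> fixes \<open>Infty\<close> and permutes the finite points, so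
  equality of the image with the Julia set can be tested on finite points.\<close>

lemma symmetry_group_iff:
  assumes "cmod \<alpha> = 1"
  shows "(\<lambda>z. \<alpha> * z + \<beta>) \<in> symmetry_group R \<longleftrightarrow>
    (\<forall>z. Fin (\<alpha> * z + \<beta>) \<in> Julia_set (rat_map R) \<longleftrightarrow> Fin z \<in> Julia_set (rat_map R))"
    (is "?s \<in> _ \<longleftrightarrow> _")
proof -
  define J where "J = Julia_set (rat_map R)"
  have a: "\<alpha> \<noteq> 0" using assms by auto
  have surj: "\<exists>w. \<alpha> * w + \<beta> = z" for z
    using a by (intro exI[of _ "(z - \<beta>) / \<alpha>"]) simp
  have "extend ?s ` J = J \<longleftrightarrow> (\<forall>z. Fin (\<alpha> * z + \<beta>) \<in> J \<longleftrightarrow> Fin z \<in> J)"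
  proof
    assume *: "extend ?s ` J = J"
    show "\<forall>z. Fin (\<alpha> * z + \<beta>) \<in> J \<longleftrightarrow> Fin z \<in> J"
    proof
      fix z
      have "Fin z \<in> J" if h: "Fin (\<alpha> * z + \<beta>) \<in> J"
      proof -
        obtain x where x: "x \<in> J" "Fin (\<alpha> * z + \<beta>) = extend ?s x" using * h by blast
        then show ?thesis using a by (cases x) auto
      qed
      moreover have "Fin (\<alpha> * z + \<beta>) \<in> J" if "Fin z \<in> J"
        using * imageI[OF that, of "extend ?s"] by simp
      ultimately show "Fin (\<alpha> * z + \<beta>) \<in> J \<longleftrightarrow> Fin z \<in> J" by blast
    qed
  next
    assume *: "\<forall>z. Fin (\<alpha> * z + \<beta>) \<in> J \<longleftrightarrow> Fin z \<in> J"
    show "extend ?s ` J = J"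
    proof (intro equalityI subsetI)
      fix x assume "x \<in> extend ?s ` J"
      then obtain y where "y \<in> J" "x = extend ?s y" by blast
      then show "x \<in> J" using * by (cases y) auto
    next
      fix x assume x: "x \<in> J"
      show "x \<in> extend ?s ` J"
      proof (cases x)
        case (Fin z)
        then obtain w where "\<alpha> * w + \<beta> = z" using surj by blast
        then show ?thesis using * x Fin by (intro image_eqI[of _ _ "Fin w"]) auto
      next
        case Infty
        then show ?thesis using x by (intro image_eqI[of _ _ Infty]) auto
      qed
    qed
  qed
  then show ?thesis
    using assms unfolding symmetry_group_def hol_isometry_def J_def by blast
qed

section \<open>The symmetry group of the polynomial\<close>

definition pf :: "real \<Rightarrow> complex \<Rightarrow> complex" where
  "pf a z = z ^ 4 - of_real (1 + a) * z\<^sup>2 + of_real a"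

lemma poly_p_poly: "poly (p_poly a) z = pf a z"
  by (simp add: p_poly_def pf_def algebra_simps power2_eq_square power4_eq_xxxx)

lemma rat_map_p_poly_iterate: "(rat_map (to_fract (p_poly a)) ^^ n) (Fin z) = Fin ((pf a ^^ n) z)"
  by (induction n) (simp_all add: poly_p_poly)

lemma funpow_add_apply: "(f ^^ (m + n)) x = (f ^^ m) ((f ^^ n) x)"
  by (simp add: funpow_add)

section \<open>Escape to infinity under the polynomial and its filled Julia set\<close>

context
  fixes a :: real
  assumes a: "0 < a" "a < 1"
begin

lemma pf_ratio:
  assumes "cmod z \<ge> 3"
  shows "cmod (pf a z / z ^ 4 - 1) \<le> 3 / (cmod z)\<^sup>2"
proof -
  have z: "z \<noteq> 0" using assms by auto
  have "pf a z / z ^ 4 - 1 = (of_real a - of_real (1 + a) * z\<^sup>2) / z ^ 4"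
    using z by (simp add: pf_def field_simps)
  also have "cmod \<dots> \<le> (a + (1 + a) * (cmod z)\<^sup>2) / cmod z ^ 4"
    unfolding norm_divide norm_power
    using a norm_triangle_ineq4[of "of_real a" "of_real (1 + a) * z\<^sup>2"]
    by (intro divide_right_mono) (simp_all add: norm_mult norm_power del: of_real_add)
  also have "\<dots> \<le> (3 * (cmod z)\<^sup>2) / cmod z ^ 4"
  proof (rule divide_right_mono)
    have "1 \<le> (cmod z)\<^sup>2" using assms by (simp add: power_mono[of 1 "cmod z" 2, simplified])
    moreover have "(1 + a) * (cmod z)\<^sup>2 \<le> 2 * (cmod z)\<^sup>2"
      using a by (intro mult_right_mono) auto
    ultimately show "a + (1 + a) * (cmod z)\<^sup>2 \<le> 3 * (cmod z)\<^sup>2" using a by linarith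
  qed simp
  also have "\<dots> = 3 / (cmod z)\<^sup>2"
    using z by (simp add: power2_eq_square power4_eq_xxxx)
  finally show ?thesis .
qed

lemma three_over_sq: "cmod z \<ge> 3 \<Longrightarrow> 3 / (cmod z)\<^sup>2 \<le> 1 / 3"
  using power_mono[of 3 "cmod z" 2] by (cases "z = 0") (simp_all add: divide_le_eq_1)

text \<open>Besides giving escape, the cubic bound turns an error of order |p z|^-2 into one of
  order |z|^-6, which is what the later comparison of escape rates needs.\<close>

lemma pf_ge:
  assumes "cmod z \<ge> 3"
  shows "cmod (pf a z) \<ge> cmod z ^ 3"
proof -
  have z: "z \<noteq> 0" using assms by auto
  have "1 - 1 / 3 \<le> cmod (pf a z / z ^ 4)"
    using norm_triangle_ineq3[of "pf a z / z ^ 4" 1] pf_ratio[OF assms] three_over_sq[OF assms]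
    by simp
  then have "2 / 3 * cmod z ^ 4 \<le> cmod (pf a z)"
    using z by (simp add: norm_divide norm_power field_simps)
  moreover have "cmod z ^ 3 \<le> 2 / 3 * cmod z ^ 4"
  proof -
    have "3 * cmod z ^ 3 \<le> cmod z * cmod z ^ 3" using assms by (intro mult_right_mono) auto
    moreover have "cmod z * cmod z ^ 3 = cmod z ^ 4" by (simp add: eval_nat_numeral)
    moreover have "0 \<le> cmod z ^ 3" by simp
    ultimately show ?thesis by linarith
  qed
  ultimately show ?thesis by linarith
qed

lemma pf_ge2:
  assumes "cmod z \<ge> 3"
  shows "cmod (pf a z) \<ge> 2 * cmod z"
proof -
  have "2 * cmod z \<le> 3 * 3 * cmod z" by simp
  also have "\<dots> \<le> cmod z * cmod z * cmod z"
    using assms by (intro mult_right_mono mult_mono) auto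
  finally show ?thesis using pf_ge[OF assms] by (simp add: power3_eq_cube)
qed

lemma pf_iter_ge: "cmod z \<ge> 3 \<Longrightarrow> cmod ((pf a ^^ n) z) \<ge> 2 ^ n * cmod z"
proof (induction n)
  case (Suc n)
  have "1 * cmod z \<le> 2 ^ n * cmod z" by (intro mult_right_mono) auto
  then have "cmod ((pf a ^^ n) z) \<ge> 3" using Suc by linarith
  from pf_ge2[OF this] Suc show ?case by simp
qed simp

lemma pf_iter_ge1: "cmod z \<ge> 3 \<Longrightarrow> cmod ((pf a ^^ n) z) \<ge> cmod z"
  using pf_iter_ge[of z n] mult_right_mono[of 1 "2 ^ n" "cmod z"] by simp

lemma pf_iter_gt3: "cmod ((pf a ^^ n) z) > 3 \<Longrightarrow> n \<le> m \<Longrightarrow> cmod ((pf a ^^ m) z) > 3"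
  using pf_iter_ge1[of "(pf a ^^ n) z" "m - n"] by (simp flip: funpow_add_apply)

lemma ln_pf:
  assumes "cmod z \<ge> 3"
  shows "\<bar>ln (cmod (pf a z)) - 4 * ln (cmod z)\<bar> \<le> 6 / (cmod z)\<^sup>2"
proof -
  have z: "z \<noteq> 0" using assms by auto
  have p: "cmod (pf a z) > 0" using pf_ge2[OF assms] assms by linarith
  define x where "x = cmod (pf a z / z ^ 4) - 1"
  have x: "\<bar>x\<bar> \<le> 3 / (cmod z)\<^sup>2"
    using norm_triangle_ineq3[of "pf a z / z ^ 4" 1] pf_ratio[OF assms] by (simp add: x_def)
  then have "\<bar>x\<bar> \<le> 1 / 2" using three_over_sq[OF assms] by linarith
  then have "\<bar>ln (1 + x)\<bar> \<le> 2 * \<bar>x\<bar>"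
    using abs_ln_one_plus_x_minus_x_bound[of x] mult_right_mono[of "\<bar>x\<bar>" "1/2" "\<bar>x\<bar>"]
    by (simp add: power2_eq_square abs_mult_self)
  moreover have "ln (1 + x) = ln (cmod (pf a z)) - 4 * ln (cmod z)"
    using p z by (simp add: x_def norm_divide norm_power ln_div ln_realpow)
  ultimately show ?thesis using x by simp
qed

text \<open>The limit of ln |p^n z| / 4^n is the Green function. Since |p^n z| \<ge> |z|, its n-th
  increment is at most 6 / (4^(n+1) |z|^2) by \<open>ln_pf\<close>, and these increments form a
  geometric series.\<close>

lemma ln_pf_iter:
  assumes "cmod z \<ge> 3"
  shows "\<bar>ln (cmod ((pf a ^^ n) z)) / 4 ^ n - ln (cmod z)\<bar> \<le> 2 * (1 - 1 / 4 ^ n) / (cmod z)\<^sup>2"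
proof (induction n)
  case (Suc n)
  define w where "w = (pf a ^^ n) z"
  have w: "cmod w \<ge> cmod z" using pf_iter_ge1[OF assms] by (simp add: w_def)
  have "\<bar>ln (cmod (pf a w)) / 4 ^ Suc n - ln (cmod w) / 4 ^ n\<bar>
      = \<bar>ln (cmod (pf a w)) - 4 * ln (cmod w)\<bar> / 4 ^ Suc n"
  proof -
    have "ln (cmod (pf a w)) / 4 ^ Suc n - ln (cmod w) / 4 ^ n
      = (ln (cmod (pf a w)) - 4 * ln (cmod w)) / 4 ^ Suc n" by (simp add: field_simps)
    then show ?thesis by (simp add: abs_divide)
  qed
  also have "\<dots> \<le> (6 / (cmod w)\<^sup>2) / 4 ^ Suc n"
    using ln_pf[of w] assms w by (intro divide_right_mono) auto
  also have "\<dots> \<le> (6 / (cmod z)\<^sup>2) / 4 ^ Suc n"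
    using w assms by (intro divide_right_mono divide_left_mono power_mono mult_pos_pos) auto
  finally have "\<bar>ln (cmod (pf a w)) / 4 ^ Suc n - ln (cmod w) / 4 ^ n\<bar> \<le> \<dots>" .
  moreover have "(6 / (cmod z)\<^sup>2) / 4 ^ Suc n + 2 * (1 - 1 / 4 ^ n) / (cmod z)\<^sup>2
      = 2 * (1 - 1 / 4 ^ Suc n) / (cmod z)\<^sup>2"
    using assms by (cases "cmod z = 0") (auto simp: field_simps)
  ultimately show ?case using Suc by (simp add: w_def)
qed simp

lemma ln_pf_iter':
  assumes "cmod z \<ge> 3"
  shows "\<bar>ln (cmod ((pf a ^^ n) z)) / 4 ^ n - ln (cmod z)\<bar> \<le> 2 / (cmod z)\<^sup>2"
proof -
  have "2 * (1 - 1 / 4 ^ n) / (cmod z)\<^sup>2 \<le> 2 / (cmod z)\<^sup>2"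
    by (intro divide_right_mono) auto
  then show ?thesis using ln_pf_iter[OF assms, of n] by linarith
qed

lemma continuous_on_pf_iter: "continuous_on A (pf a ^^ n)"
proof (induction n)
  case (Suc n)
  have "continuous_on ((pf a ^^ n) ` A) (pf a)" unfolding pf_def by (intro continuous_intros)
  then show ?case using Suc continuous_on_compose by fastforce
qed (simp add: id_def)

lemma holomorphic_pf_iter: "(pf a ^^ n) holomorphic_on A"
proof (induction n)
  case (Suc n)
  have "(\<lambda>z. pf a ((pf a ^^ n) z)) holomorphic_on A"
    unfolding pf_def[of a "_ z" for z] by (intro holomorphic_intros Suc)
  then show ?case by (simp add: o_def)
qed (simp add: id_def)

text \<open>The radius 3 characterizes bounded orbits: by \<open>pf_iter_ge\<close> an orbit that
  once exceeds modulus 3 tends to infinity.\<close>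

definition filled_Julia :: "complex set" where "filled_Julia = {z. \<forall>n. cmod ((pf a ^^ n) z) \<le> 3}"

lemma closed_filled_Julia: "closed filled_Julia"
proof -
  have "filled_Julia = (\<Inter>n. {z. cmod ((pf a ^^ n) z) \<le> 3})" by (auto simp: filled_Julia_def)
  also have "closed \<dots>"
    by (intro closed_INT ballI closed_Collect_le continuous_intros continuous_on_pf_iter)
  finally show ?thesis .
qed

lemma bounded_filled_Julia: "bounded filled_Julia"
proof -
  have "filled_Julia \<subseteq> cball 0 3" unfolding filled_Julia_def by (auto dest: spec[of _ 0])
  then show ?thesis using bounded_subset bounded_cball by blast
qed

text \<open>Arbitrarily close to a frontier point there are escaping points, while its own orbit
  stays in the disc of radius 3; this contradicts equicontinuity.\<close>

lemma frontier_filled_Julia_subset_Julia: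
  assumes "z \<in> frontier filled_Julia"
  shows "Fin z \<in> Julia_set (rat_map (to_fract (p_poly a)))"
proof (rule ccontr)
  let ?f = "rat_map (to_fract (p_poly a))"
  assume "Fin z \<notin> Julia_set ?f"
  then have eq: "iterates_equicontinuous_at ?f (Fin z)"
    by (auto simp: Julia_set_def Fatou_set_def)
  have zK: "z \<in> filled_Julia" using assms closed_filled_Julia frontier_subset_closed by blast
  \<comment> \<open>Points of modulus at most 3 have chordal distance at least 2 / sqrt 10 = 2e from
    \<open>Infty\<close>.\<close>
  define e :: real where "e = 1 / sqrt 10"
  have e: "e > 0" by (simp add: e_def)
  obtain d where d: "d > 0" "\<And>n y. dist y (Fin z) < d \<Longrightarrow> dist ((?f ^^ n) y) ((?f ^^ n) (Fin z)) < e"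
    using eq e unfolding iterates_equicontinuous_at_def by meson
  obtain w where w: "w \<notin> filled_Julia" "dist z w < d / 2"
    using assms d(1) unfolding frontier_straddle by (metis half_gt_zero)
  then obtain n where n: "cmod ((pf a ^^ n) w) > 3" by (auto simp: filled_Julia_def not_le)
  \<comment> \<open>Modulus above 2 / e means chordal distance below e from \<open>Infty\<close>;
    \<open>k\<close> further doublings bring the orbit of \<open>w\<close> there.\<close>
  obtain k :: nat where k: "2 ^ k > 2 / e"
    using real_arch_pow[of 2 "2 / e"] by auto
  define v where "v = (pf a ^^ (k + n)) w"
  define u where "u = (pf a ^^ (k + n)) z"
  have "2 ^ k \<le> 2 ^ k * cmod ((pf a ^^ n) w)" using n by simp
  also have "\<dots> \<le> cmod v" unfolding v_def funpow_add_apply by (rule pf_iter_ge) (use n in simp)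
  finally have v: "cmod v > 2 / e" using k by linarith
  have "dist (Fin v) (Fin u) < e"
    using d(2)[of "Fin w" "k + n"] w(2) dist_Fin_le[of w z]
    by (simp add: rat_map_p_poly_iterate v_def u_def dist_commute)
  moreover have "dist (Fin v) Infty < e"
  proof -
    have "2 / e < sqrt (1 + (cmod v)\<^sup>2)" using v real_le_rsqrt[of "cmod v" "1 + (cmod v)\<^sup>2"] by simp
    then show ?thesis using e unfolding dist_rsphere_Fin_Infty
      by (simp add: field_simps add_pos_nonneg)
  qed
  moreover have "dist (Fin u) Infty \<ge> 2 * e"
  proof -
    have "cmod u \<le> 3" using zK by (simp add: filled_Julia_def u_def)
    then have "(cmod u)\<^sup>2 \<le> 3\<^sup>2" by (intro power_mono) auto
    then have "sqrt (1 + (cmod u)\<^sup>2) \<le> sqrt 10" by simp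
    then show ?thesis unfolding dist_rsphere_Fin_Infty e_def
      by (simp add: divide_left_mono add_pos_nonneg)
  qed
  ultimately show False
    using dist_triangle[of "Fin u" Infty "Fin v"] by (simp add: dist_commute)
qed

text \<open>Near an escaping point all late iterates are uniformly close to \<open>Infty\<close>,
  and the finitely many early ones are continuous, so the iterates are equicontinuous there.\<close>

lemma Julia_subset_filled_Julia:
  assumes "Fin z \<in> Julia_set (rat_map (to_fract (p_poly a)))"
  shows "z \<in> filled_Julia"
proof (rule ccontr)
  let ?f = "rat_map (to_fract (p_poly a))"
  assume "z \<notin> filled_Julia"
  then obtain N where N: "cmod ((pf a ^^ N) z) > 3" by (auto simp: filled_Julia_def not_le)
  define U where "U = {w. cmod ((pf a ^^ N) w) > 3}"
  have "open U"
    unfolding U_def by (intro open_Collect_less continuous_intros continuous_on_pf_iter)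
  then have oU: "open (Fin ` U)" by (rule open_Fin_image)
  have "iterates_equicontinuous_at ?f (Fin w)" if w: "w \<in> U" for w
    unfolding iterates_equicontinuous_at_def
  proof (intro allI impI)
    fix e :: real assume e: "e > 0"
    \<comment> \<open>Modulus above 4 / e gives chordal distance below e / 2 from
      \<open>Infty\<close>, so two such points are within e of each other.\<close>
    obtain k :: nat where k: "2 ^ k > 4 / e"
      using real_arch_pow[of 2 "4 / e"] by auto
    have far: "dist ((?f ^^ n) (Fin v)) Infty < e / 2" if "v \<in> U" "n \<ge> k + N" for v n
    proof -
      define m where "m = n - (k + N)"
      have n: "n = m + (k + N)" using that by (simp add: m_def)
      have 3: "cmod ((pf a ^^ N) v) > 3" using that by (simp add: U_def)
      have "2 ^ k \<le> 2 ^ k * cmod ((pf a ^^ N) v)" using 3 by simp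
      also have "\<dots> \<le> cmod ((pf a ^^ k) ((pf a ^^ N) v))" by (rule pf_iter_ge) (use 3 in simp)
      also have "\<dots> \<le> cmod ((pf a ^^ m) ((pf a ^^ k) ((pf a ^^ N) v)))"
        using pf_iter_ge1[of "(pf a ^^ N) v" k] 3 by (intro pf_iter_ge1) linarith
      finally have "4 / e < cmod ((pf a ^^ n) v)" using k by (simp add: n funpow_add_apply)
      also have "\<dots> \<le> sqrt (1 + (cmod ((pf a ^^ n) v))\<^sup>2)" by (rule real_le_rsqrt) simp
      finally show ?thesis using e unfolding rat_map_p_poly_iterate dist_rsphere_Fin_Infty
        by (simp add: field_simps add_pos_nonneg)
    qed
    have ev1: "\<forall>\<^sub>F y in nhds (Fin w). y \<in> Fin ` U"
      using oU w eventually_nhds by blast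
    have ev2: "\<forall>\<^sub>F y in nhds (Fin w). dist ((?f ^^ n) y) ((?f ^^ n) (Fin w)) < e" for n
    proof -
      have "isCont fin_part (Fin w)"
        using continuous_on_fin_part open_range_Fin continuous_on_eq_continuous_at by blast
      moreover have "isCont (pf a ^^ n) (fin_part (Fin w))"
        using continuous_on_pf_iter[of UNIV] continuous_on_eq_continuous_at by blast
      ultimately have "isCont (\<lambda>y. (pf a ^^ n) (fin_part y)) (Fin w)"
        by (rule isCont_o2)
      then have "isCont (\<lambda>y. Fin ((pf a ^^ n) (fin_part y))) (Fin w)"
        by (rule isCont_o2) (rule isCont_Fin)
      then have "((\<lambda>y. Fin ((pf a ^^ n) (fin_part y))) \<longlongrightarrow> Fin ((pf a ^^ n) w)) (nhds (Fin w))"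
        unfolding isCont_def by (subst (asm) tendsto_at_iff_tendsto_nhds) simp
      then have "\<forall>\<^sub>F y in nhds (Fin w). dist (Fin ((pf a ^^ n) (fin_part y))) (Fin ((pf a ^^ n) w)) < e"
        using e by (rule tendstoD)
      with ev1 show ?thesis
        by eventually_elim (auto simp: rat_map_p_poly_iterate)
    qed
    have "\<forall>\<^sub>F y in nhds (Fin w). \<forall>n\<in>{..<k + N}. dist ((?f ^^ n) y) ((?f ^^ n) (Fin w)) < e"
      by (intro eventually_ball_finite) (auto intro: ev2)
    with ev1 have "\<forall>\<^sub>F y in nhds (Fin w). \<forall>n. dist ((?f ^^ n) y) ((?f ^^ n) (Fin w)) < e"
    proof eventually_elim
      case (elim y)
      show ?case
      proof
        fix n
        show "dist ((?f ^^ n) y) ((?f ^^ n) (Fin w)) < e"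
        proof (cases "n < k + N")
          case False
          obtain v where "v \<in> U" "y = Fin v" using elim by auto
          then have "dist ((?f ^^ n) y) Infty < e / 2" "dist ((?f ^^ n) (Fin w)) Infty < e / 2"
            using far[of v n] far[OF w, of n] False by simp_all
          then show ?thesis
            using dist_triangle[of "(?f ^^ n) y" "(?f ^^ n) (Fin w)" Infty] by (simp add: dist_commute)
        qed (use elim in auto)
      qed
    qed
    then show "\<exists>d>0. \<forall>n y. dist y (Fin w) < d \<longrightarrow> dist ((?f ^^ n) y) ((?f ^^ n) (Fin w)) < e"
      unfolding eventually_nhds_metric by blast
  qed
  then have "Fin z \<in> Fatou_set ?f"
    unfolding Fatou_set_def using oU N by (auto simp: U_def intro!: exI[of _ "Fin ` U"])
  then show False using assms by (simp add: Julia_set_def)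
qed

text \<open>By the maximum principle it suffices to bound the iterates on the frontier, which lies in the Julia set.\<close>

lemma symmetry_preserves_filled_Julia:
  assumes "cmod \<alpha> = 1" "(\<lambda>z. \<alpha> * z + \<beta>) \<in> symmetry_group (to_fract (p_poly a))" "z \<in> filled_Julia"
  shows "\<alpha> * z + \<beta> \<in> filled_Julia"
  unfolding filled_Julia_def
proof (intro CollectI allI)
  fix n
  define g where "g = (\<lambda>z. (pf a ^^ n) (\<alpha> * z + \<beta>))"
  have hol: "g holomorphic_on A" for A
    unfolding g_def using holomorphic_on_compose[of "\<lambda>z. \<alpha> * z + \<beta>" A "pf a ^^ n"]
    by (simp add: o_def holomorphic_pf_iter holomorphic_intros)
  show "cmod ((pf a ^^ n) (\<alpha> * z + \<beta>)) \<le> 3"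
  proof (rule maximum_modulus_frontier[of g filled_Julia 3 z, unfolded g_def])
    fix w assume "w \<in> frontier filled_Julia"
    then have "Fin (\<alpha> * w + \<beta>) \<in> Julia_set (rat_map (to_fract (p_poly a)))"
      using assms(1,2) frontier_filled_Julia_subset_Julia symmetry_group_iff by blast
    then have "\<alpha> * w + \<beta> \<in> filled_Julia" by (rule Julia_subset_filled_Julia)
    then show "cmod ((pf a ^^ n) (\<alpha> * w + \<beta>)) \<le> 3" by (simp add: filled_Julia_def)
  qed (use hol bounded_filled_Julia assms(3) in \<open>auto simp: g_def holomorphic_on_imp_continuous_on\<close>)
qed

end

text \<open>If \<delta> \<noteq> 0, then along a direction in which \<delta> u^j is positive the
  real part of g exceeds 1 by about |\<delta>| x^j, which is larger than K x^m for small x because j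
  < m.\<close>

lemma tendsto_direction:
  fixes \<delta> :: complex and g :: "complex \<Rightarrow> complex" and K :: real
  assumes lim: "((\<lambda>u. (g u - 1) / u ^ j) \<longlongrightarrow> \<delta>) (at 0)" and j: "0 < j" "j < m"
    and le: "\<And>\<omega>. cmod \<omega> = 1 \<Longrightarrow> \<forall>\<^sub>F x in at_right 0. Re (g (of_real x * \<omega>)) \<le> 1 + K * x ^ m"
  shows "\<delta> = 0"
proof (rule ccontr)
  assume d: "\<delta> \<noteq> 0"
  \<comment> \<open>Dividing the argument of the conjugate of \<delta> by j makes
    \<open>\<omega> ^ j * \<delta>\<close> equal to |\<delta>|.\<close>
  define \<omega> where "\<omega> = cis (Arg (cnj \<delta>) / j)"
  have "\<omega> ^ j = sgn (cnj \<delta>)"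
    using j d by (simp add: \<omega>_def Complex.DeMoivre cis_Arg)
  then have w: "\<omega> ^ j * \<delta> = of_real (cmod \<delta>)"
  proof -
    have "\<omega> ^ j * \<delta> = (\<delta> * cnj \<delta>) / of_real (cmod \<delta>)"
      using \<open>\<omega> ^ j = sgn (cnj \<delta>)\<close> by (simp add: sgn_eq)
    also have "\<delta> * cnj \<delta> = (of_real (cmod \<delta>))\<^sup>2" using complex_norm_square[of \<delta>] by simp
    finally show ?thesis using d by (simp add: power2_eq_square)
  qed
  have w1: "cmod \<omega> = 1" by (simp add: \<omega>_def)
  then have w0: "\<omega> \<noteq> 0" by auto
  have "filterlim (\<lambda>x::real. of_real x * \<omega>) (at 0) (at_right 0)"
    using w0 by (auto simp: filterlim_at eventually_at_filter intro!: tendsto_eq_intros)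
  from filterlim_compose[OF lim this]
  have "((\<lambda>x. (g (of_real x * \<omega>) - 1) / (of_real x * \<omega>) ^ j) \<longlongrightarrow> \<delta>) (at_right (0::real))" .
  from tendsto_Re[OF tendsto_mult_left[OF this, of "\<omega> ^ j"]]
  have 1: "((\<lambda>x. Re (\<omega> ^ j * ((g (of_real x * \<omega>) - 1) / (of_real x * \<omega>) ^ j))) \<longlongrightarrow> cmod \<delta>) (at_right (0::real))"
    by (simp add: w)
  have 2: "((\<lambda>x. K * x ^ (m - j)) \<longlongrightarrow> 0) (at_right (0::real))"
    using j by (auto intro!: tendsto_eq_intros)
  have "\<forall>\<^sub>F x in at_right 0. Re (\<omega> ^ j * ((g (of_real x * \<omega>) - 1) / (of_real x * \<omega>) ^ j)) \<le> K * x ^ (m - j)"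
    using le[OF w1] eventually_at_right_less[of "0::real"]
  proof eventually_elim
    case (elim x)
    have "\<omega> ^ j * ((g (of_real x * \<omega>) - 1) / (of_real x * \<omega>) ^ j)
        = (g (of_real x * \<omega>) - 1) / of_real (x ^ j)"
      using w0 elim by (simp add: power_mult_distrib)
    then have "Re (\<omega> ^ j * ((g (of_real x * \<omega>) - 1) / (of_real x * \<omega>) ^ j))
        = (Re (g (of_real x * \<omega>)) - 1) / x ^ j"
      by (simp only: Re_divide_of_real) simp
    also have "\<dots> \<le> K * x ^ m / x ^ j"
      using elim by (intro divide_right_mono) auto
    also have "\<dots> = K * x ^ (m - j)"
      using elim j by (simp add: power_diff)
    finally show ?case .
  qed
  from tendsto_le[OF _ 2 1 this] d show False by simp
qed

lemma compact_decreasing_empty: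
  fixes A :: "nat \<Rightarrow> complex set"
  assumes "\<And>n. compact (A n)" "\<And>m n. m \<le> n \<Longrightarrow> A n \<subseteq> A m" "(\<Inter>n. A n) = {}"
  obtains n where "\<And>m. m \<ge> n \<Longrightarrow> A m = {}"
proof -
  have "\<exists>n. A n = {}"
    using compact_nest[of A] assms by blast
  then show ?thesis using assms(2) that by blast
qed

section \<open>Comparison of escape rates under a symmetry\<close>

context
  fixes a :: real
  assumes a: "0 < a" "a < 1"
begin

text \<open>The compact sets |p^N z| \<le> 3 decrease to the filled Julia set, on which
  |p^n(\<alpha>z + \<beta>)| \<le> 3. Compactness extends the bound, weakened to 4, to one of these
  sets.\<close>

lemma rotation_pf_iter_bound:
  assumes \<alpha>: "cmod \<alpha> = 1" and K: "\<And>z. z \<in> filled_Julia a \<Longrightarrow> \<alpha> * z + \<beta> \<in> filled_Julia a"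
  shows "\<exists>N\<ge>n. \<forall>z. cmod ((pf a ^^ N) z) \<le> 3 \<longrightarrow> cmod ((pf a ^^ n) (\<alpha> * z + \<beta>)) \<le> 4"
proof -
  have cont: "continuous_on A (\<lambda>z. (pf a ^^ n) (\<alpha> * z + \<beta>))" for A
    by (rule continuous_on_compose2[OF continuous_on_pf_iter[OF a, of UNIV n]])
       (auto intro!: continuous_intros)
  define A where "A = (\<lambda>N. {z. cmod ((pf a ^^ N) z) \<le> 3} \<inter> {z. 4 \<le> cmod ((pf a ^^ n) (\<alpha> * z + \<beta>))})"
  have "compact (A N)" for N
  proof -
    have "closed (A N)" unfolding A_def
      by (intro closed_Int closed_Collect_le continuous_intros continuous_on_pf_iter[OF a] cont)
    moreover have "A N \<subseteq> cball 0 3"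
      unfolding A_def using pf_iter_gt3[OF a, of 0 _ N] by (auto simp: not_le) (meson not_le)
    ultimately show ?thesis
      using bounded_subset[OF bounded_cball] compact_eq_bounded_closed by blast
  qed
  moreover have "A N \<subseteq> A M" if "M \<le> N" for M N
    unfolding A_def using pf_iter_gt3[OF a _ that] by (auto simp: not_le) (meson not_le)
  moreover have "(\<Inter>N. A N) = {}"
  proof -
    have False if "\<And>N. z \<in> A N" for z
    proof -
      have "z \<in> filled_Julia a" using that by (simp add: A_def filled_Julia_def[OF a])
      then have "cmod ((pf a ^^ n) (\<alpha> * z + \<beta>)) \<le> 3" using K by (auto simp: filled_Julia_def[OF a])
      then show False using that[of 0] by (auto simp: A_def)
    qed
    then show ?thesis by blast
  qed
  ultimately obtain N where "\<And>M. M \<ge> N \<Longrightarrow> A M = {}"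
    using compact_decreasing_empty by metis
  then have "A (max n N) = {}" by simp
  then show ?thesis unfolding A_def
    by (intro exI[of _ "max n N"]) (auto simp: not_le disjoint_iff intro: less_imp_le)
qed

lemma rotation_norm_bounds:
  assumes "cmod \<alpha> = 1"
  shows "cmod z - cmod \<beta> \<le> cmod (\<alpha> * z + \<beta>)" "cmod (\<alpha> * z + \<beta>) \<le> cmod z + cmod \<beta>"
  using norm_triangle_ineq[of "\<alpha> * z" \<beta>] norm_diff_ineq[of "\<alpha> * z" \<beta>] assms
  by (simp_all add: norm_mult)

text \<open>Maximum principle for the quotient of \<open>p\<^sup>n(\<alpha>z + \<beta>)\<close> raised to the power \<open>4\<^sup>N\<^sup>-\<^sup>n\<close> by \<open>p\<^sup>N\<close>,
  which tends to modulus 1 at infinity.\<close>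

lemma rotation_pf_iter_le:
  assumes \<alpha>: "cmod \<alpha> = 1" and nN: "n \<le> N"
    and bd: "\<And>z. cmod ((pf a ^^ N) z) \<le> 3 \<Longrightarrow> cmod ((pf a ^^ n) (\<alpha> * z + \<beta>)) \<le> 4"
    and z: "cmod z \<ge> 3"
  shows "cmod ((pf a ^^ n) (\<alpha> * z + \<beta>)) ^ 4 ^ (N - n) \<le> 4 ^ 4 ^ (N - n) * cmod ((pf a ^^ N) z)"
proof -
  \<comment> \<open>With this exponent \<open>G ^ M\<close> and \<open>F\<close> are polynomials of
    the same degree 4^N.\<close>
  define M :: nat where "M = 4 ^ (N - n)"
  define F where "F = pf a ^^ N"
  define G where "G = (\<lambda>z. (pf a ^^ n) (\<alpha> * z + \<beta>))"
  have M: "M \<ge> 1" "real M * 4 ^ n = 4 ^ N" using nN by (simp_all add: M_def flip: power_add)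
  have holF: "F holomorphic_on A" for A unfolding F_def by (rule holomorphic_pf_iter[OF a])
  have holG: "G holomorphic_on A" for A
    unfolding G_def using holomorphic_on_compose[of "\<lambda>z. \<alpha> * z + \<beta>" A "pf a ^^ n"]
    by (simp add: o_def holomorphic_pf_iter[OF a] holomorphic_intros)
  \<comment> \<open>On the circle of radius x this expression bounds the logarithm of the quotient,
    by \<open>ln_pf_iter'\<close> and because |\<alpha>w + \<beta>| lies between x - |\<beta>| and x
    + |\<beta>|. Hence the quotient has modulus at most 4 on a large circle |w| = T.\<close>
  have lim: "((\<lambda>x. 4 ^ N * (ln (x + cmod \<beta>) - ln x + 2 / (x - cmod \<beta>)\<^sup>2 + 2 / x\<^sup>2)) \<longlongrightarrow> 0) at_top"
  proof -
    have "((\<lambda>x. ln (x + cmod \<beta>) - ln x + 2 / (x - cmod \<beta>)\<^sup>2 + 2 / x\<^sup>2) \<longlongrightarrow> 0) at_top"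
      by real_asymp
    from tendsto_mult_left[OF this, of "4 ^ N"] show ?thesis by simp
  qed
  have "\<forall>\<^sub>F x in at_top. 4 ^ N * (ln (x + cmod \<beta>) - ln x + 2 / (x - cmod \<beta>)\<^sup>2 + 2 / x\<^sup>2) < ln 4 \<and> x \<ge> 4 + cmod \<beta> \<and> x > cmod z"
    using order_tendstoD(2)[OF lim, of "ln 4"] eventually_ge_at_top[of "4 + cmod \<beta>"] eventually_gt_at_top[of "cmod z"]
    by (intro eventually_conj) auto
  then obtain T where T: "4 ^ N * (ln (T + cmod \<beta>) - ln T + 2 / (T - cmod \<beta>)\<^sup>2 + 2 / T\<^sup>2) < ln 4"
      "T \<ge> 4 + cmod \<beta>" "T > cmod z"
    using eventually_happens[of _ at_top] by (metis (mono_tags, lifting) trivial_limit_at_top_linorder)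
  \<comment> \<open>\<open>F\<close> has no zero in this region, and each frontier point satisfies
    |F w| = 3, where \<open>bd\<close> applies, or |w| = T.\<close>
  define S where "S = {w. 3 \<le> cmod (F w)} \<inter> {w. cmod w \<le> T}"
  have cF: "continuous_on A F" "continuous_on A (\<lambda>z. cmod (F z))" for A
    using holF holomorphic_on_imp_continuous_on by (auto intro!: continuous_intros)
  have S0: "F w \<noteq> 0" if "w \<in> S" for w using that by (auto simp: S_def)
  have hol: "(\<lambda>w. G w ^ M / F w) holomorphic_on S"
    by (intro holomorphic_intros holF holG S0)
  have clS: "closed S"
    unfolding S_def by (intro closed_Int closed_Collect_le continuous_intros cF)
  have "cmod (G z ^ M / F z) \<le> 4 ^ M"
  proof (rule maximum_modulus_frontier[of "\<lambda>w. G w ^ M / F w" S])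
    show "(\<lambda>w. G w ^ M / F w) holomorphic_on interior S"
      using hol holomorphic_on_subset interior_subset by blast
    show "continuous_on (closure S) (\<lambda>w. G w ^ M / F w)"
      using clS hol by (simp add: holomorphic_on_imp_continuous_on)
    have "S \<subseteq> cball 0 T" by (auto simp: S_def)
    then show "bounded S" using bounded_subset bounded_cball by blast
    show "z \<in> S" using T z pf_iter_ge1[OF a z, of N] by (simp add: S_def F_def)
    fix w assume w: "w \<in> frontier S"
    have wS: "w \<in> S" using w clS frontier_subset_closed by blast
    have "{w. 3 < cmod (F w)} \<inter> {w. cmod w < T} \<subseteq> interior S"
    proof (rule interior_maximal)
      show "open ({w. 3 < cmod (F w)} \<inter> {w. cmod w < T})"
        by (intro open_Int open_Collect_less continuous_intros cF)
    qed (auto simp: S_def)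
    then have "w \<notin> {w. 3 < cmod (F w)} \<inter> {w. cmod w < T}"
      using w by (auto simp only: frontier_def)
    then have "cmod (F w) = 3 \<or> cmod w = T"
      using wS by (auto simp: S_def)
    then show "cmod (G w ^ M / F w) \<le> 4 ^ M"
    proof
      assume F3: "cmod (F w) = 3"
      then have "cmod (G w) \<le> 4" using bd[of w] by (simp add: F_def G_def)
      then have "cmod (G w) ^ M \<le> 4 ^ M" by (intro power_mono) auto
      then show ?thesis using F3 by (simp add: norm_divide norm_power)
          (smt (verit) zero_le_power norm_ge_zero)
    next
      assume wT: "cmod w = T"
      define v where "v = \<alpha> * w + \<beta>"
      have v: "T - cmod \<beta> \<le> cmod v" "cmod v \<le> T + cmod \<beta>"
        using rotation_norm_bounds[OF \<alpha>, of w \<beta>] by (simp_all add: v_def wT)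
      have w3: "cmod w \<ge> 3" "cmod v \<ge> 3" using T v wT norm_ge_zero[of \<beta>] by linarith+
      have pos: "cmod (G w) > 0" "cmod (F w) > 0"
        using pf_iter_ge1[OF a w3(2), of n] pf_iter_ge1[OF a w3(1), of N] w3
        unfolding G_def F_def v_def by linarith+
      have "ln (cmod (G w)) / 4 ^ n \<le> ln (cmod v) + 2 / (cmod v)\<^sup>2"
        using ln_pf_iter'[OF a w3(2), of n] by (simp add: G_def v_def)
      also have "\<dots> \<le> ln (T + cmod \<beta>) + 2 / (T - cmod \<beta>)\<^sup>2"
        using v w3 T by (intro add_mono divide_left_mono power_mono mult_pos_pos ln_mono) auto
      finally have 1: "ln (cmod (G w)) \<le> 4 ^ n * (ln (T + cmod \<beta>) + 2 / (T - cmod \<beta>)\<^sup>2)"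
        by (simp add: field_simps)
      have "ln T - 2 / T\<^sup>2 \<le> ln (cmod (F w)) / 4 ^ N"
        using ln_pf_iter'[OF a w3(1), of N] by (simp add: F_def wT)
      then have 2: "4 ^ N * (ln T - 2 / T\<^sup>2) \<le> ln (cmod (F w))" by (simp add: field_simps)
      have "real M * ln (cmod (G w)) \<le> real M * (4 ^ n * (ln (T + cmod \<beta>) + 2 / (T - cmod \<beta>)\<^sup>2))"
        by (intro mult_left_mono 1) auto
      also have "\<dots> = 4 ^ N * (ln (T + cmod \<beta>) + 2 / (T - cmod \<beta>)\<^sup>2)"
        using M(2) by (simp only: mult.assoc[symmetric])
      finally have 3: "real M * ln (cmod (G w)) - ln (cmod (F w)) \<le> ln 4"
        using 2 T(1) by (simp add: algebra_simps)
      have "ln (cmod (G w ^ M / F w)) = real M * ln (cmod (G w)) - ln (cmod (F w))"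
        using pos by (simp add: norm_divide norm_power ln_div ln_realpow)
      then have "cmod (G w ^ M / F w) \<le> 4"
      proof -
        have "0 < cmod (G w ^ M / F w)" using pos by (simp add: norm_divide norm_power)
        then show ?thesis using 3 \<open>ln (cmod (G w ^ M / F w)) = _\<close> by (metis ln_le_cancel_iff zero_less_numeral)
      qed
      also have "(4::real) \<le> 4 ^ M" using power_increasing[OF M(1), of "4::real"] by simp
      finally show ?thesis .
    qed
  qed
  moreover have "cmod (F z) > 0"
    using pf_iter_ge1[OF a z, of N] z unfolding F_def by linarith
  ultimately show ?thesis
    unfolding M_def[symmetric] by (simp add: norm_divide norm_power divide_le_eq F_def G_def)
qed

text \<open>Taking logarithms in \<open>rotation_pf_iter_le\<close> compares the normalized escape
  rates of \<alpha>z + \<beta> and z up to ln 4 / 4^n. Both rates are estimated from the first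
  iterate instead of the starting point, which gives errors of order -6.\<close>

lemma rotation_ln_pf_le:
  assumes \<alpha>: "cmod \<alpha> = 1" and K: "\<And>z. z \<in> filled_Julia a \<Longrightarrow> \<alpha> * z + \<beta> \<in> filled_Julia a"
    and z: "cmod z \<ge> 3" "cmod (\<alpha> * z + \<beta>) \<ge> 3"
  shows "ln (cmod (pf a (\<alpha> * z + \<beta>))) \<le> ln (cmod (pf a z)) + 2 / cmod z ^ 6 + 2 / cmod (\<alpha> * z + \<beta>) ^ 6"
proof -
  define v where "v = \<alpha> * z + \<beta>"
  have est: "\<bar>ln (cmod ((pf a ^^ Suc n) w)) / 4 ^ n - ln (cmod (pf a w))\<bar> \<le> 2 / cmod w ^ 6"
    if w: "cmod w \<ge> 3" for w n
  proof -
    have g: "cmod (pf a w) \<ge> cmod w ^ 3" by (rule pf_ge[OF a w])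
    have g3: "cmod (pf a w) \<ge> 3" using pf_ge2[OF a w] w by linarith
    have "2 / (cmod (pf a w))\<^sup>2 \<le> 2 / (cmod w ^ 3)\<^sup>2"
      using g w g3 by (intro divide_left_mono power_mono mult_pos_pos zero_less_power) auto
    also have "\<dots> = 2 / cmod w ^ 6" by (simp flip: power_mult)
    finally show ?thesis using ln_pf_iter'[OF a g3, of n] by (simp add: funpow_swap1)
  qed
  have step: "ln (cmod (pf a v)) - 2 / cmod v ^ 6 \<le> ln (cmod (pf a z)) + 2 / cmod z ^ 6 + ln 4 * (1 / 4) ^ n" for n
  proof -
    obtain N where N: "N \<ge> Suc n" "\<And>z. cmod ((pf a ^^ N) z) \<le> 3 \<Longrightarrow> cmod ((pf a ^^ Suc n) (\<alpha> * z + \<beta>)) \<le> 4"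
      using rotation_pf_iter_bound[OF \<alpha> K, of "Suc n"] by blast
    define G where "G = cmod ((pf a ^^ Suc n) v)"
    define F where "F = cmod ((pf a ^^ N) z)"
    have pos: "G > 0" "F > 0"
      using pf_iter_ge1[OF a z(2), of "Suc n"] pf_iter_ge1[OF a z(1), of N] z
      unfolding G_def F_def v_def by linarith+
    define k where "k = N - Suc n"
    have N': "N = Suc (n + k)" using N by (simp add: k_def)
    have "G ^ 4 ^ k \<le> 4 ^ 4 ^ k * F"
      using rotation_pf_iter_le[OF \<alpha> N(1) N(2) z(1)] by (simp add: G_def F_def v_def k_def)
    then have "ln (G ^ 4 ^ k) \<le> ln (4 ^ 4 ^ k * F)"
      using pos by (intro ln_mono) auto
    then have "4 ^ k * ln G \<le> 4 ^ k * ln 4 + ln F"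
      using pos by (simp add: ln_mult ln_realpow)
    then have "(4 ^ k * ln G) / 4 ^ (n + k) \<le> (4 ^ k * ln 4 + ln F) / 4 ^ (n + k)"
      by (intro divide_right_mono) auto
    then have "ln G / 4 ^ n \<le> ln 4 / 4 ^ n + ln F / 4 ^ (n + k)"
      by (simp add: add_divide_distrib power_add)
    moreover have "ln (cmod (pf a v)) - 2 / cmod v ^ 6 \<le> ln G / 4 ^ n"
      using est[OF z(2), of n] by (simp add: G_def v_def)
    moreover have "ln F / 4 ^ (n + k) \<le> ln (cmod (pf a z)) + 2 / cmod z ^ 6"
      using est[OF z(1), of "n + k"] by (simp add: F_def N')
    ultimately show ?thesis by (simp add: power_divide)
  qed
  \<comment> \<open>Letting n tend to infinity removes the contribution of the constant 4.\<close>
  have "(\<lambda>n. ln (cmod (pf a z)) + 2 / cmod z ^ 6 + ln 4 * (1 / 4) ^ n) \<longlonglongrightarrow> ln (cmod (pf a z)) + 2 / cmod z ^ 6 + ln 4 * 0"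
    by (intro tendsto_intros LIMSEQ_realpow_zero) auto
  from LIMSEQ_le_const[OF this, of "ln (cmod (pf a v)) - 2 / cmod v ^ 6"] step
  show ?thesis by (auto simp: v_def)
qed

end

section \<open>Reading off the symmetries from the expansion at infinity\<close>

lemma uminus_in_symmetry_group_p_poly: "uminus \<in> symmetry_group (to_fract (p_poly a))"
proof -
  let ?f = "rat_map (to_fract (p_poly a))"
  have "?f (extend uminus x) = ?f x" for x
    by (cases x) (simp_all add: poly_p_poly pf_def)
  then have it: "(?f ^^ Suc n) (extend uminus x) = (?f ^^ Suc n) x" for n x
    by (simp add: funpow_swap1)
  \<comment> \<open>For n > 0 the orbits of x and -x agree because p is even; for n = 0 the claim is
    that negation is an isometry.\<close>
  have "dist ((?f ^^ n) (extend uminus x)) ((?f ^^ n) (extend uminus y)) = dist ((?f ^^ n) x) ((?f ^^ n) y)" for n x y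
    by (cases n) (simp_all only: it, simp add: dist_extend_uminus)
  then have "extend uminus x \<in> Julia_set ?f \<longleftrightarrow> x \<in> Julia_set ?f" for x
    by (intro Julia_set_isometry dist_extend_uminus extend_involution) simp_all
  from this[of "Fin _"] show ?thesis
    using symmetry_group_iff[of "-1" 0 "to_fract (p_poly a)"] by simp
qed

lemma id_in_symmetry_group: "(\<lambda>z. z) \<in> symmetry_group R"
  using symmetry_group_iff[of 1 0 R] by simp

lemma symmetry_group_p_poly:
  assumes a: "0 < a" "a < 1"
  shows "symmetry_group (to_fract (p_poly a)) = {\<lambda>z. z, uminus}"
proof (intro equalityI subsetI)
  fix \<sigma> assume \<sigma>: "\<sigma> \<in> symmetry_group (to_fract (p_poly a))"
  then obtain \<alpha> \<beta> where \<alpha>: "cmod \<alpha> = 1" and \<sigma>_eq: "\<sigma> = (\<lambda>z. \<alpha> * z + \<beta>)"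
    by (auto simp: symmetry_group_def hol_isometry_def)
  have \<alpha>0: "\<alpha> \<noteq> 0" using \<alpha> by auto
  have K: "\<alpha> * z + \<beta> \<in> filled_Julia a" if "z \<in> filled_Julia a" for z
    using symmetry_preserves_filled_Julia[OF a \<alpha>] \<sigma> that by (simp add: \<sigma>_eq)
  define s :: complex where "s = of_real (1 + a)"
  have s0: "s \<noteq> 0" using a by (simp add: s_def of_real_eq_0_iff del: of_real_add)
  define D where "D = (\<lambda>u. 1 - s * u\<^sup>2 + of_real a * u ^ 4)"
  \<comment> \<open>With u = 1/z this is p(\<alpha>z + \<beta>) / (\<alpha>^4 p(z)), a rational
    function with value 1 at u = 0.\<close>
  define R where "R = (\<lambda>u. ((\<alpha> + \<beta> * u) ^ 4 - s * (\<alpha> + \<beta> * u)\<^sup>2 * u\<^sup>2 + of_real a * u ^ 4) / (\<alpha> ^ 4 * D u))"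
  have pfR: "pf a (\<alpha> / u + \<beta>) / pf a (1 / u) = \<alpha> ^ 4 * R u" if "u \<noteq> 0" for u
  proof -
    have scale: "pf a (n / u) = (n ^ 4 - s * n\<^sup>2 * u\<^sup>2 + of_real a * u ^ 4) / u ^ 4" for n
    proof -
      have "s * (n / u)\<^sup>2 = s * n\<^sup>2 * u\<^sup>2 / u ^ 4"
        using that by (simp add: power_divide power4_eq_xxxx power2_eq_square)
      then show ?thesis
        using that unfolding pf_def s_def[symmetric] by (simp add: power_divide add_divide_distrib diff_divide_distrib)
    qed
    have 1: "pf a (1 / u) = D u / u ^ 4"
      unfolding scale by (simp add: D_def)
    have "\<alpha> / u + \<beta> = (\<alpha> + \<beta> * u) / u" using that by (simp add: add_divide_distrib)
    then have "pf a (\<alpha> / u + \<beta>) = ((\<alpha> + \<beta> * u) ^ 4 - s * (\<alpha> + \<beta> * u)\<^sup>2 * u\<^sup>2 + of_real a * u ^ 4) / u ^ 4"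
      by (simp only: scale)
    moreover have "x / u ^ 4 / (D u / u ^ 4) = \<alpha> ^ 4 * (x / (\<alpha> ^ 4 * D u))" for x
      using that \<alpha>0 by simp
    ultimately show ?thesis unfolding 1 R_def by simp
  qed
  have D0: "(D \<longlongrightarrow> 1) (at 0)" unfolding D_def by (auto intro!: tendsto_eq_intros)
  have D_ev: "\<forall>\<^sub>F u in at 0. D u \<noteq> 0"
    using tendsto_imp_eventually_ne[OF D0] by simp
  have le: "\<forall>\<^sub>F x in at_right 0. Re (R (of_real x * \<omega>)) \<le> 1 + 300 * x ^ 6" if \<omega>: "cmod \<omega> = 1" for \<omega>
  proof -
    \<comment> \<open>This makes |z| = 1/x \<ge> 6 and |\<beta>| \<le> |z| / 2, hence |\<alpha>z +
      \<beta>| \<ge> 1/(2x) \<ge> 3, so the escape estimates apply at both points.\<close>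
    have 1: "\<forall>\<^sub>F x in at_right 0. x * (6 + 2 * cmod \<beta>) < 1"
      by (rule order_tendstoD(2)[of _ 0]) (auto intro!: tendsto_eq_intros)
    show ?thesis using 1 eventually_at_right_less[of "0::real"]
    proof eventually_elim
      case (elim x)
      define u where "u = of_real x * \<omega>"
      define z where "z = 1 / u"
      define v where "v = \<alpha> * z + \<beta>"
      have w0: "\<omega> \<noteq> 0" using \<omega> by auto
      have u0: "u \<noteq> 0" using w0 elim by (simp add: u_def)
      have nz: "cmod z = 1 / x" using elim \<omega> by (simp add: z_def u_def norm_divide norm_mult)
      have x1: "x * 6 \<le> 1" "x * cmod \<beta> \<le> 1 / 2"
      proof -
        have "0 \<le> x * cmod \<beta>" using elim by simp
        moreover have "x * (6 + 2 * cmod \<beta>) = x * 6 + 2 * (x * cmod \<beta>)" by (simp add: algebra_simps)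
        ultimately show "x * 6 \<le> 1" "x * cmod \<beta> \<le> 1 / 2" using elim by linarith+
      qed
      have z6: "cmod z \<ge> 6" using x1 elim by (simp add: nz field_simps)
      have "cmod \<beta> \<le> 1 / (2 * x)" using x1 elim by (simp add: field_simps)
      then have v: "cmod v \<ge> 1 / (2 * x)"
        using rotation_norm_bounds(1)[OF a \<alpha>, of z \<beta>] elim by (simp add: v_def nz field_simps)
      have v3: "cmod v \<ge> 3" using v z6 by (simp add: nz)
      have "ln (cmod (pf a v)) \<le> ln (cmod (pf a z)) + 2 / cmod z ^ 6 + 2 / cmod v ^ 6"
        using rotation_ln_pf_le[OF a \<alpha> K, of z] z6 v3 by (simp add: v_def)
      also have "2 / cmod z ^ 6 = 2 * x ^ 6" by (simp add: nz power_divide)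
      also have "2 / cmod v ^ 6 \<le> 2 / (1 / (2 * x)) ^ 6"
        using v elim v3 by (intro divide_left_mono power_mono mult_pos_pos zero_less_power) auto
      also have "\<dots> = 128 * x ^ 6" by (simp add: power_divide power_mult_distrib)
      finally have ln: "ln (cmod (pf a v)) \<le> ln (cmod (pf a z)) + 130 * x ^ 6" by simp
      have pos: "cmod (pf a v) > 0" "cmod (pf a z) > 0"
        using pf_ge2[OF a v3] pf_ge2[OF a, of z] v3 z6 by linarith+
      have "cmod (R u) = cmod (pf a v / pf a z)"
        using pfR[OF u0] \<alpha> by (simp add: v_def z_def norm_mult norm_power)
      also have "\<dots> = exp (ln (cmod (pf a v)) - ln (cmod (pf a z)))"
        using pos by (simp add: norm_divide exp_diff)
      also have "\<dots> \<le> exp (130 * x ^ 6)" using ln by simp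
      \<comment> \<open>Here exp y \<le> 1 + 2y for 0 \<le> y \<le> 1/2; the constant is 130 = 2 + 2
        * 2^6, the second term coming from |\<alpha>z + \<beta>| \<ge> 1/(2x).\<close>
      also have "\<dots> \<le> 1 + 2 * (130 * x ^ 6)"
      proof -
        have "x ^ 6 \<le> (1 / 6) ^ 6" using x1 elim by (intro power_mono) auto
        then have "130 * x ^ 6 \<le> 1 / 2" by (simp add: power_divide)
        then show ?thesis using elim exp_bound_lemma[of "130 * x ^ 6"] by simp
      qed
      also have "\<dots> \<le> 1 + 300 * x ^ 6" using elim by simp
      finally show ?case using complex_Re_le_cmod[of "R u"] by (simp add: u_def)
    qed
  qed
  \<comment> \<open>The coefficient of u in R is 4\<beta>/\<alpha>. \<open>Q\<close> is the
    difference quotient with the factor u cancelled, so that its limit at 0 can be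
    evaluated.\<close>
  have \<beta>0: "\<beta> = 0"
  proof -
    define Q where "Q = (\<lambda>u. (4 * \<alpha> ^ 3 * \<beta> + 6 * \<alpha>\<^sup>2 * \<beta>\<^sup>2 * u + 4 * \<alpha> * \<beta> ^ 3 * u\<^sup>2 + \<beta> ^ 4 * u ^ 3
      - s * (\<alpha> + \<beta> * u)\<^sup>2 * u + of_real a * u ^ 3 + \<alpha> ^ 4 * (s * u - of_real a * u ^ 3)) / (\<alpha> ^ 4 * D u))"
    have "\<forall>\<^sub>F u in at 0. Q u = (R u - 1) / u ^ 1"
      using D_ev eventually_neq_at_within[of 0]
    proof eventually_elim
      case (elim u)
      have "(R u - 1) / u ^ 1 = ((\<alpha> + \<beta> * u) ^ 4 - s * (\<alpha> + \<beta> * u)\<^sup>2 * u\<^sup>2 + of_real a * u ^ 4 - \<alpha> ^ 4 * D u) / (u * (\<alpha> ^ 4 * D u))"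
        using elim \<alpha>0 unfolding R_def by (simp add: field_simps)
      also have "(\<alpha> + \<beta> * u) ^ 4 - s * (\<alpha> + \<beta> * u)\<^sup>2 * u\<^sup>2 + of_real a * u ^ 4 - \<alpha> ^ 4 * D u
        = u * (4 * \<alpha> ^ 3 * \<beta> + 6 * \<alpha>\<^sup>2 * \<beta>\<^sup>2 * u + 4 * \<alpha> * \<beta> ^ 3 * u\<^sup>2 + \<beta> ^ 4 * u ^ 3
      - s * (\<alpha> + \<beta> * u)\<^sup>2 * u + of_real a * u ^ 3 + \<alpha> ^ 4 * (s * u - of_real a * u ^ 3))"
        unfolding D_def by algebra
      finally show ?case using elim by (simp add: Q_def)
    qed
    moreover have "(Q \<longlongrightarrow> 4 * \<alpha> ^ 3 * \<beta> / (\<alpha> ^ 4 * 1)) (at 0)"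
      unfolding Q_def using \<alpha>0 by (intro tendsto_divide tendsto_mult[OF tendsto_const D0]) (auto intro!: tendsto_eq_intros)
    ultimately have "((\<lambda>u. (R u - 1) / u ^ 1) \<longlongrightarrow> 4 * \<alpha> ^ 3 * \<beta> / (\<alpha> ^ 4 * 1)) (at 0)"
      by (rule Lim_transform_eventually[rotated])
    from tendsto_direction[OF this _ _ le] have "4 * \<alpha> ^ 3 * \<beta> / (\<alpha> ^ 4 * 1) = 0"
      by simp
    then show ?thesis using \<alpha>0 by simp
  qed
  \<comment> \<open>With \<beta> = 0 the function R is even, and its coefficient of u^2 is s
    (\<alpha>^2 - 1) / \<alpha>^2 with s = 1 + a \<noteq> 0.\<close>
  have "\<alpha>\<^sup>2 = 1"
  proof -
    define Q where "Q = (\<lambda>u. (- s * \<alpha>\<^sup>2 + of_real a * u\<^sup>2 + \<alpha> ^ 4 * (s - of_real a * u\<^sup>2)) / (\<alpha> ^ 4 * D u))"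
    have "\<forall>\<^sub>F u in at 0. Q u = (R u - 1) / u\<^sup>2"
      using D_ev eventually_neq_at_within[of 0]
    proof eventually_elim
      case (elim u)
      have "(R u - 1) / u\<^sup>2 = (\<alpha> ^ 4 - s * \<alpha>\<^sup>2 * u\<^sup>2 + of_real a * u ^ 4 - \<alpha> ^ 4 * D u) / (u\<^sup>2 * (\<alpha> ^ 4 * D u))"
        using elim \<alpha>0 unfolding R_def \<beta>0 by (simp add: field_simps)
      also have "\<alpha> ^ 4 - s * \<alpha>\<^sup>2 * u\<^sup>2 + of_real a * u ^ 4 - \<alpha> ^ 4 * D u
        = u\<^sup>2 * (- s * \<alpha>\<^sup>2 + of_real a * u\<^sup>2 + \<alpha> ^ 4 * (s - of_real a * u\<^sup>2))"
        unfolding D_def by algebra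
      finally show ?case using elim by (simp add: Q_def)
    qed
    moreover have "(Q \<longlongrightarrow> (- s * \<alpha>\<^sup>2 + \<alpha> ^ 4 * s) / (\<alpha> ^ 4 * 1)) (at 0)"
      unfolding Q_def using \<alpha>0 by (intro tendsto_divide tendsto_mult[OF tendsto_const D0]) (auto intro!: tendsto_eq_intros)
    ultimately have "((\<lambda>u. (R u - 1) / u\<^sup>2) \<longlongrightarrow> (- s * \<alpha>\<^sup>2 + \<alpha> ^ 4 * s) / (\<alpha> ^ 4 * 1)) (at 0)"
      by (rule Lim_transform_eventually[rotated])
    from tendsto_direction[OF this _ _ le] have "(- s * \<alpha>\<^sup>2 + \<alpha> ^ 4 * s) / (\<alpha> ^ 4 * 1) = 0"
      by simp
    then have "\<alpha>\<^sup>2 * s * (\<alpha>\<^sup>2 - 1) = 0" using \<alpha>0 by (simp add: algebra_simps flip: power_add)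
    then show ?thesis using \<alpha>0 s0 by simp
  qed
  then have "\<alpha> = 1 \<or> \<alpha> = - 1" by (simp add: power2_eq_1_iff)
  then show "\<sigma> \<in> {\<lambda>z. z, uminus}" by (auto simp: \<sigma>_eq \<beta>0)
qed (use id_in_symmetry_group uminus_in_symmetry_group_p_poly in auto)

section \<open>Linearization at a repelling fixed point\<close>

text \<open>The inverse function theorem at a fixed point, with explicit discs on both sides. It
  serves to invert the given germ and later its linearizer.\<close>

lemma holomorphic_local_inverse:
  fixes g :: "complex \<Rightarrow> complex"
  assumes hol: "g holomorphic_on ball 0 R" and R: "R > 0" and g0: "g 0 = 0"
    and d: "(g has_field_derivative d) (at 0)" "d \<noteq> 0"
  obtains h r \<rho> where "0 < r" "r \<le> R" "0 < \<rho>" "h holomorphic_on ball 0 \<rho>"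
    "\<And>u. u \<in> ball 0 r \<Longrightarrow> h (g u) = u"
    "\<And>w. w \<in> ball 0 \<rho> \<Longrightarrow> h w \<in> ball 0 r \<and> g (h w) = w"
    "((\<lambda>w. h w / w) \<longlongrightarrow> 1 / d) (at 0)"
proof -
  have dg: "deriv g 0 = d" using d(1) by (rule DERIV_imp_deriv)
  have z: "(0::complex) \<in> ball 0 R" and nz: "deriv g 0 \<noteq> 0" using R d(2) dg by auto
  obtain r where r: "r > 0" "ball (0::complex) r \<subseteq> ball 0 R" "open (g ` ball 0 r)" "inj_on g (ball 0 r)"
    by (rule has_complex_derivative_locally_invertible[OF hol z open_ball nz]) (rule that)
  have hol': "g holomorphic_on ball 0 r" using hol r(2) holomorphic_on_subset by blast
  obtain h where h: "h holomorphic_on g ` ball 0 r"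
      "\<And>z. z \<in> ball 0 r \<Longrightarrow> deriv g z * deriv h (g z) = 1" "\<And>z. z \<in> ball 0 r \<Longrightarrow> h (g z) = z"
    by (rule holomorphic_has_inverse[OF hol' open_ball r(4)]) (rule that)
  have "0 \<in> g ` ball 0 r" using r(1) g0 by (intro image_eqI[of _ _ 0]) auto
  then obtain \<rho> where \<rho>: "\<rho> > 0" "ball 0 \<rho> \<subseteq> g ` ball 0 r"
    using r(3) open_contains_ball by blast
  have holh: "h holomorphic_on ball 0 \<rho>" using h(1) \<rho>(2) holomorphic_on_subset by blast
  have h0: "h 0 = 0" using h(3)[of 0] r(1) g0 by simp
  have "deriv h 0 = 1 / d"
    using h(2)[of 0] r(1) g0 dg d(2) by (simp add: field_simps)
  then have "(h has_field_derivative 1 / d) (at 0)"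
    using holomorphic_derivI[OF holh, of 0] \<rho>(1) by simp
  then have lim: "((\<lambda>w. h w / w) \<longlongrightarrow> 1 / d) (at 0)"
    by (simp add: has_field_derivative_iff h0)
  show thesis
  proof (rule that[of r \<rho> h])
    show "r \<le> R" using r(1,2) R by (simp add: ball_subset_ball_iff)
    show "h w \<in> ball 0 r \<and> g (h w) = w" if w: "w \<in> ball 0 \<rho>" for w :: complex
    proof -
      obtain u where "u \<in> ball 0 r" "w = g u" using w \<rho>(2) by blast
      then show ?thesis using h(3) by simp
    qed
  qed (use r \<rho> h holh lim in auto)
qed

lemma tendsto_of_norm_bound:
  fixes f :: "complex \<Rightarrow> complex"
  assumes "\<And>u. u \<in> ball 0 R \<Longrightarrow> u \<noteq> 0 \<Longrightarrow> norm (f u - l) \<le> K * norm u" "R > 0"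
  shows "(f \<longlongrightarrow> l) (at 0)"
proof -
  have "((\<lambda>u. f u - l) \<longlongrightarrow> 0) (at 0)"
  proof (rule tendsto_0_le)
    show "((\<lambda>u::complex. u) \<longlongrightarrow> 0) (at 0)" by (rule tendsto_ident_at)
    show "\<forall>\<^sub>F u in at 0. norm (f u - l) \<le> norm u * K"
      using assms unfolding eventually_at by (intro exI[of _ R]) (auto simp: mult.commute)
  qed
  then show ?thesis by (simp add: Lim_null[symmetric])
qed

text \<open>Koenigs' theorem. With f the local inverse of c, the linearizer \<phi> is the limit of
  \<kappa>^n \<psi>(f^n u) for \<psi> u = u + b u^3. Starting from this cubic instead of the
  identity gives the third-order coefficient of \<phi> at once; \<Phi> is the inverse of
  \<phi>.\<close>

lemma koenigs_linearization:
  fixes c :: "complex \<Rightarrow> complex" and \<kappa> c3 b K R :: real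
  assumes hol: "c holomorphic_on ball 0 R" and R: "0 < R" "R \<le> 1" and \<kappa>: "1 < \<kappa>"
    and expn: "\<And>u :: complex. u \<in> ball 0 R \<Longrightarrow> cmod (c u - (\<kappa> * u + c3 * u ^ 3)) \<le> K * cmod u ^ 4"
    and c_minus: "\<And>u. c (- u) = - c u" and c_cnj: "\<And>u. c (cnj u) = cnj (c u)"
    and b: "b * (\<kappa> - \<kappa> ^ 3) = c3"
  obtains \<rho> \<phi> \<Phi> where "0 < \<rho>" "continuous_on (ball 0 \<rho>) \<Phi>"
    "\<And>w. w \<in> ball 0 \<rho> \<Longrightarrow> \<Phi> w \<in> ball 0 R \<and> c (\<Phi> (w / of_real \<kappa>)) = \<Phi> w"
    "\<And>w. w \<in> ball 0 \<rho> \<Longrightarrow> \<Phi> w = 0 \<longleftrightarrow> w = 0"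
    "\<And>w. w \<in> ball 0 \<rho> \<Longrightarrow> \<Phi> (- w) = - \<Phi> w"
    "\<And>w. w \<in> ball 0 \<rho> \<Longrightarrow> \<Phi> (cnj w) = cnj (\<Phi> w)"
    "((\<lambda>w. (\<Phi> w - w) / w ^ 3) \<longlongrightarrow> - of_real b) (at 0)"
    "((\<lambda>u. (\<phi> u - u) / u ^ 3) \<longlongrightarrow> of_real b) (at 0)" "\<phi> 0 = 0"
    "\<forall>\<^sub>F u in nhds 0. \<phi> u \<in> ball 0 \<rho> \<and> \<Phi> (\<phi> u) = u"
proof -
  define K' where "K' = max K 0"
  have K': "cmod (c u - (\<kappa> * u + c3 * u ^ 3)) \<le> K' * cmod u ^ 4" if "u \<in> ball 0 R" for u :: complex
    using expn[OF that] mult_right_mono[of K K' "cmod u ^ 4"] by (simp add: K'_def)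
  have K'0: "K' \<ge> 0" by (simp add: K'_def)
  have c0: "c 0 = 0" using expn[of 0] R by simp
  have pow_le: "cmod u ^ n \<le> cmod u ^ m" if "u \<in> ball 0 R" "m \<le> n" for u :: complex and m n
    using that R by (intro power_decreasing) auto
  have lin: "cmod (c u - \<kappa> * u) \<le> (\<bar>c3\<bar> + K') * cmod u ^ 3" if u: "u \<in> ball 0 R" for u :: complex
  proof -
    have "cmod (c u - \<kappa> * u) \<le> cmod (c u - (\<kappa> * u + c3 * u ^ 3)) + cmod (c3 * u ^ 3)"
      using norm_triangle_ineq[of "c u - (\<kappa> * u + c3 * u ^ 3)" "c3 * u ^ 3"] by simp
    also have "\<dots> \<le> K' * cmod u ^ 4 + \<bar>c3\<bar> * cmod u ^ 3"
      using K'[OF u] by (intro add_mono) (auto simp: norm_mult norm_power)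
    also have "\<dots> \<le> K' * cmod u ^ 3 + \<bar>c3\<bar> * cmod u ^ 3"
      using pow_le[OF u, of 3 4] K'0 by (intro add_mono mult_left_mono) auto
    finally show ?thesis by (simp add: algebra_simps)
  qed
  have "((\<lambda>u. c u / u) \<longlongrightarrow> of_real \<kappa>) (at 0)"
  proof (rule tendsto_of_norm_bound[OF _ R(1)])
    fix u :: complex assume u: "u \<in> ball 0 R" "u \<noteq> 0"
    have "cmod (c u / u - \<kappa>) = cmod (c u - \<kappa> * u) / cmod u"
      using u by (simp add: norm_divide[symmetric] diff_divide_distrib)
    also have "\<dots> \<le> (\<bar>c3\<bar> + K') * cmod u ^ 3 / cmod u"
      using lin[OF u(1)] by (intro divide_right_mono) auto
    also have "\<dots> = (\<bar>c3\<bar> + K') * cmod u ^ 2"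
      using u by (simp add: eval_nat_numeral)
    also have "\<dots> \<le> (\<bar>c3\<bar> + K') * cmod u ^ 1"
      using pow_le[OF u(1), of 1 2] K'0 by (intro mult_left_mono) auto
    finally show "cmod (c u / u - \<kappa>) \<le> (\<bar>c3\<bar> + K') * cmod u" by simp
  qed
  then have dc: "(c has_field_derivative of_real \<kappa>) (at 0)"
    by (simp add: has_field_derivative_iff c0)
  have \<kappa>0: "\<kappa> > 0" using \<kappa> by simp
  then have \<kappa>c0: "complex_of_real \<kappa> \<noteq> 0" by simp
  obtain f r0 \<rho>1 where f: "0 < r0" "r0 \<le> R" "0 < \<rho>1" "f holomorphic_on ball 0 \<rho>1"
      "\<And>u. u \<in> ball 0 r0 \<Longrightarrow> f (c u) = u"
      "\<And>w. w \<in> ball 0 \<rho>1 \<Longrightarrow> f w \<in> ball 0 r0 \<and> c (f w) = w"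
      "((\<lambda>w. f w / w) \<longlongrightarrow> 1 / of_real \<kappa>) (at 0)"
    by (rule holomorphic_local_inverse[OF hol R(1) c0 dc \<kappa>c0]) (rule that)
  have f0: "f 0 = 0" using f(5)[of 0] f(1) c0 by simp
  \<comment> \<open>Any contraction factor of f must exceed 1/\<kappa>; this one is also small
    enough that \<kappa> r^4 = 1/\<kappa> < 1, so a fourth-order error, scaled by \<kappa>^n, is
    summable.\<close>
  define r where "r = sqrt (1 / \<kappa>)"
  have r: "0 < r" "r < 1" "1 / \<kappa> < r" "r\<^sup>2 = 1 / \<kappa>"
  proof -
    show "0 < r" "r < 1" "r\<^sup>2 = 1 / \<kappa>" using \<kappa> by (simp_all add: r_def real_sqrt_divide power_divide)
    then have "r * r < r * 1" by (intro mult_strict_left_mono) auto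
    then show "1 / \<kappa> < r" using \<open>r\<^sup>2 = 1 / \<kappa>\<close> by (simp add: power2_eq_square)
  qed
  have "\<forall>\<^sub>F w in at 0. cmod (f w / w) < r"
    using order_tendstoD(2)[OF tendsto_norm[OF f(7)], of r] r \<kappa>0 by (simp add: norm_divide)
  then obtain \<rho>2 where \<rho>2: "\<rho>2 > 0" "\<And>w. w \<noteq> 0 \<Longrightarrow> cmod w < \<rho>2 \<Longrightarrow> cmod (f w / w) < r"
    unfolding eventually_at by (auto simp: dist_norm)
  define \<rho>0 where "\<rho>0 = min (min \<rho>1 \<rho>2) R"
  have \<rho>0: "\<rho>0 > 0" "\<rho>0 \<le> \<rho>1" "\<rho>0 \<le> R" using f \<rho>2 R by (auto simp: \<rho>0_def)
  have f_le: "cmod (f w) \<le> r * cmod w" if "w \<in> ball 0 \<rho>0" for w :: complex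
  proof (cases "w = 0")
    case False
    then have "cmod (f w / w) < r" using that \<rho>2 by (auto simp: \<rho>0_def)
    then show ?thesis using False by (simp add: norm_divide field_simps)
  qed (simp add: f0)
  have f_le1: "cmod (f w) \<le> cmod w" if "w \<in> ball 0 \<rho>0" for w :: complex
    using f_le[OF that] r mult_right_mono[of r 1 "cmod w"] by simp
  have fn: "(f ^^ n) w \<in> ball 0 \<rho>0 \<and> cmod ((f ^^ n) w) \<le> r ^ n * cmod w" if w: "w \<in> ball 0 \<rho>0" for n and w :: complex
  proof (induction n)
    case (Suc n)
    define v where "v = (f ^^ n) w"
    have v: "v \<in> ball 0 \<rho>0" "cmod v \<le> r ^ n * cmod w" using Suc by (simp_all add: v_def)
    have "cmod (f v) \<le> r * (r ^ n * cmod w)"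
      using f_le[OF v(1)] v(2) r mult_left_mono[of "cmod v" "r ^ n * cmod w" r] by linarith
    moreover have "f v \<in> ball 0 \<rho>0" using f_le1[OF v(1)] v(1) by auto
    ultimately show ?case by (simp add: v_def mult.assoc)
  qed (use w in simp)
  \<comment> \<open>The equation for b is exactly the one that makes the cubic terms of \<kappa>
    \<psi>(t) and \<psi>(c t) cancel, leaving a fourth-order error.\<close>
  define \<psi> where "\<psi> = (\<lambda>u::complex. u + b * u ^ 3)"
  define L where "L = \<kappa> + \<bar>c3\<bar> + K'"
  define K1 where "K1 = K' + \<bar>b\<bar> * ((\<bar>c3\<bar> + K') * (3 * L\<^sup>2))"
  have L: "L \<ge> \<kappa>" "L \<ge> 0" using K'0 \<kappa> by (auto simp: L_def)
  have \<psi>_err: "cmod (\<kappa> * \<psi> t - \<psi> (c t)) \<le> K1 * cmod t ^ 4" if t: "t \<in> ball 0 R" for t :: complex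
  proof -
    define e where "e = c t - (\<kappa> * t + c3 * t ^ 3)"
    have "\<kappa> * \<psi> t - \<psi> (c t) = \<kappa> * b * t ^ 3 - c3 * t ^ 3 - e - b * c t ^ 3"
      by (simp add: \<psi>_def e_def algebra_simps)
    also have "\<dots> = - e - b * (c t ^ 3 - (\<kappa> * t) ^ 3)"
      by (simp flip: b add: algebra_simps power_mult_distrib)
    finally have eq: "\<kappa> * \<psi> t - \<psi> (c t) = - e - b * (c t ^ 3 - (\<kappa> * t) ^ 3)" .
    have ct: "cmod (c t) \<le> L * cmod t"
    proof -
      have "cmod (c t) \<le> cmod (c t - \<kappa> * t) + cmod (\<kappa> * t)"
        using norm_triangle_ineq[of "c t - \<kappa> * t" "\<kappa> * t"] by simp
      also have "\<dots> \<le> (\<bar>c3\<bar> + K') * cmod t ^ 1 + \<kappa> * cmod t"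
        using lin[OF t] pow_le[OF t, of 1 3] K'0 \<kappa>0 mult_left_mono[of "cmod t ^ 3" "cmod t ^ 1" "\<bar>c3\<bar> + K'"]
        by (simp add: norm_mult)
      finally show ?thesis by (simp add: L_def algebra_simps)
    qed
    have \<kappa>t: "cmod (\<kappa> * t) \<le> L * cmod t" using L \<kappa>0 by (simp add: norm_mult mult_right_mono)
    have "c t ^ 3 - (\<kappa> * t) ^ 3 = (c t - \<kappa> * t) * ((c t)\<^sup>2 + c t * (\<kappa> * t) + (\<kappa> * t)\<^sup>2)"
      by algebra
    then have "cmod (c t ^ 3 - (\<kappa> * t) ^ 3) = cmod (c t - \<kappa> * t) * cmod ((c t)\<^sup>2 + c t * (\<kappa> * t) + (\<kappa> * t)\<^sup>2)"
      by (simp add: norm_mult)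
    also have "\<dots> \<le> ((\<bar>c3\<bar> + K') * cmod t ^ 3) * (3 * (L * cmod t)\<^sup>2)"
    proof (rule mult_mono)
      have "cmod ((c t)\<^sup>2 + c t * (\<kappa> * t) + (\<kappa> * t)\<^sup>2) \<le> (cmod (c t))\<^sup>2 + cmod (c t) * cmod (\<kappa> * t) + (cmod (\<kappa> * t))\<^sup>2"
        by (intro norm_triangle_le add_mono) (simp_all add: norm_mult norm_power)
      also have "\<dots> \<le> (L * cmod t)\<^sup>2 + (L * cmod t) * (L * cmod t) + (L * cmod t)\<^sup>2"
        using ct \<kappa>t L by (intro add_mono power_mono mult_mono) auto
      also have "\<dots> = 3 * (L * cmod t)\<^sup>2" by (simp add: power2_eq_square)
      finally show "cmod ((c t)\<^sup>2 + c t * (\<kappa> * t) + (\<kappa> * t)\<^sup>2) \<le> 3 * (L * cmod t)\<^sup>2" .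
    qed (use lin[OF t] K'0 in auto)
    also have "\<dots> = ((\<bar>c3\<bar> + K') * (3 * L\<^sup>2)) * cmod t ^ 5"
      by (simp add: power_mult_distrib eval_nat_numeral)
    also have "\<dots> \<le> ((\<bar>c3\<bar> + K') * (3 * L\<^sup>2)) * cmod t ^ 4"
      using pow_le[OF t, of 4 5] K'0 by (intro mult_left_mono) auto
    finally have cube: "cmod (c t ^ 3 - (\<kappa> * t) ^ 3) \<le> ((\<bar>c3\<bar> + K') * (3 * L\<^sup>2)) * cmod t ^ 4" .
    have "cmod (- e - b * (c t ^ 3 - (\<kappa> * t) ^ 3)) \<le> cmod e + \<bar>b\<bar> * cmod (c t ^ 3 - (\<kappa> * t) ^ 3)"
      using norm_triangle_ineq4[of "- e" "b * (c t ^ 3 - (\<kappa> * t) ^ 3)"] by (simp add: norm_mult)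
    also have "\<dots> \<le> K' * cmod t ^ 4 + \<bar>b\<bar> * (((\<bar>c3\<bar> + K') * (3 * L\<^sup>2)) * cmod t ^ 4)"
      using K'[OF t] cube by (intro add_mono mult_left_mono) (auto simp: e_def)
    finally show ?thesis unfolding eq by (simp add: K1_def algebra_simps)
  qed
  have K1: "K1 \<ge> 0" using K'0 by (auto simp: K1_def)
  define g where "g = (\<lambda>n v. of_real (\<kappa> ^ n) * \<psi> ((f ^^ n) v))"
  \<comment> \<open>Consecutive approximations differ by \<kappa>^n times the conjugacy error of
    \<psi> at a point of modulus at most r^n |v|, hence by a multiple of (\<kappa> r^4)^n.\<close>
  have g_diff: "cmod (g (Suc n) v - g n v) \<le> (K1 * cmod v ^ 4) * (1 / \<kappa>) ^ n" if v: "v \<in> ball 0 \<rho>0" for n and v :: complex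
  proof -
    define w where "w = (f ^^ n) v"
    have w: "w \<in> ball 0 \<rho>0" "cmod w \<le> r ^ n * cmod v" using fn[OF v, of n] by (simp_all add: w_def)
    have fw: "c (f w) = w" "f w \<in> ball 0 R" "cmod (f w) \<le> cmod w"
      using f(6)[of w] w \<rho>0 f(2) f_le1[OF w(1)] by auto
    have "g (Suc n) v - g n v = of_real (\<kappa> ^ n) * (\<kappa> * \<psi> (f w) - \<psi> (c (f w)))"
      by (simp add: g_def w_def[symmetric] fw algebra_simps)
    then have "cmod (g (Suc n) v - g n v) = \<kappa> ^ n * cmod (\<kappa> * \<psi> (f w) - \<psi> (c (f w)))"
      using \<kappa>0 by (simp add: norm_mult norm_power)
    also have "\<dots> \<le> \<kappa> ^ n * (K1 * cmod (f w) ^ 4)"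
      using \<psi>_err[OF fw(2)] \<kappa>0 by (intro mult_left_mono) auto
    also have "\<dots> \<le> \<kappa> ^ n * (K1 * (r ^ n * cmod v) ^ 4)"
      using fw(3) w(2) \<kappa>0 K1 by (intro mult_left_mono power_mono) auto
    also have "\<dots> = K1 * cmod v ^ 4 * (\<kappa> * (r\<^sup>2)\<^sup>2) ^ n"
      by (simp add: power_mult_distrib mult_ac flip: power_mult)
    also have "\<kappa> * (r\<^sup>2)\<^sup>2 = 1 / \<kappa>" using \<kappa>0 by (simp only: r(4)) (simp add: power2_eq_square)
    finally show ?thesis .
  qed
  have geo: "summable (\<lambda>n. (1 / \<kappa>) ^ n)" using \<kappa> by (simp add: summable_geometric)
  \<comment> \<open>The limit is written as a telescoping series so that the Weierstrass M-test
    gives uniform convergence and hence holomorphy.\<close>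
  define \<phi> where "\<phi> = (\<lambda>v. \<psi> v + (\<Sum>n. g (Suc n) v - g n v))"
  have g0: "g 0 v = \<psi> v" for v by (simp add: g_def)
  have ul: "uniform_limit (ball 0 \<rho>0) g \<phi> sequentially"
  proof -
    have "uniform_limit (ball 0 \<rho>0) (\<lambda>n v. \<Sum>i<n. g (Suc i) v - g i v) (\<lambda>v. \<Sum>i. g (Suc i) v - g i v) sequentially"
    proof (rule Weierstrass_m_test[of _ _ "\<lambda>n. K1 * (1 / \<kappa>) ^ n"])
      fix n and v :: complex assume v: "v \<in> ball 0 \<rho>0"
      then have "v \<in> ball 0 R" using \<rho>0 by auto
      then have "cmod v ^ 4 \<le> 1" using pow_le[of v 0 4] by simp
      then have "(K1 * cmod v ^ 4) * (1 / \<kappa>) ^ n \<le> (K1 * 1) * (1 / \<kappa>) ^ n"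
        using K1 \<kappa>0 by (intro mult_right_mono mult_left_mono) auto
      then show "cmod (g (Suc n) v - g n v) \<le> K1 * (1 / \<kappa>) ^ n"
        using g_diff[OF v, of n] by linarith
    qed (rule summable_mult[OF geo])
    moreover have "(\<Sum>i<n. g (Suc i) v - g i v) = g n v - \<psi> v" for n v
      using sum_lessThan_telescope[of "\<lambda>i. g i v" n] by (simp add: g0)
    ultimately have "uniform_limit (ball 0 \<rho>0) (\<lambda>n v. g n v - \<psi> v) (\<lambda>v. \<Sum>i. g (Suc i) v - g i v) sequentially"
      by simp
    then have "uniform_limit (ball 0 \<rho>0) (\<lambda>n v. \<psi> v + (g n v - \<psi> v)) (\<lambda>v. \<psi> v + (\<Sum>i. g (Suc i) v - g i v)) sequentially"
      by (intro uniform_limit_add uniform_limit_const)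
    then show ?thesis by (simp add: \<phi>_def)
  qed
  have \<phi>_lim: "(\<lambda>n. g n v) \<longlonglongrightarrow> \<phi> v" if "v \<in> ball 0 \<rho>0" for v :: complex
    using tendsto_uniform_limitI[OF ul that] .
  define K2 where "K2 = (\<Sum>n. K1 * (1 / \<kappa>) ^ n)"
  have \<phi>_err: "cmod (\<phi> v - \<psi> v) \<le> K2 * cmod v ^ 4" if v: "v \<in> ball 0 \<rho>0" for v :: complex
  proof -
    have s: "summable (\<lambda>n. (K1 * cmod v ^ 4) * (1 / \<kappa>) ^ n)" by (rule summable_mult[OF geo])
    have "cmod (\<phi> v - \<psi> v) \<le> (\<Sum>n. (K1 * cmod v ^ 4) * (1 / \<kappa>) ^ n)"
      unfolding \<phi>_def using norm_suminf_le[OF g_diff[OF v] s] by simp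
    also have "\<dots> = K2 * cmod v ^ 4"
      using suminf_mult[OF summable_mult[OF geo, of K1], of "cmod v ^ 4"] by (simp add: K2_def mult_ac)
    finally show ?thesis .
  qed
  have hol_fn: "(f ^^ n) holomorphic_on ball 0 \<rho>0" for n
  proof (induction n)
    case (Suc n)
    have "(f ^^ n) ` ball 0 \<rho>0 \<subseteq> ball 0 \<rho>1" using fn subset_ball[OF \<rho>0(2), of "0::complex"] by blast
    from holomorphic_on_compose_gen[OF Suc f(4) this] show ?case by (simp add: o_def)
  qed (simp add: id_def)
  have hol_g: "g n holomorphic_on ball 0 \<rho>0" for n
    unfolding g_def \<psi>_def by (intro holomorphic_intros hol_fn)
  have hol_\<phi>: "\<phi> holomorphic_on ball 0 \<rho>0"
  proof (rule holomorphic_uniform_sequence[OF open_ball hol_g])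
    fix x :: complex assume "x \<in> ball 0 \<rho>0"
    then obtain d where "d > 0" "cball x d \<subseteq> ball 0 \<rho>0"
      using open_contains_cball open_ball by blast
    then show "\<exists>d>0. cball x d \<subseteq> ball 0 \<rho>0 \<and> uniform_limit (cball x d) g \<phi> sequentially"
      using uniform_limit_on_subset[OF ul] by blast
  qed
  have \<phi>0: "\<phi> 0 = 0" using \<phi>_err[of 0] \<rho>0 by (simp add: \<psi>_def)
  have \<phi>_b: "((\<lambda>u. (\<phi> u - u) / u ^ 3) \<longlongrightarrow> of_real b) (at 0)"
  proof (rule tendsto_of_norm_bound[OF _ \<rho>0(1)])
    fix u :: complex assume u: "u \<in> ball 0 \<rho>0" "u \<noteq> 0"
    have "(\<phi> u - u) / u ^ 3 - b = (\<phi> u - \<psi> u) / u ^ 3"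
      using u by (simp add: \<psi>_def field_simps)
    then have "cmod ((\<phi> u - u) / u ^ 3 - b) = cmod (\<phi> u - \<psi> u) / cmod u ^ 3"
      by (simp add: norm_divide norm_power)
    also have "\<dots> \<le> K2 * cmod u ^ 4 / cmod u ^ 3"
      using \<phi>_err[OF u(1)] by (intro divide_right_mono) auto
    also have "\<dots> = K2 * cmod u" using u by (simp add: eval_nat_numeral)
    finally show "cmod ((\<phi> u - u) / u ^ 3 - b) \<le> K2 * cmod u" .
  qed
  have \<phi>_quot: "((\<lambda>u. \<phi> u / u) \<longlongrightarrow> 1) (at 0)"
  proof -
    have "((\<lambda>u. (\<phi> u - u) / u ^ 3 * u\<^sup>2 + 1) \<longlongrightarrow> of_real b * 0\<^sup>2 + 1) (at 0)"
      by (intro tendsto_intros \<phi>_b)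
    moreover have "\<forall>\<^sub>F u in at 0. (\<phi> u - u) / u ^ 3 * u\<^sup>2 + 1 = \<phi> u / u"
      using eventually_neq_at_within[of 0] by eventually_elim (simp add: divide_simps eval_nat_numeral)
    ultimately have "((\<lambda>u. \<phi> u / u) \<longlongrightarrow> of_real b * 0\<^sup>2 + 1) (at 0)"
      by (rule Lim_transform_eventually)
    then show ?thesis by simp
  qed
  then have d\<phi>: "(\<phi> has_field_derivative 1) (at 0)"
    by (simp add: has_field_derivative_iff \<phi>0)
  \<comment> \<open>\<open>g n (f v)\<close> is \<open>g (Suc n) v\<close> divided by \<kappa>, so
    the functional equation follows in the limit.\<close>
  have \<phi>_f: "\<phi> (f v) = \<phi> v / of_real \<kappa>" if v: "v \<in> ball 0 \<rho>0" for v :: complex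
  proof -
    have "f v \<in> ball 0 \<rho>0" using fn[OF v, of 1] by simp
    then have "(\<lambda>n. g n (f v)) \<longlonglongrightarrow> \<phi> (f v)" by (rule \<phi>_lim)
    moreover have "(\<lambda>n. g (Suc n) v / of_real \<kappa>) \<longlonglongrightarrow> \<phi> v / of_real \<kappa>"
      by (rule tendsto_divide[OF LIMSEQ_Suc[OF \<phi>_lim[OF v]] tendsto_const \<kappa>c0])
    moreover have "g (Suc n) v / of_real \<kappa> = g n (f v)" for n
      using \<kappa>0 by (simp add: g_def funpow_swap1)
    ultimately show ?thesis using LIMSEQ_unique by auto
  qed
  \<comment> \<open>The symmetries of c pass to f because the preimage under c in the small disc is
    unique; they then pass to the iterates and to the limit \<phi>.\<close>
  have f_minus: "f (- v) = - f v" and f_cnj: "f (cnj v) = cnj (f v)" if v: "v \<in> ball 0 \<rho>0" for v :: complex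
  proof -
    have fv: "f v \<in> ball 0 r0" "c (f v) = v" using f(6)[of v] v \<rho>0 by auto
    show "f (- v) = - f v" using f(5)[of "- f v"] fv by (simp add: c_minus)
    show "f (cnj v) = cnj (f v)" using f(5)[of "cnj (f v)"] fv by (simp add: c_cnj)
  qed
  have fn_minus: "(f ^^ n) (- v) = - (f ^^ n) v" and fn_cnj: "(f ^^ n) (cnj v) = cnj ((f ^^ n) v)"
    if v: "v \<in> ball 0 \<rho>0" for n and v :: complex
    using fn[OF v] by (induction n) (simp_all add: f_minus f_cnj)
  have \<phi>_minus: "\<phi> (- v) = - \<phi> v" and \<phi>_cnj: "\<phi> (cnj v) = cnj (\<phi> v)" if v: "v \<in> ball 0 \<rho>0" for v :: complex
  proof -
    have v': "- v \<in> ball 0 \<rho>0" "cnj v \<in> ball 0 \<rho>0" using v by auto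
    have "g n (- v) = - g n v" "g n (cnj v) = cnj (g n v)" for n
      by (simp_all add: g_def fn_minus[OF v] fn_cnj[OF v] \<psi>_def algebra_simps)
    then show "\<phi> (- v) = - \<phi> v" "\<phi> (cnj v) = cnj (\<phi> v)"
      using LIMSEQ_unique[OF \<phi>_lim[OF v'(1)]] LIMSEQ_unique[OF \<phi>_lim[OF v'(2)]]
        tendsto_minus[OF \<phi>_lim[OF v]] tendsto_cnj[OF \<phi>_lim[OF v]] by auto
  qed
  obtain \<Phi> r1 \<rho> where \<Phi>: "0 < r1" "r1 \<le> \<rho>0" "0 < \<rho>" "\<Phi> holomorphic_on ball 0 \<rho>"
      "\<And>u. u \<in> ball 0 r1 \<Longrightarrow> \<Phi> (\<phi> u) = u"
      "\<And>w. w \<in> ball 0 \<rho> \<Longrightarrow> \<Phi> w \<in> ball 0 r1 \<and> \<phi> (\<Phi> w) = w"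
      "((\<lambda>w. \<Phi> w / w) \<longlongrightarrow> 1 / 1) (at 0)"
    by (rule holomorphic_local_inverse[OF hol_\<phi> \<rho>0(1) \<phi>0 d\<phi> one_neq_zero]) (rule that)
  have \<Phi>0: "\<Phi> 0 = 0" using \<Phi>(5)[of 0] \<Phi>(1) \<phi>0 by simp
  show thesis
  proof (rule that[of \<rho> \<Phi> \<phi>])
    show "0 < \<rho>" by fact
    show cont: "continuous_on (ball 0 \<rho>) \<Phi>" using \<Phi>(4) holomorphic_on_imp_continuous_on by blast
    show "\<phi> 0 = 0" by fact
    show "((\<lambda>u. (\<phi> u - u) / u ^ 3) \<longlongrightarrow> of_real b) (at 0)" by fact
    fix w :: complex assume w: "w \<in> ball 0 \<rho>"
    define u where "u = \<Phi> w"
    have u: "u \<in> ball 0 r1" "\<phi> u = w" "u \<in> ball 0 \<rho>0" using \<Phi>(6)[OF w] \<Phi>(2) by (auto simp: u_def)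
    have "f u \<in> ball 0 r1" using f_le1[OF u(3)] u(1) by auto
    \<comment> \<open>Inverting \<phi>(f u) = \<phi>(u)/\<kappa> gives \<Phi>(w/\<kappa>) = f u, and
      applying c recovers u = \<Phi> w.\<close>
    then have "\<Phi> (w / of_real \<kappa>) = f u" using \<Phi>(5)[of "f u"] \<phi>_f[OF u(3)] u(2) by simp
    then show "\<Phi> w \<in> ball 0 R \<and> c (\<Phi> (w / of_real \<kappa>)) = \<Phi> w"
      using f(6)[of u] u \<rho>0 by (auto simp: u_def)
    show "\<Phi> w = 0 \<longleftrightarrow> w = 0" using u(2) \<phi>0 \<Phi>0 by (auto simp: u_def)
    show "\<Phi> (- w) = - \<Phi> w" using \<Phi>(5)[of "- u"] u \<phi>_minus[OF u(3)] by (simp add: u_def)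
    show "\<Phi> (cnj w) = cnj (\<Phi> w)" using \<Phi>(5)[of "cnj u"] u \<phi>_cnj[OF u(3)] by (simp add: u_def)
  next
    have ev: "\<forall>\<^sub>F w in at 0. w \<in> ball 0 \<rho> \<and> w \<noteq> 0"
      using \<Phi>(3) eventually_at_ball[of \<rho> 0 UNIV] eventually_neq_at_within[of 0]
      by (intro eventually_conj) auto
    have "(\<Phi> \<longlongrightarrow> 0) (at 0)"
      using holomorphic_on_imp_continuous_on[OF \<Phi>(4)] \<Phi>(3) \<Phi>0
      by (metis centre_in_ball continuous_on_def at_within_open open_ball)
    moreover have "\<forall>\<^sub>F w in at 0. \<Phi> w \<noteq> 0"
      using ev by eventually_elim (use \<Phi>(6) \<phi>0 in fastforce)
    ultimately have fl: "filterlim \<Phi> (at 0) (at 0)" by (simp add: filterlim_at)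
    \<comment> \<open>With u = \<Phi> w and w = \<phi> u, the cubic quotient of \<Phi> is minus that
      of \<phi> times (u/w)^3, and u/w tends to 1.\<close>
    have "((\<lambda>w. - ((\<phi> (\<Phi> w) - \<Phi> w) / \<Phi> w ^ 3) * (\<Phi> w / w) ^ 3) \<longlongrightarrow> - of_real b * (1 / 1) ^ 3) (at 0)"
      by (intro tendsto_intros filterlim_compose[OF \<phi>_b fl] \<Phi>(7))
    moreover have "\<forall>\<^sub>F w in at 0. - ((\<phi> (\<Phi> w) - \<Phi> w) / \<Phi> w ^ 3) * (\<Phi> w / w) ^ 3 = (\<Phi> w - w) / w ^ 3"
      using ev \<open>\<forall>\<^sub>F w in at 0. \<Phi> w \<noteq> 0\<close>
      by eventually_elim (use \<Phi>(6) in \<open>simp add: power_divide field_simps\<close>)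
    ultimately have "((\<lambda>w. (\<Phi> w - w) / w ^ 3) \<longlongrightarrow> - of_real b * (1 / 1) ^ 3) (at 0)"
      by (rule Lim_transform_eventually)
    then show "((\<lambda>w. (\<Phi> w - w) / w ^ 3) \<longlongrightarrow> - of_real b) (at 0)" by simp
    have "isCont \<phi> 0" using d\<phi> DERIV_isCont by blast
    then have "(\<phi> \<longlongrightarrow> 0) (nhds 0)" by (metis isCont_def \<phi>0 tendsto_at_iff_tendsto_nhds)
    then have "\<forall>\<^sub>F u in nhds 0. \<phi> u \<in> ball 0 \<rho>"
      by (rule topological_tendstoD) (use \<Phi>(3) in auto)
    moreover have "\<forall>\<^sub>F u in nhds 0. u \<in> ball 0 r1"
      using \<Phi>(1) by (intro eventually_nhds_in_open) auto
    ultimately show "\<forall>\<^sub>F u in nhds 0. \<phi> u \<in> ball 0 \<rho> \<and> \<Phi> (\<phi> u) = u"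
      by eventually_elim (use \<Phi>(5) in auto)
  qed
qed

section \<open>Rotations of a scale-invariant closed set\<close>

lemma ex_power_between:
  fixes x \<kappa> :: real
  assumes "1 < \<kappa>" "1 \<le> x"
  shows "\<exists>n. \<kappa> ^ n \<le> x \<and> x \<le> \<kappa> ^ Suc n"
proof -
  obtain m where m: "x < \<kappa> ^ m" using real_arch_pow[OF assms(1)] by blast
  define k where "k = (LEAST m. x < \<kappa> ^ m)"
  have k: "x < \<kappa> ^ k" unfolding k_def using m by (rule LeastI)
  then have "k \<noteq> 0" using assms(2) by (intro notI) simp
  then obtain n where n: "k = Suc n" by (cases k) auto
  have "\<not> x < \<kappa> ^ n" using not_less_Least[of n "\<lambda>m. x < \<kappa> ^ m"] n by (simp add: k_def)
  then show ?thesis using k n by (intro exI[of _ n]) auto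
qed

text \<open>The annulus between radii 1 and \<kappa> is a fundamental domain for scaling; the two
  cases replace a power with integer exponent.\<close>

lemma ex_scale_annulus:
  fixes \<kappa> :: real and w :: complex
  assumes "1 < \<kappa>" "w \<noteq> 0"
  obtains n where "1 \<le> cmod (w / of_real \<kappa> ^ n)" "cmod (w / of_real \<kappa> ^ n) \<le> \<kappa>"
    | n where "1 \<le> cmod (w * of_real \<kappa> ^ n)" "cmod (w * of_real \<kappa> ^ n) \<le> \<kappa>"
proof (cases "cmod w \<ge> 1")
  case True
  obtain n where "\<kappa> ^ n \<le> cmod w" "cmod w \<le> \<kappa> ^ Suc n"
    using ex_power_between[OF assms(1) True] by blast
  then show ?thesis using assms
    by (intro that(1)[of n]) (auto simp: norm_divide norm_power field_simps)
next
  case False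
  then have "1 \<le> 1 / cmod w" using assms by simp
  then obtain n where "\<kappa> ^ n \<le> 1 / cmod w" "1 / cmod w \<le> \<kappa> ^ Suc n"
    using ex_power_between[OF assms(1)] by blast
  then have "1 \<le> cmod w * \<kappa> ^ Suc n" "cmod w * \<kappa> ^ n \<le> 1"
    using assms by (auto simp: field_simps)
  then have "1 \<le> cmod w * \<kappa> ^ Suc n" "cmod w * \<kappa> ^ Suc n \<le> \<kappa>"
    using assms mult_right_mono[of "cmod w * \<kappa> ^ n" 1 \<kappa>] by (auto simp: mult_ac)
  then show ?thesis using assms
    by (intro that(2)[of "Suc n"]) (auto simp: norm_mult norm_power)
qed

lemma tendsto_div_power:
  fixes w :: complex and \<kappa> :: real
  assumes "1 < \<kappa>"
  shows "(\<lambda>n. w / of_real \<kappa> ^ n) \<longlonglongrightarrow> 0"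
proof -
  have "(\<lambda>n. w * (of_real (1 / \<kappa>)) ^ n) \<longlonglongrightarrow> w * 0"
    using assms by (intro tendsto_intros LIMSEQ_power_zero) (simp add: norm_divide)
  then show ?thesis by (simp add: power_divide)
qed

text \<open>The data that Chebyshev's method provides near infinity: \<open>J\<close> is the finite
  part of the Julia set, \<open>\<Phi>\<close> parametrizes u = 1/z by the linearizing coordinate,
  and \<open>J_scale\<close> expresses invariance of \<open>J\<close> under the map.\<close>

locale scaled_cone =
  fixes J :: "complex set" and \<phi> \<Phi> :: "complex \<Rightarrow> complex" and \<kappa> b \<rho> :: real
  assumes \<kappa>: "1 < \<kappa>" and b: "0 < b" and \<rho>: "0 < \<rho>"
    and cont: "continuous_on (ball 0 \<rho>) \<Phi>"
    and \<Phi>_0_iff: "\<And>w. w \<in> ball 0 \<rho> \<Longrightarrow> \<Phi> w = 0 \<longleftrightarrow> w = 0"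
    and \<Phi>_minus: "\<And>w. w \<in> ball 0 \<rho> \<Longrightarrow> \<Phi> (- w) = - \<Phi> w"
    and \<Phi>_cnj: "\<And>w. w \<in> ball 0 \<rho> \<Longrightarrow> \<Phi> (cnj w) = cnj (\<Phi> w)"
    and \<Phi>_lim: "((\<lambda>w. (\<Phi> w - w) / w ^ 3) \<longlongrightarrow> - of_real b) (at 0)"
    and \<phi>_lim: "((\<lambda>u. (\<phi> u - u) / u ^ 3) \<longlongrightarrow> of_real b) (at 0)"
    and \<phi>_0: "\<phi> 0 = 0"
    and \<phi>_inv: "\<forall>\<^sub>F u in nhds 0. \<phi> u \<in> ball 0 \<rho> \<and> \<Phi> (\<phi> u) = u"
    and closed_J: "closed J"
    and J_minus: "\<And>z. z \<in> J \<Longrightarrow> - z \<in> J"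
    and J_cnj: "\<And>z. z \<in> J \<Longrightarrow> cnj z \<in> J"
    and J_scale: "\<And>w. w \<in> ball 0 \<rho> \<Longrightarrow> w \<noteq> 0 \<Longrightarrow> 1 / \<Phi> (w / of_real \<kappa>) \<in> J \<longleftrightarrow> 1 / \<Phi> w \<in> J"
    and J_imag: "\<And>y::real. y \<noteq> 0 \<Longrightarrow> \<i> * of_real y \<in> J"
    and J_real: "\<exists>X::real. \<forall>x::real. \<bar>x\<bar> > X \<longrightarrow> of_real x \<notin> J"
begin

text \<open>\<open>J\<close> in the linearizing coordinate. \<open>\<Phi>\<close> is controlled only
  on a disc, so a point is first scaled into it; this extends the set to the whole punctured
  plane.\<close>

definition S :: "complex set" where
  "S = {w. w \<noteq> 0 \<and> (\<exists>n. w / of_real \<kappa> ^ n \<in> ball 0 \<rho> \<and> 1 / \<Phi> (w / of_real \<kappa> ^ n) \<in> J)}"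

lemma div_in_ball: "w \<in> ball 0 \<rho> \<Longrightarrow> w / of_real \<kappa> ^ n \<in> ball (0::complex) \<rho>"
proof -
  assume w: "w \<in> ball 0 \<rho>"
  have "1 \<le> \<kappa> ^ n" using \<kappa> by (intro one_le_power) simp
  then have "cmod w / \<kappa> ^ n \<le> cmod w / 1" using \<kappa> by (intro divide_left_mono) auto
  then show ?thesis using w \<kappa> by (simp add: norm_divide norm_power)
qed

lemma ex_div_in_ball: "\<exists>n. w / of_real \<kappa> ^ n \<in> ball (0::complex) \<rho>"
proof -
  have "\<forall>\<^sub>F n in sequentially. w / of_real \<kappa> ^ n \<in> ball (0::complex) \<rho>"
    by (rule topological_tendstoD[OF tendsto_div_power[OF \<kappa>]]) (use \<rho> in auto)
  then show ?thesis by (auto simp: eventually_sequentially)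
qed

lemma J_scale_power:
  assumes "w \<in> ball 0 \<rho>" "w \<noteq> 0"
  shows "1 / \<Phi> (w / of_real \<kappa> ^ n) \<in> J \<longleftrightarrow> 1 / \<Phi> w \<in> J"
proof (induction n)
  case (Suc n)
  have "w / of_real \<kappa> ^ n \<noteq> 0" using assms \<kappa> by simp
  from J_scale[OF div_in_ball[OF assms(1), of n] this] Suc show ?case
    by (simp add: divide_divide_eq_left mult.commute)
qed simp

text \<open>By \<open>J_scale\<close> all admissible exponents give the same answer, so any single
  one decides membership.\<close>

lemma S_iff:
  assumes "w \<noteq> 0" "w / of_real \<kappa> ^ n \<in> ball 0 \<rho>"
  shows "w \<in> S \<longleftrightarrow> 1 / \<Phi> (w / of_real \<kappa> ^ n) \<in> J"
proof -
  have "1 / \<Phi> (w / of_real \<kappa> ^ m) \<in> J \<longleftrightarrow> 1 / \<Phi> (w / of_real \<kappa> ^ n) \<in> J"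
    if "w / of_real \<kappa> ^ m \<in> ball 0 \<rho>" "w / of_real \<kappa> ^ n \<in> ball 0 \<rho>" "m \<le> n" for m n
  proof -
    have "w / of_real \<kappa> ^ n = w / of_real \<kappa> ^ m / of_real \<kappa> ^ (n - m)"
      using that(3) by (simp flip: power_add)
    moreover have "w / of_real \<kappa> ^ m \<noteq> 0" using assms(1) \<kappa> by simp
    ultimately show ?thesis using J_scale_power[OF that(1)] by metis
  qed
  then have "1 / \<Phi> (w / of_real \<kappa> ^ m) \<in> J \<longleftrightarrow> 1 / \<Phi> (w / of_real \<kappa> ^ n) \<in> J"
    if "w / of_real \<kappa> ^ m \<in> ball 0 \<rho>" for m
    using that assms(2) by (cases "m \<le> n") (metis, metis nat_le_linear)
  then show ?thesis unfolding S_def using assms by blast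
qed

lemma S_iff_ball: "w \<noteq> 0 \<Longrightarrow> w \<in> ball 0 \<rho> \<Longrightarrow> w \<in> S \<longleftrightarrow> 1 / \<Phi> w \<in> J"
  using S_iff[of w 0] by simp

lemma S_nonzero: "w \<in> S \<Longrightarrow> w \<noteq> 0"
  by (simp add: S_def)

lemma S_div: "w / of_real \<kappa> ^ n \<in> S \<longleftrightarrow> w \<in> S"
proof (cases "w = 0")
  case False
  obtain m where m: "w / of_real \<kappa> ^ m \<in> ball 0 \<rho>" using ex_div_in_ball by blast
  then have m': "w / of_real \<kappa> ^ (m + n) \<in> ball 0 \<rho>"
    using div_in_ball[OF m, of n] by (simp add: power_add)
  have eq: "w / of_real \<kappa> ^ n / of_real \<kappa> ^ m = w / of_real \<kappa> ^ (m + n)"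
    by (simp add: power_add mult.commute)
  have "w / of_real \<kappa> ^ n \<noteq> 0" using False \<kappa> by simp
  from S_iff[OF this, of m, unfolded eq, OF m'] S_iff[OF False m'] show ?thesis by blast
qed (use S_nonzero in auto)

lemma S_mult: "w * of_real \<kappa> ^ n \<in> S \<longleftrightarrow> w \<in> S"
  using S_div[of "w * of_real \<kappa> ^ n" n] \<kappa> by simp

lemma S_minus: "w \<in> S \<Longrightarrow> - w \<in> S"
proof -
  assume w: "w \<in> S"
  obtain m where m: "w / of_real \<kappa> ^ m \<in> ball 0 \<rho>" using ex_div_in_ball by blast
  then have m': "- w / of_real \<kappa> ^ m \<in> ball 0 \<rho>" by simp
  have "1 / \<Phi> (w / of_real \<kappa> ^ m) \<in> J" using w S_iff[OF S_nonzero[OF w] m] by simp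
  then have "1 / \<Phi> (- w / of_real \<kappa> ^ m) \<in> J"
    using J_minus \<Phi>_minus[OF m] by fastforce
  then show ?thesis using S_iff[OF _ m'] S_nonzero[OF w] by simp
qed

lemma S_cnj: "w \<in> S \<Longrightarrow> cnj w \<in> S"
proof -
  assume w: "w \<in> S"
  obtain m where m: "w / of_real \<kappa> ^ m \<in> ball 0 \<rho>" using ex_div_in_ball by blast
  then have m': "cnj w / of_real \<kappa> ^ m \<in> ball 0 \<rho>" by (simp add: norm_divide)
  have "1 / \<Phi> (w / of_real \<kappa> ^ m) \<in> J" using w S_iff[OF S_nonzero[OF w] m] by simp
  then have "1 / \<Phi> (cnj w / of_real \<kappa> ^ m) \<in> J"
    using J_cnj \<Phi>_cnj[OF m] by fastforce
  then show ?thesis using S_iff[OF _ m'] S_nonzero[OF w] by simp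
qed

text \<open>S is closed only in the punctured plane: it is nonempty and scale-invariant, so it
  accumulates at 0.\<close>

lemma open_compl_S: "open {w. w \<noteq> 0 \<and> w \<notin> S}"
proof -
  define A where "A = (\<lambda>n. {w::complex. w / of_real \<kappa> ^ n \<in> ball 0 \<rho> \<and> w \<noteq> 0})"
  have oA: "open (A n)" for n
  proof -
    have "A n = ((\<lambda>w::complex. w / of_real \<kappa> ^ n) -` ball 0 \<rho>) \<inter> (- {0})" by (auto simp: A_def)
    moreover have "open ((\<lambda>w::complex. w / of_real \<kappa> ^ n) -` ball 0 \<rho>)"
      by (rule open_vimage) (use \<kappa> in \<open>auto intro!: continuous_intros\<close>)
    ultimately show ?thesis by auto
  qed
  have "continuous_on (A n) (\<lambda>w. 1 / \<Phi> (w / of_real \<kappa> ^ n))" for n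
  proof (intro continuous_intros ballI)
    show "continuous_on (A n) (\<lambda>w. \<Phi> (w / of_real \<kappa> ^ n))"
    proof (rule continuous_on_compose2[OF cont])
      show "continuous_on (A n) (\<lambda>w. w / of_real \<kappa> ^ n)"
        using \<kappa> by (intro continuous_intros) auto
      show "(\<lambda>w. w / of_real \<kappa> ^ n) ` A n \<subseteq> ball 0 \<rho>" unfolding A_def by blast
    qed
    show "\<Phi> (w / of_real \<kappa> ^ n) \<noteq> 0" if "w \<in> A n" for w
      using that \<Phi>_0_iff[of "w / of_real \<kappa> ^ n"] \<kappa> by (auto simp: A_def)
  qed
  then have "open (A n \<inter> (\<lambda>w. 1 / \<Phi> (w / of_real \<kappa> ^ n)) -` (- J))" for n
    using oA closed_J by (intro continuous_open_preimage) auto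
  moreover have "{w. w \<noteq> 0 \<and> w \<notin> S} = (\<Union>n. A n \<inter> (\<lambda>w. 1 / \<Phi> (w / of_real \<kappa> ^ n)) -` (- J))"
    (is "?L = ?R")
  proof (intro equalityI subsetI)
    fix w assume w: "w \<in> ?L"
    obtain m where m: "w / of_real \<kappa> ^ m \<in> ball 0 \<rho>" using ex_div_in_ball by blast
    then have "1 / \<Phi> (w / of_real \<kappa> ^ m) \<notin> J" using w S_iff by blast
    then show "w \<in> ?R" using w m by (auto simp: A_def)
  next
    fix w assume "w \<in> ?R"
    then obtain n where "w / of_real \<kappa> ^ n \<in> ball 0 \<rho>" "w \<noteq> 0" "1 / \<Phi> (w / of_real \<kappa> ^ n) \<notin> J"
      by (auto simp: A_def)
    then show "w \<in> ?L" using S_iff by blast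
  qed
  ultimately show ?thesis by auto
qed

lemma S_closed:
  assumes "(f \<longlongrightarrow> w) F" "F \<noteq> bot" "w \<noteq> 0" "\<forall>\<^sub>F x in F. f x \<in> S"
  shows "w \<in> S"
proof (rule ccontr)
  assume "w \<notin> S"
  then have "\<forall>\<^sub>F x in F. f x \<in> {w. w \<noteq> 0 \<and> w \<notin> S}"
    using topological_tendstoD[OF assms(1) open_compl_S] assms(3) by auto
  with assms(4) have "\<forall>\<^sub>F x in F. False" by eventually_elim auto
  then show False using assms(2) by (simp add: eventually_False)
qed

lemma \<Phi>_zero: "\<Phi> 0 = 0"
  using \<Phi>_0_iff[of 0] \<rho> by simp

lemma \<Phi>_tendsto: "(\<Phi> \<longlongrightarrow> 0) (at 0)"
  using cont \<rho> \<Phi>_zero by (metis centre_in_ball continuous_on_def at_within_open open_ball)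

text \<open>By conjugation symmetry \<open>\<Phi>\<close> is real on real points. Scaling a real
  point of S towards 0 would yield real points of J of arbitrarily large modulus, against
  \<open>J_real\<close>.\<close>

lemma real_notin_S: "of_real x \<notin> S"
proof
  assume S: "of_real x \<in> S"
  obtain X where X: "\<And>x::real. \<bar>x\<bar> > X \<Longrightarrow> of_real x \<notin> J" using J_real by blast
  define w where "w = (\<lambda>n. complex_of_real x / of_real \<kappa> ^ n)"
  have x0: "x \<noteq> 0" using S_nonzero[OF S] by auto
  have w0: "w n \<noteq> 0" for n using x0 \<kappa> by (simp add: w_def)
  have lim: "w \<longlonglongrightarrow> 0" unfolding w_def by (rule tendsto_div_power[OF \<kappa>])
  then have "filterlim w (at 0) sequentially" using w0 by (simp add: filterlim_at)
  from filterlim_compose[OF \<Phi>_tendsto this] have "(\<lambda>n. \<Phi> (w n)) \<longlonglongrightarrow> 0" .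
  then have "\<forall>\<^sub>F n in sequentially. cmod (\<Phi> (w n)) < 1 / (\<bar>X\<bar> + 1)"
    using tendsto_norm_zero by (intro order_tendstoD(2)[of _ 0]) fastforce+
  moreover have "\<forall>\<^sub>F n in sequentially. w n \<in> ball 0 \<rho>"
    using topological_tendstoD[OF lim open_ball, of 0 \<rho>] \<rho> by simp
  ultimately have "\<forall>\<^sub>F n in sequentially. cmod (\<Phi> (w n)) < 1 / (\<bar>X\<bar> + 1) \<and> w n \<in> ball 0 \<rho>"
    by (rule eventually_conj)
  then obtain n where n: "cmod (\<Phi> (w n)) < 1 / (\<bar>X\<bar> + 1)" "w n \<in> ball 0 \<rho>"
    using eventually_happens' sequentially_bot by blast
  have "cnj (w n) = w n" by (simp add: w_def)
  then have "cnj (\<Phi> (w n)) = \<Phi> (w n)" using \<Phi>_cnj[OF n(2)] by simp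
  then have "\<Phi> (w n) \<in> \<real>" by (simp add: Reals_cnj_iff)
  then obtain y where y: "\<Phi> (w n) = of_real y" by (auto elim: Reals_cases)
  have "y \<noteq> 0" using \<Phi>_0_iff[OF n(2)] w0 y by auto
  then have "\<bar>X\<bar> + 1 < \<bar>1 / y\<bar>" using n(1) y by (simp add: field_simps)
  then have "of_real (1 / y) \<notin> J" by (intro X) simp
  moreover have "1 / \<Phi> (w n) \<in> J"
    using S_iff[of "of_real x" n] S x0 n(2) by (simp add: w_def)
  ultimately show False by (simp add: y)
qed

text \<open>\<open>\<Phi>\<close> commutes with the reflection w \<mapsto> - cnj w, so it maps the
  imaginary axis into itself.\<close>

lemma imag_in_S: "y \<noteq> 0 \<Longrightarrow> \<i> * of_real y \<in> S"
proof -
  assume y: "y \<noteq> 0"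
  define w where "w = \<i> * complex_of_real y"
  obtain m where m: "w / of_real \<kappa> ^ m \<in> ball 0 \<rho>" using ex_div_in_ball by blast
  define v where "v = w / of_real \<kappa> ^ m"
  have v: "v \<in> ball 0 \<rho>" "- cnj v = v" "v \<noteq> 0" using m y \<kappa> by (auto simp: v_def w_def)
  have "cnj v \<in> ball 0 \<rho>" using v by simp
  then have "\<Phi> v = - cnj (\<Phi> v)" using \<Phi>_minus[of "cnj v"] \<Phi>_cnj[OF v(1)] v(2) by simp
  then have "Re (\<Phi> v) = - Re (\<Phi> v)" by (metis complex_cnj(1) cnj.simps(1) uminus_complex.simps(1))
  then have re: "Re (\<Phi> v) = 0" by simp
  define t where "t = Im (\<Phi> v)"
  have t: "\<Phi> v = \<i> * of_real t" using re by (simp add: t_def complex_eq_iff)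
  have "t \<noteq> 0" using \<Phi>_0_iff[OF v(1)] v(3) t by auto
  then have "1 / \<Phi> v = \<i> * of_real (- 1 / t)" by (simp add: t field_simps)
  then have "1 / \<Phi> v \<in> J" using J_imag[of "- 1 / t"] \<open>t \<noteq> 0\<close> by simp
  then show ?thesis using S_iff[of w m] m y by (simp add: w_def[symmetric] v_def[symmetric]) (simp add: w_def)
qed

text \<open>The point \<open>w0\<close> spans the ray of S in the upper half-plane closest to the
  positive real axis: \<open>Im (w * cnj w0)\<close> \<ge> 0 says that w has no smaller argument. It
  maximizes Re/Im over the compact half-annulus, where Im cannot vanish on S.\<close>

lemma ex_extremal:
  obtains w0 where "w0 \<in> S" "Im w0 > 0" "\<And>w. w \<in> S \<Longrightarrow> Im w > 0 \<Longrightarrow> 0 \<le> Im (w * cnj w0)"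
proof -
  define B where "B = {w. 1 \<le> cmod w \<and> cmod w \<le> \<kappa> \<and> 0 \<le> Im w}"
  have Im0: "Im w \<noteq> 0" if "w \<in> S" for w
    using that real_notin_S[of "Re w"] complex_is_Real_iff[of w] by (auto elim!: Reals_cases)
  have "closed B"
    unfolding B_def by (intro closed_Collect_conj closed_Collect_le continuous_intros)
  moreover have "B \<subseteq> cball 0 \<kappa>" by (auto simp: B_def)
  ultimately have "compact B"
    using bounded_subset[OF bounded_cball] compact_eq_bounded_closed by blast
  moreover have "B \<inter> S = B - {w. w \<noteq> 0 \<and> w \<notin> S}" by (auto simp: B_def)
  ultimately have "compact (B \<inter> S)" using open_compl_S by (simp add: compact_diff)
  moreover have "\<i> \<in> B \<inter> S" using imag_in_S[of 1] \<kappa> by (simp add: B_def)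
  moreover have "continuous_on (B \<inter> S) (\<lambda>w. Re w / Im w)"
    using Im0 by (intro continuous_intros) auto
  ultimately obtain w0 where w0: "w0 \<in> B \<inter> S" "\<And>w. w \<in> B \<inter> S \<Longrightarrow> Re w / Im w \<le> Re w0 / Im w0"
    using continuous_attains_sup[of "B \<inter> S" "\<lambda>w. Re w / Im w"] by blast
  have i0: "Im w0 > 0" using w0(1) Im0[of w0] by (auto simp: B_def)
  show thesis
  proof (rule that[of w0])
    fix w assume w: "w \<in> S" "Im w > 0"
    \<comment> \<open>Re/Im is unchanged by positive scaling, so a point may be moved into the
      annulus before it is compared with \<open>w0\<close>.\<close>
    have key: "0 \<le> Im (w * cnj w0)" if t: "of_real t * w \<in> B \<inter> S" "t > 0" for t
    proof -
      have "Re (of_real t * w) / Im (of_real t * w) = Re w / Im w" using t by simp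
      then have "Re w / Im w \<le> Re w0 / Im w0" using w0(2)[OF t(1)] by simp
      then show ?thesis using w(2) i0 by (simp add: field_simps)
    qed
    from \<kappa> S_nonzero[OF w(1)] show "0 \<le> Im (w * cnj w0)"
    proof (cases rule: ex_scale_annulus)
      case (1 n)
      have eq: "of_real (1 / \<kappa> ^ n) * w = w / of_real \<kappa> ^ n" by simp
      moreover have "w / of_real \<kappa> ^ n \<in> B \<inter> S"
        using 1 S_div w \<kappa> by (auto simp: B_def simp flip: of_real_power)
      ultimately show ?thesis using \<kappa> by (intro key[of "1 / \<kappa> ^ n"]) (simp_all only: eq, simp_all)
    next
      case (2 n)
      have eq: "of_real (\<kappa> ^ n) * w = w * of_real \<kappa> ^ n" by simp
      moreover have "w * of_real \<kappa> ^ n \<in> B \<inter> S"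
        using 2 S_mult w \<kappa> by (auto simp: B_def simp flip: of_real_power)
      ultimately show ?thesis using \<kappa> by (intro key[of "\<kappa> ^ n"]) (simp_all only: eq, simp_all)
    qed
  qed (use w0 i0 in auto)
qed

lemma tendsto_of_cubic:
  fixes f :: "complex \<Rightarrow> complex"
  assumes "((\<lambda>w. (f w - w) / w ^ 3) \<longlongrightarrow> l) (at 0)"
  shows "((\<lambda>w. f w / w) \<longlongrightarrow> 1) (at 0)" "((\<lambda>w. (f w - w) / w\<^sup>2) \<longlongrightarrow> 0) (at 0)"
proof -
  have "((\<lambda>w. (f w - w) / w ^ 3 * w) \<longlongrightarrow> l * 0) (at 0)" by (intro tendsto_intros assms)
  moreover have "\<forall>\<^sub>F w in at 0. (f w - w) / w ^ 3 * w = (f w - w) / w\<^sup>2"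
    using eventually_neq_at_within[of 0] by eventually_elim (simp add: divide_simps eval_nat_numeral)
  ultimately have "((\<lambda>w. (f w - w) / w\<^sup>2) \<longlongrightarrow> l * 0) (at 0)" by (rule Lim_transform_eventually)
  then show 2: "((\<lambda>w. (f w - w) / w\<^sup>2) \<longlongrightarrow> 0) (at 0)" by simp
  have "((\<lambda>w. (f w - w) / w\<^sup>2 * w + 1) \<longlongrightarrow> 0 * 0 + 1) (at 0)" by (intro tendsto_intros 2)
  moreover have "\<forall>\<^sub>F w in at 0. (f w - w) / w\<^sup>2 * w + 1 = f w / w"
    using eventually_neq_at_within[of 0] by eventually_elim (simp add: divide_simps eval_nat_numeral)
  ultimately have "((\<lambda>w. f w / w) \<longlongrightarrow> 0 * 0 + 1) (at 0)" by (rule Lim_transform_eventually)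
  then show "((\<lambda>w. f w / w) \<longlongrightarrow> 1) (at 0)" by simp
qed

end

lemma Im_of_real_mult: "Im (of_real r * z) = r * Im z"
  by simp

section \<open>Extremal rays and the action of a symmetry on them\<close>

context scaled_cone
begin

text \<open>\<open>Im (w * cnj w1)\<close> has the sign of the angle from w1 to a nearby w. Locally
  S thus lies on one side of the ray through w1, the sign of \<open>s\<close> telling which;
  negation keeps the side, conjugation swaps it.\<close>

definition extremal :: "real \<Rightarrow> complex \<Rightarrow> bool" where
  "extremal s w1 \<longleftrightarrow> w1 \<in> S \<and> (\<forall>\<^sub>F w in nhds w1. w \<in> S \<longrightarrow> 0 \<le> s * Im (w * cnj w1))"

lemma extremal_minus:
  assumes "extremal s w" shows "extremal s (- w)"
proof -
  have "filterlim uminus (nhds w) (nhds (- w))"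
    using tendsto_minus[OF filterlim_ident, of "- w"] by simp
  from eventually_compose_filterlim[OF _ this] assms
  have "\<forall>\<^sub>F v in nhds (- w). - v \<in> S \<longrightarrow> 0 \<le> s * Im (- v * cnj w)"
    unfolding extremal_def by blast
  then have "\<forall>\<^sub>F v in nhds (- w). v \<in> S \<longrightarrow> 0 \<le> s * Im (v * cnj (- w))"
    by eventually_elim (use S_minus in auto)
  then show ?thesis using assms S_minus by (auto simp: extremal_def)
qed

lemma extremal_cnj:
  assumes "extremal s w" shows "extremal (- s) (cnj w)"
proof -
  have "filterlim cnj (nhds w) (nhds (cnj w))"
    using tendsto_cnj[OF filterlim_ident, of "cnj w"] by simp
  from eventually_compose_filterlim[OF _ this] assms
  have "\<forall>\<^sub>F v in nhds (cnj w). cnj v \<in> S \<longrightarrow> 0 \<le> s * Im (cnj v * cnj w)"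
    unfolding extremal_def by blast
  then have "\<forall>\<^sub>F v in nhds (cnj w). v \<in> S \<longrightarrow> 0 \<le> - s * Im (v * cnj (cnj w))"
    by eventually_elim (use S_cnj in \<open>auto simp: algebra_simps\<close>)
  then show ?thesis using assms S_cnj by (auto simp: extremal_def)
qed

definition J_symmetry :: "complex \<Rightarrow> complex \<Rightarrow> bool" where
  "J_symmetry \<alpha> \<beta> \<longleftrightarrow> cmod \<alpha> = 1 \<and> (\<forall>z. \<alpha> * z + \<beta> \<in> J \<longleftrightarrow> z \<in> J)"

lemma J_symmetry_nonzero: "J_symmetry \<alpha> \<beta> \<Longrightarrow> \<alpha> \<noteq> 0"
  by (auto simp: J_symmetry_def)

lemma J_symmetry_inverse:
  assumes "J_symmetry \<alpha> \<beta>" shows "J_symmetry (1 / \<alpha>) (- \<beta> / \<alpha>)"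
  unfolding J_symmetry_def
proof (intro conjI allI)
  show "cmod (1 / \<alpha>) = 1" using assms by (simp add: J_symmetry_def norm_divide)
  fix z
  have "\<alpha> * (1 / \<alpha> * z + - \<beta> / \<alpha>) + \<beta> = z"
    using J_symmetry_nonzero[OF assms] by (simp add: field_simps)
  then show "1 / \<alpha> * z + - \<beta> / \<alpha> \<in> J \<longleftrightarrow> z \<in> J"
    using assms unfolding J_symmetry_def by metis
qed

text \<open>The isometry \<open>z \<mapsto> \<alpha> z + \<beta>\<close> in the linearizing coordinate \<open>w\<close>, where \<open>z = 1 / \<Phi> w\<close>.\<close>

definition lin :: "complex \<Rightarrow> complex \<Rightarrow> complex \<Rightarrow> complex" where
  "lin \<alpha> \<beta> w = \<phi> (\<Phi> w / (\<alpha> + \<beta> * \<Phi> w))"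

lemma filterlim_\<Phi>: "filterlim \<Phi> (at 0) (at 0)"
proof -
  have "\<forall>\<^sub>F w in at 0. \<Phi> w / w \<noteq> 0"
    using tendsto_imp_eventually_ne[OF tendsto_of_cubic(1)[OF \<Phi>_lim], of 0] by simp
  then have "\<forall>\<^sub>F w in at 0. \<Phi> w \<noteq> 0" by eventually_elim auto
  then show ?thesis using \<Phi>_tendsto by (simp add: filterlim_at)
qed

lemma \<Phi>_quot: "((\<lambda>w. \<Phi> w / w) \<longlongrightarrow> 1) (at 0)"
  by (rule tendsto_of_cubic(1)[OF \<Phi>_lim])

context
  fixes \<alpha> \<beta> :: complex
  assumes sym: "J_symmetry \<alpha> \<beta>"
begin

lemma \<alpha>0: "\<alpha> \<noteq> 0"
  using sym by (rule J_symmetry_nonzero)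

lemma denom_tendsto: "((\<lambda>w. \<alpha> + \<beta> * \<Phi> w) \<longlongrightarrow> \<alpha>) (at 0)"
  by (rule tendsto_eq_intros \<Phi>_tendsto refl | simp)+

lemma denom_nonzero: "\<forall>\<^sub>F w in at 0. \<alpha> + \<beta> * \<Phi> w \<noteq> 0"
  using tendsto_imp_eventually_ne[OF denom_tendsto \<alpha>0] .

lemma \<Phi>_nonzero: "\<forall>\<^sub>F w in at 0. \<Phi> w \<noteq> 0"
  using filterlim_\<Phi> by (simp add: filterlim_at)

lemma moebius_tendsto: "filterlim (\<lambda>w. \<Phi> w / (\<alpha> + \<beta> * \<Phi> w)) (at 0) (at 0)"
proof -
  have "((\<lambda>w. \<Phi> w / (\<alpha> + \<beta> * \<Phi> w)) \<longlongrightarrow> 0 / \<alpha>) (at 0)"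
    by (intro tendsto_divide \<Phi>_tendsto denom_tendsto \<alpha>0)
  moreover have "\<forall>\<^sub>F w in at 0. \<Phi> w / (\<alpha> + \<beta> * \<Phi> w) \<noteq> 0"
    using denom_nonzero \<Phi>_nonzero by eventually_elim simp
  ultimately show ?thesis by (simp add: filterlim_at)
qed

text \<open>Near 0 the function \<Phi> undoes \<phi>, so 1/\<Phi>(lin w) = \<alpha>/\<Phi>(w) +
  \<beta>, which is the image of 1/\<Phi>(w) under the symmetry.\<close>

lemma lin_in_S: "\<forall>\<^sub>F w in at 0. w \<in> S \<longrightarrow> lin \<alpha> \<beta> w \<in> S"
proof -
  have "\<forall>\<^sub>F u in at 0. \<phi> u \<in> ball 0 \<rho> \<and> \<Phi> (\<phi> u) = u"
    using \<phi>_inv eventually_nhds_conv_at by blast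
  from eventually_compose_filterlim[OF this moebius_tendsto]
  have 1: "\<forall>\<^sub>F w in at 0. lin \<alpha> \<beta> w \<in> ball 0 \<rho> \<and> \<Phi> (lin \<alpha> \<beta> w) = \<Phi> w / (\<alpha> + \<beta> * \<Phi> w)"
    by (simp add: lin_def)
  have 2: "\<forall>\<^sub>F w::complex in at 0. w \<in> ball 0 \<rho>"
    using eventually_at_ball[OF \<rho>, of "0::complex" UNIV] by (rule eventually_mono) auto
  show ?thesis
    using 1 2 denom_nonzero \<Phi>_nonzero
  proof eventually_elim
    case (elim w)
    show ?case
    proof
      assume w: "w \<in> S"
      have "1 / \<Phi> w \<in> J" using S_iff_ball[OF S_nonzero[OF w]] elim w by blast
      then have "\<alpha> * (1 / \<Phi> w) + \<beta> \<in> J" using sym unfolding J_symmetry_def by blast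
      also have "\<alpha> * (1 / \<Phi> w) + \<beta> = 1 / \<Phi> (lin \<alpha> \<beta> w)"
        using elim by (simp add: add_divide_distrib)
      finally have "1 / \<Phi> (lin \<alpha> \<beta> w) \<in> J" .
      moreover have "\<Phi> (lin \<alpha> \<beta> w) \<noteq> 0" using elim by simp
      then have "lin \<alpha> \<beta> w \<noteq> 0" using \<Phi>_zero by metis
      ultimately show "lin \<alpha> \<beta> w \<in> S" using S_iff_ball elim by blast
    qed
  qed
qed

lemma moebius_quot: "((\<lambda>w. \<Phi> w / (\<alpha> + \<beta> * \<Phi> w) / w) \<longlongrightarrow> 1 / \<alpha>) (at 0)"
proof -
  have "((\<lambda>w. \<Phi> w / w / (\<alpha> + \<beta> * \<Phi> w)) \<longlongrightarrow> 1 / \<alpha>) (at 0)"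
    by (intro tendsto_divide \<Phi>_quot denom_tendsto \<alpha>0)
  then show ?thesis by (simp add: field_simps)
qed

lemma lin_quot: "((\<lambda>w. lin \<alpha> \<beta> w / w) \<longlongrightarrow> 1 / \<alpha>) (at 0)"
proof -
  have "((\<lambda>w. \<phi> (\<Phi> w / (\<alpha> + \<beta> * \<Phi> w)) / (\<Phi> w / (\<alpha> + \<beta> * \<Phi> w)) * (\<Phi> w / (\<alpha> + \<beta> * \<Phi> w) / w)) \<longlongrightarrow> 1 * (1 / \<alpha>)) (at 0)"
    by (intro tendsto_mult moebius_quot filterlim_compose[OF tendsto_of_cubic(1)[OF \<phi>_lim] moebius_tendsto])
  moreover have "\<forall>\<^sub>F w in at 0. \<phi> (\<Phi> w / (\<alpha> + \<beta> * \<Phi> w)) / (\<Phi> w / (\<alpha> + \<beta> * \<Phi> w)) * (\<Phi> w / (\<alpha> + \<beta> * \<Phi> w) / w) = lin \<alpha> \<beta> w / w"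
    using denom_nonzero \<Phi>_nonzero by eventually_elim (simp add: lin_def)
  ultimately have "((\<lambda>w. lin \<alpha> \<beta> w / w) \<longlongrightarrow> 1 * (1 / \<alpha>)) (at 0)"
    by (rule Lim_transform_eventually)
  then show ?thesis by simp
qed

text \<open>\<phi> and \<Phi> have no quadratic term, so the second-order term comes from the
  Moebius map u \<mapsto> u/(\<alpha> + \<beta>u) alone.\<close>

lemma lin_second_order: "((\<lambda>w. (lin \<alpha> \<beta> w - w / \<alpha>) / w\<^sup>2) \<longlongrightarrow> - \<beta> / \<alpha>\<^sup>2) (at 0)"
proof -
  define t where "t = (\<lambda>w. \<Phi> w / (\<alpha> + \<beta> * \<Phi> w))"
  have fl: "filterlim t (at 0) (at 0)" unfolding t_def by (rule moebius_tendsto)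
  have tq: "((\<lambda>w. t w / w) \<longlongrightarrow> 1 / \<alpha>) (at 0)" unfolding t_def by (rule moebius_quot)
  \<comment> \<open>The difference lin w - w/\<alpha> is split as (\<phi> t - t) + (t -
    \<Phi>/\<alpha>) + (\<Phi> - w)/\<alpha>, and only the middle term contributes in the
    limit.\<close>
  have "((\<lambda>w. (\<phi> (t w) - t w) / (t w)\<^sup>2 * (t w / w)\<^sup>2 + - \<beta> * (\<Phi> w / w)\<^sup>2 / (\<alpha> * (\<alpha> + \<beta> * \<Phi> w))
      + (\<Phi> w - w) / w\<^sup>2 / \<alpha>) \<longlongrightarrow> 0 * (1 / \<alpha>)\<^sup>2 + - \<beta> * 1\<^sup>2 / (\<alpha> * \<alpha>) + 0 / \<alpha>) (at 0)"
    using \<alpha>0 by (intro tendsto_intros filterlim_compose[OF tendsto_of_cubic(2)[OF \<phi>_lim] fl] tq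
      \<Phi>_quot denom_tendsto tendsto_of_cubic(2)[OF \<Phi>_lim]) auto
  moreover have "\<forall>\<^sub>F w in at 0. (\<phi> (t w) - t w) / (t w)\<^sup>2 * (t w / w)\<^sup>2 + - \<beta> * (\<Phi> w / w)\<^sup>2 / (\<alpha> * (\<alpha> + \<beta> * \<Phi> w))
      + (\<Phi> w - w) / w\<^sup>2 / \<alpha> = (lin \<alpha> \<beta> w - w / \<alpha>) / w\<^sup>2"
    using denom_nonzero \<Phi>_nonzero eventually_neq_at_within[of 0]
  proof eventually_elim
    case (elim w)
    have t0: "t w \<noteq> 0" using elim by (simp add: t_def)
    have "t w - \<Phi> w / \<alpha> = - \<beta> * (\<Phi> w)\<^sup>2 / (\<alpha> * (\<alpha> + \<beta> * \<Phi> w))"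
      using elim \<alpha>0 by (simp add: t_def divide_simps) (simp add: algebra_simps power2_eq_square)
    then have "- \<beta> * (\<Phi> w / w)\<^sup>2 / (\<alpha> * (\<alpha> + \<beta> * \<Phi> w)) = (t w - \<Phi> w / \<alpha>) / w\<^sup>2"
      by (simp add: power_divide)
    moreover have "(\<phi> (t w) - t w) / (t w)\<^sup>2 * (t w / w)\<^sup>2 = (\<phi> (t w) - t w) / w\<^sup>2"
      using t0 by (simp add: power_divide)
    moreover have "(\<Phi> w - w) / w\<^sup>2 / \<alpha> = (\<Phi> w / \<alpha> - w / \<alpha>) / w\<^sup>2"
      by (simp add: diff_divide_distrib mult.commute)
    moreover have "lin \<alpha> \<beta> w = \<phi> (t w)" by (simp add: lin_def t_def)
    ultimately show ?case
      by (simp only: flip: add_divide_distrib) simp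
  qed
  ultimately have "((\<lambda>w. (lin \<alpha> \<beta> w - w / \<alpha>) / w\<^sup>2) \<longlongrightarrow> 0 * (1 / \<alpha>)\<^sup>2 + - \<beta> * 1\<^sup>2 / (\<alpha> * \<alpha>) + 0 / \<alpha>) (at 0)"
    by (rule Lim_transform_eventually)
  then show ?thesis by (simp add: power2_eq_square)
qed

text \<open>Without translation the Moebius map is linear; the cubic terms of \<phi> and \<Phi>
  contribute b/\<alpha>^3 and -b/\<alpha>.\<close>

lemma lin_third_order:
  assumes "\<beta> = 0"
  shows "((\<lambda>w. (lin \<alpha> \<beta> w - w / \<alpha>) / w ^ 3) \<longlongrightarrow> of_real b * ((1 / \<alpha>) ^ 3 - 1 / \<alpha>)) (at 0)"
proof -
  define t where "t = (\<lambda>w. \<Phi> w / \<alpha>)"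
  have fl: "filterlim t (at 0) (at 0)" using moebius_tendsto by (simp add: t_def assms)
  have tq: "((\<lambda>w. t w / w) \<longlongrightarrow> 1 / \<alpha>) (at 0)" using moebius_quot by (simp add: t_def assms)
  have "((\<lambda>w. (\<phi> (t w) - t w) / (t w) ^ 3 * (t w / w) ^ 3 + (\<Phi> w - w) / w ^ 3 / \<alpha>)
      \<longlongrightarrow> of_real b * (1 / \<alpha>) ^ 3 + - of_real b / \<alpha>) (at 0)"
    using \<alpha>0 by (intro tendsto_intros filterlim_compose[OF \<phi>_lim fl] tq \<Phi>_lim)
  moreover have "\<forall>\<^sub>F w in at 0. (\<phi> (t w) - t w) / (t w) ^ 3 * (t w / w) ^ 3 + (\<Phi> w - w) / w ^ 3 / \<alpha>
      = (lin \<alpha> \<beta> w - w / \<alpha>) / w ^ 3"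
    using \<Phi>_nonzero eventually_neq_at_within[of 0]
  proof eventually_elim
    case (elim w)
    have t0: "t w \<noteq> 0" using elim \<alpha>0 by (simp add: t_def)
    have "(\<phi> (t w) - t w) / (t w) ^ 3 * (t w / w) ^ 3 = (\<phi> (t w) - t w) / w ^ 3"
      using t0 by (simp add: power_divide)
    moreover have "(\<Phi> w - w) / w ^ 3 / \<alpha> = (t w - w / \<alpha>) / w ^ 3"
      by (simp add: t_def diff_divide_distrib mult.commute)
    moreover have "lin \<alpha> \<beta> w = \<phi> (t w)" by (simp add: lin_def t_def assms)
    ultimately show ?case
      by (simp only: flip: add_divide_distrib) simp
  qed
  ultimately have "((\<lambda>w. (lin \<alpha> \<beta> w - w / \<alpha>) / w ^ 3) \<longlongrightarrow> of_real b * (1 / \<alpha>) ^ 3 + - of_real b / \<alpha>) (at 0)"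
    by (rule Lim_transform_eventually)
  then show ?thesis by (simp add: algebra_simps)
qed

text \<open>Conjugating \<open>lin\<close> by scaling with \<kappa>^n preserves S and makes the
  local map near 0 usable at an arbitrary nonzero point.\<close>

lemma scaled_lin:
  assumes "w \<noteq> 0"
  shows "\<forall>\<^sub>F n in sequentially. w \<in> S \<longrightarrow> w * (lin \<alpha> \<beta> (w / of_real \<kappa> ^ n) / (w / of_real \<kappa> ^ n)) \<in> S"
    and "filterlim (\<lambda>n. w / of_real \<kappa> ^ n) (at 0) sequentially"
proof -
  show fl: "filterlim (\<lambda>n. w / of_real \<kappa> ^ n) (at 0) sequentially"
    using tendsto_div_power[OF \<kappa>, of w] assms \<kappa> by (simp add: filterlim_at)
  from eventually_compose_filterlim[OF lin_in_S this]
  show "\<forall>\<^sub>F n in sequentially. w \<in> S \<longrightarrow> w * (lin \<alpha> \<beta> (w / of_real \<kappa> ^ n) / (w / of_real \<kappa> ^ n)) \<in> S"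
  proof eventually_elim
    case (elim n)
    have "w * (lin \<alpha> \<beta> (w / of_real \<kappa> ^ n) / (w / of_real \<kappa> ^ n)) = lin \<alpha> \<beta> (w / of_real \<kappa> ^ n) * of_real \<kappa> ^ n"
      using assms \<kappa> by simp
    then show ?case using elim S_div S_mult by simp
  qed
qed

text \<open>The rescaled maps converge to their linear part w \<mapsto> w/\<alpha>, and S is closed
  away from 0.\<close>

lemma S_rotate: "w \<in> S \<Longrightarrow> w / \<alpha> \<in> S"
proof -
  assume w: "w \<in> S"
  then have w0: "w \<noteq> 0" by (rule S_nonzero)
  have "(\<lambda>n. w * (lin \<alpha> \<beta> (w / of_real \<kappa> ^ n) / (w / of_real \<kappa> ^ n))) \<longlonglongrightarrow> w * (1 / \<alpha>)"
    by (intro tendsto_intros filterlim_compose[OF lin_quot scaled_lin(2)[OF w0]])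
  from S_closed[OF this _ _ eventually_mono[OF scaled_lin(1)[OF w0]]] show ?thesis
    using w w0 \<alpha>0 by simp
qed

end

lemma S_rotate':
  assumes "J_symmetry \<alpha> \<beta>" "w \<in> S" shows "w * \<alpha> \<in> S"
  using S_rotate[OF J_symmetry_inverse[OF assms(1)] assms(2)] by simp

text \<open>Rotating back by \<open>\<alpha>\<close>, the symmetry moves an extremal ray to first order by \<open>l w\<^sup>j\<close>, which has to
  point into the admissible side.\<close>

lemma extremal_first_order:
  assumes sym: "J_symmetry \<alpha> \<beta>" and ext: "extremal s w1"
    and lim: "((\<lambda>w. (lin \<alpha> \<beta> w - w / \<alpha>) / w ^ Suc j) \<longlongrightarrow> l / \<alpha>) (at 0)"
  shows "0 \<le> s * Im (l * w1 ^ j)"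
proof -
  have \<alpha>0: "\<alpha> \<noteq> 0" using J_symmetry_nonzero[OF sym] .
  have w1: "w1 \<in> S" "w1 \<noteq> 0" using ext S_nonzero by (auto simp: extremal_def)
  define v where "v = (\<lambda>n. w1 / of_real \<kappa> ^ n)"
  have v0: "v n \<noteq> 0" for n using w1 \<kappa> by (simp add: v_def)
  have fl: "filterlim v (at 0) sequentially" unfolding v_def by (rule scaled_lin(2)[OF sym w1(2)])
  \<comment> \<open>\<open>w1 * e n\<close> is the rescaled image of \<open>w1\<close>, rotated back
    by \<alpha>. It lies in S and tends to \<open>w1\<close>, so extremality restricts the sign of
    \<open>Im (e n)\<close>, while e n is 1 + l (v n)^j to leading order.\<close>
  define e where "e = (\<lambda>n. lin \<alpha> \<beta> (v n) / v n * \<alpha>)"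
  have e: "e \<longlonglongrightarrow> 1 / \<alpha> * \<alpha>"
    unfolding e_def by (intro tendsto_intros filterlim_compose[OF lin_quot[OF sym] fl])
  then have "(\<lambda>n. w1 * e n) \<longlonglongrightarrow> w1 * 1" using \<alpha>0 by (intro tendsto_intros) simp
  then have "(\<lambda>n. w1 * e n) \<longlonglongrightarrow> w1" by simp
  from eventually_compose_filterlim[OF _ this] ext
  have "\<forall>\<^sub>F n in sequentially. w1 * e n \<in> S \<longrightarrow> 0 \<le> s * Im (w1 * e n * cnj w1)"
    unfolding extremal_def by blast
  moreover have "\<forall>\<^sub>F n in sequentially. w1 * e n \<in> S"
    using scaled_lin(1)[OF sym w1(2)]
  proof eventually_elim
    case (elim n)
    then have "w1 * (lin \<alpha> \<beta> (v n) / v n) * \<alpha> \<in> S" using S_rotate'[OF sym] w1(1) by (simp add: v_def)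
    then show ?case by (simp add: e_def mult.assoc)
  qed
  ultimately have "\<forall>\<^sub>F n in sequentially. 0 \<le> s * Im (l * w1 ^ j) + s * Im (((e n - 1) / v n ^ j - l) * w1 ^ j)"
  proof eventually_elim
    case (elim n)
    define x where "x = \<kappa> ^ n"
    have x: "x > 0" using \<kappa> by (simp add: x_def)
    have vx: "v n * of_real x = w1" using \<kappa> by (simp add: v_def x_def)
    have "w1 * e n * cnj w1 = of_real ((cmod w1)\<^sup>2) * e n"
      unfolding complex_norm_square by simp
    then have "Im (w1 * e n * cnj w1) = (cmod w1)\<^sup>2 * Im (e n)"
      by (simp only: Im_of_real_mult)
    then have "0 \<le> (cmod w1)\<^sup>2 * (s * Im (e n))" using elim by (simp add: mult_ac)
    then have "0 \<le> s * Im (e n)" using w1(2) by (simp add: zero_le_mult_iff)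
    \<comment> \<open>As \<open>w1\<close> is a positive real multiple of \<open>v n\<close>,
      normalizing by the power j only rescales Im (e n) and keeps its sign.\<close>
    moreover have "Im ((e n - 1) / v n ^ j * w1 ^ j) = x ^ j * Im (e n)"
    proof -
      have "(e n - 1) / v n ^ j * w1 ^ j = of_real (x ^ j) * (e n - 1)"
        using v0[of n] by (simp add: power_mult_distrib flip: vx)
      then show ?thesis by (simp only: Im_of_real_mult) simp
    qed
    ultimately have "0 \<le> s * Im ((e n - 1) / v n ^ j * w1 ^ j)"
      using x by (metis mult.left_commute mult_nonneg_nonneg less_imp_le zero_less_power)
    moreover have "(e n - 1) / v n ^ j * w1 ^ j = l * w1 ^ j + ((e n - 1) / v n ^ j - l) * w1 ^ j"
      by (simp add: algebra_simps)
    ultimately show ?case by (simp add: distrib_left)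
  qed
  moreover have "(\<lambda>n. s * Im (l * w1 ^ j) + s * Im (((e n - 1) / v n ^ j - l) * w1 ^ j)) \<longlonglongrightarrow> s * Im (l * w1 ^ j) + s * Im ((l - l) * w1 ^ j)"
  proof (intro tendsto_intros)
    have "(\<lambda>n. (lin \<alpha> \<beta> (v n) - v n / \<alpha>) / v n ^ Suc j * \<alpha>) \<longlonglongrightarrow> l / \<alpha> * \<alpha>"
      by (intro tendsto_intros filterlim_compose[OF lim fl])
    moreover have "(lin \<alpha> \<beta> (v n) - v n / \<alpha>) / v n ^ Suc j * \<alpha> = (e n - 1) / v n ^ j" for n
      using v0[of n] \<alpha>0 by (simp add: e_def field_simps)
    ultimately show "(\<lambda>n. (e n - 1) / v n ^ j) \<longlonglongrightarrow> l" using \<alpha>0 by simp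
  qed
  ultimately have "0 \<le> s * Im (l * w1 ^ j) + s * Im ((l - l) * w1 ^ j)"
    by (intro tendsto_lowerbound) auto
  then show ?thesis by simp
qed

text \<open>If \<beta> \<noteq> 0, the first-order condition has j = 1 and l = -\<beta>/\<alpha>.
  Testing it on \<plusminus>w0 and \<plusminus>cnj w0 forces the extremal ray, and then all of S,
  into the imaginary axis. A translation symmetry finally carries \<open>r\<close> to infinity off
  that axis or along it, and neither is possible.\<close>

lemma translation_part_zero:
  assumes sym: "J_symmetry \<alpha> \<beta>" and r: "r \<in> J" "Re r \<noteq> 0"
  shows "\<beta> = 0"
proof (rule ccontr)
  assume \<beta>: "\<beta> \<noteq> 0"
  have \<alpha>0: "\<alpha> \<noteq> 0" using J_symmetry_nonzero[OF sym] .
  obtain w0 where w0: "w0 \<in> S" "Im w0 > 0" "\<And>w. w \<in> S \<Longrightarrow> Im w > 0 \<Longrightarrow> 0 \<le> Im (w * cnj w0)"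
    using ex_extremal by blast
  have "\<forall>\<^sub>F w in nhds w0. Im w > 0"
    using order_tendstoD(1)[OF tendsto_Im[OF filterlim_ident], of 0 w0] w0 by simp
  then have "\<forall>\<^sub>F w in nhds w0. w \<in> S \<longrightarrow> 0 \<le> 1 * Im (w * cnj w0)"
    by eventually_elim (use w0 in auto)
  then have ext: "extremal 1 w0" using w0 by (simp add: extremal_def)
  define l where "l = - \<beta> / \<alpha>"
  have lim: "((\<lambda>w. (lin \<alpha> \<beta> w - w / \<alpha>) / w ^ Suc 1) \<longlongrightarrow> l / \<alpha>) (at 0)"
    using lin_second_order[OF sym] by (simp add: l_def power2_eq_square)
  note first = extremal_first_order[OF sym _ lim]
  \<comment> \<open>For j = 1 the condition is odd in the ray, so opposite rays turn the inequality
    into an equality.\<close>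
  have l1: "Im (l * w0) = 0"
    using first[OF ext] first[OF extremal_minus[OF ext]] by simp
  have l2: "Im (l * cnj w0) = 0"
    using first[OF extremal_cnj[OF ext]] first[OF extremal_minus[OF extremal_cnj[OF ext]]] by simp
  have "Re l * Im w0 + Im l * Re w0 = 0" "Im l * Re w0 - Re l * Im w0 = 0" using l1 l2 by simp_all
  then have "Re l * Im w0 = 0" "Im l * Re w0 = 0" by linarith+
  moreover have "l \<noteq> 0" using \<beta> \<alpha>0 by (simp add: l_def)
  ultimately have re0: "Re w0 = 0" using w0(2) by (auto simp: complex_eq_iff)
  have le: "Re w \<le> 0" if "w \<in> S" "Im w > 0" for w
    using w0(3)[OF that] re0 w0(2) by (simp add: mult_le_0_iff)
  \<comment> \<open>An imaginary extremal ray leaves no point of S in the open first quadrant;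
    reflection in the imaginary axis excludes the second quadrant too.\<close>
  have upper: "Re w = 0" if w: "w \<in> S" "Im w > 0" for w
  proof -
    have "- cnj w \<in> S" using w S_minus S_cnj by blast
    then show ?thesis using le[OF w] le[of "- cnj w"] w by simp
  qed
  have S_imag: "Re w = 0" if w: "w \<in> S" for w
  proof -
    have "Im w \<noteq> 0"
      using w real_notin_S[of "Re w"] complex_is_Real_iff[of w] by (auto elim!: Reals_cases)
    then show ?thesis using upper[OF w] upper[OF S_minus[OF w]] by (cases "Im w > 0") auto
  qed
  \<comment> \<open>Every point of J near infinity corresponds to a point of S, and \<Phi> maps
    imaginary points to imaginary points.\<close>
  have "\<forall>\<^sub>F u in nhds 0. u \<noteq> 0 \<longrightarrow> 1 / u \<in> J \<longrightarrow> Re (1 / u) = 0"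
    using \<phi>_inv
  proof eventually_elim
    case (elim u)
    show ?case
    proof (intro impI)
      assume u: "u \<noteq> 0" "1 / u \<in> J"
      define w where "w = \<phi> u"
      have w: "w \<in> ball 0 \<rho>" "\<Phi> w = u" using elim by (auto simp: w_def)
      have wn: "w \<noteq> 0" using w u \<Phi>_zero by auto
      then have "w \<in> S" using S_iff_ball[OF wn w(1)] u(2) w(2) by simp
      then have "Re w = 0" by (rule S_imag)
      then have cw: "- cnj w = w" by (simp add: complex_eq_iff)
      have "cnj w \<in> ball 0 \<rho>" using w by simp
      then have "u = - cnj u" using \<Phi>_minus[of "cnj w"] \<Phi>_cnj[OF w(1)] cw w(2) by simp
      from arg_cong[OF this, of Re] have "Re u = 0" by simp
      then show "Re (1 / u) = 0" by (simp add: Re_divide)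
    qed
  qed
  then obtain d where d: "d > 0" "\<And>u. cmod u < d \<Longrightarrow> u \<noteq> 0 \<Longrightarrow> 1 / u \<in> J \<Longrightarrow> Re (1 / u) = 0"
    unfolding eventually_nhds_metric by (auto simp: dist_norm)
  have far: "Re z = 0" if z: "z \<in> J" "cmod z > 1 / d" for z
  proof -
    have "1 / d > 0" using d by simp
    then have "cmod z > 0" using z(2) by linarith
    then have "z \<noteq> 0" by auto
    moreover have "cmod (1 / z) < d" using z \<open>cmod z > 0\<close> d(1) by (simp add: norm_divide field_simps)
    ultimately show ?thesis using d(2)[of "1 / z"] z(1) by simp
  qed
  have i: "\<i> \<in> S" using imag_in_S[of 1] by simp
  have "Re (\<i> * \<alpha>) = 0" by (rule S_imag[OF S_rotate'[OF sym i]])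
  then have "Im \<alpha> = 0" by simp
  then have "\<alpha> = of_real (Re \<alpha>)" by (simp add: complex_eq_iff)
  moreover have "cmod \<alpha> = 1" using sym by (simp add: J_symmetry_def)
  ultimately have \<alpha>: "\<alpha> = 1 \<or> \<alpha> = - 1"
    by (metis abs_if minus_minus norm_of_real of_real_1 of_real_minus)
  \<comment> \<open>For \<alpha> = -1, composing the symmetry with z \<mapsto> -z gives a
    translation as well.\<close>
  have "\<exists>\<beta>'. \<beta>' \<noteq> 0 \<and> (\<forall>z\<in>J. z + \<beta>' \<in> J)"
    using \<alpha>
  proof
    assume "\<alpha> = 1"
    then show ?thesis using sym \<beta> by (intro exI[of _ \<beta>]) (auto simp: J_symmetry_def)
  next
    assume a1: "\<alpha> = - 1"
    have "z + \<beta> \<in> J" if "z \<in> J" for z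
    proof -
      have "\<alpha> * (- z) + \<beta> \<in> J" using sym J_minus[OF that] unfolding J_symmetry_def by blast
      then show ?thesis using a1 by simp
    qed
    then show ?thesis using \<beta> by (intro exI[of _ \<beta>]) auto
  qed
  then obtain \<beta>' where \<beta>': "\<beta>' \<noteq> 0" "\<And>z. z \<in> J \<Longrightarrow> z + \<beta>' \<in> J" by blast
  have rn: "r + of_nat n * \<beta>' \<in> J" for n
  proof (induction n)
    case (Suc n)
    from \<beta>'(2)[OF this] show ?case by (simp add: algebra_simps)
  qed (use r in simp)
  obtain N :: nat where N: "real N * cmod \<beta>' > 1 / d + cmod r"
    using reals_Archimedean3[of "cmod \<beta>'"] \<beta>'(1) by auto
  \<comment> \<open>Far translates of \<open>r\<close> lie where J is imaginary. Two consecutive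
    ones give Re \<beta>' = 0, and then Re r = 0.\<close>
  have "Re (r + of_nat n * \<beta>') = 0" if "n \<ge> N" for n
  proof (rule far[OF rn])
    have "real N * cmod \<beta>' \<le> real n * cmod \<beta>'" using that by (intro mult_right_mono) auto
    then have "1 / d + cmod r < cmod (of_nat n * \<beta>')" using N by (simp add: norm_mult)
    then show "1 / d < cmod (r + of_nat n * \<beta>')"
      using norm_diff_ineq[of "of_nat n * \<beta>'" r] by (simp add: add.commute)
  qed
  from this[of N] this[of "Suc N"] have "Re \<beta>' = 0" "Re r = 0"
    by (simp_all add: algebra_simps)
  then show False using r by simp
qed

text \<open>The extremal condition has j = 2 and is applied to the symmetry and to its inverse,
  which replaces \<delta> = \<alpha>^2 by its conjugate. If \<delta> \<noteq> 1, the two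
  inequalities make the extremal ray imaginary and leave \<delta> = -1, a quarter turn.\<close>

lemma rotation_part:
  assumes sym: "J_symmetry \<alpha> 0"
  shows "\<alpha> = 1 \<or> \<alpha> = - 1"
proof -
  have \<alpha>0: "\<alpha> \<noteq> 0" using J_symmetry_nonzero[OF sym] .
  obtain w0 where w0: "w0 \<in> S" "Im w0 > 0" "\<And>w. w \<in> S \<Longrightarrow> Im w > 0 \<Longrightarrow> 0 \<le> Im (w * cnj w0)"
    using ex_extremal by blast
  have "\<forall>\<^sub>F w in nhds w0. Im w > 0"
    using order_tendstoD(1)[OF tendsto_Im[OF filterlim_ident], of 0 w0] w0 by simp
  then have "\<forall>\<^sub>F w in nhds w0. w \<in> S \<longrightarrow> 0 \<le> 1 * Im (w * cnj w0)"
    by eventually_elim (use w0 in auto)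
  then have ext: "extremal 1 w0" using w0 by (simp add: extremal_def)
  \<comment> \<open>Comparison with the point \<i> of S: the extremal ray lies in the closed first
    quadrant.\<close>
  have re0: "Re w0 \<ge> 0" using w0(3)[OF imag_in_S[of 1]] by simp
  have ineq: "0 \<le> Im (((1 / \<gamma>)\<^sup>2 - 1) * w0\<^sup>2)" if s: "J_symmetry \<gamma> 0" for \<gamma>
  proof -
    have \<gamma>0: "\<gamma> \<noteq> 0" using J_symmetry_nonzero[OF s] .
    have "((\<lambda>w. (lin \<gamma> 0 w - w / \<gamma>) / w ^ Suc 2) \<longlongrightarrow> of_real b * ((1 / \<gamma>)\<^sup>2 - 1) / \<gamma>) (at 0)"
      using lin_third_order[OF s refl] \<gamma>0 by (simp add: field_simps eval_nat_numeral)
    from extremal_first_order[OF s ext this] show ?thesis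
      using b by (simp only: mult.assoc Im_of_real_mult) (simp add: zero_le_mult_iff)
  qed
  define \<delta> where "\<delta> = \<alpha>\<^sup>2"
  have d1: "cmod \<delta> = 1" using sym by (simp add: J_symmetry_def \<delta>_def norm_power)
  have "1 / \<delta> = cnj \<delta>"
  proof -
    have "\<delta> \<noteq> 0" "\<delta> * cnj \<delta> = 1" using d1 complex_norm_square[of \<delta>] by auto
    then show ?thesis by (simp add: divide_eq_eq mult.commute)
  qed
  then have 1: "0 \<le> Im ((cnj \<delta> - 1) * w0\<^sup>2)" using ineq[OF sym] by (simp add: \<delta>_def power_divide)
  have 2: "0 \<le> Im ((\<delta> - 1) * w0\<^sup>2)"
    using ineq[OF J_symmetry_inverse[OF sym, simplified]] by (simp add: \<delta>_def)
  have "\<delta> = 1"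
  proof (rule ccontr)
    assume "\<delta> \<noteq> 1"
    have norm: "(Re \<delta>)\<^sup>2 + (Im \<delta>)\<^sup>2 = 1" using d1 cmod_power2[of \<delta>] by simp
    have "Re \<delta> < 1"
    proof -
      have "(Re \<delta>)\<^sup>2 \<le> 1" using norm zero_le_power2[of "Im \<delta>"] by linarith
      then have "Re \<delta> \<le> 1" using power2_le_imp_le[of "Re \<delta>" 1] by simp
      moreover have "Re \<delta> \<noteq> 1" using norm \<open>\<delta> \<noteq> 1\<close> by (auto simp: complex_eq_iff)
      ultimately show ?thesis by linarith
    qed
    \<comment> \<open>Sum of both inequalities, as \<delta> + cnj \<delta> - 2 = 2 (Re \<delta> -
      1).\<close>
    moreover have "0 \<le> 2 * (Re \<delta> - 1) * Im (w0\<^sup>2)" using 1 2 by (simp add: algebra_simps)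
    ultimately have "Im (w0\<^sup>2) \<le> 0" by (simp add: zero_le_mult_iff)
    then have "Re w0 = 0" using re0 w0(2) by (simp add: power2_eq_square mult_le_0_iff)
    then have "w0\<^sup>2 = of_real (- (Im w0)\<^sup>2)" by (simp add: complex_eq_iff power2_eq_square)
    then have "Im ((cnj \<delta> - 1) * w0\<^sup>2) = (Im w0)\<^sup>2 * Im \<delta>" "Im ((\<delta> - 1) * w0\<^sup>2) = - ((Im w0)\<^sup>2 * Im \<delta>)"
      by (simp_all add: mult.commute)
    then have "Im \<delta> = 0" using 1 2 w0(2) by auto
    then have "(Re \<delta>)\<^sup>2 = 1" using norm by simp
    then have "Re \<delta> = - 1" using \<open>Re \<delta> < 1\<close> by (auto simp: power2_eq_1_iff)
    then have "\<alpha>\<^sup>2 = \<i>\<^sup>2" using \<open>Im \<delta> = 0\<close> by (simp add: \<delta>_def[symmetric] complex_eq_iff)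
    then have "\<alpha> = \<i> \<or> \<alpha> = - \<i>" by (simp only: power2_eq_iff)
    \<comment> \<open>A quarter turn would rotate the imaginary points of S onto the real axis,
      which S avoids.\<close>
    then have "\<i> * \<alpha> = of_real (- 1) \<or> \<i> * \<alpha> = of_real 1" by auto
    moreover have "\<i> * \<alpha> \<in> S" using S_rotate'[OF sym] imag_in_S[of 1] by simp
    ultimately show False using real_notin_S by metis
  qed
  then show ?thesis by (simp add: \<delta>_def power2_eq_1_iff)
qed

end

section \<open>Chebyshev's method for the quartic\<close>

lemma quot_of_fract_divide:
  fixes p q :: "complex poly"
  assumes "q \<noteq> 0"
  obtains P Q d where "quot_of_fract (to_fract p / to_fract q) = (P, Q)" "p = P * d" "q = Q * d" "d \<noteq> 0"
proof -
  have "to_fract p / to_fract q = quot_to_fract (p, q)"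
    by (simp add: to_fract_def quot_to_fract_def)
  then have quot: "quot_of_fract (to_fract p / to_fract q) = normalize_quot (p, q)"
    using assms by (simp add: quot_of_fract_quot_to_fract)
  obtain d where "p = fst (normalize_quot (p, q)) * d" "q = snd (normalize_quot (p, q)) * d" "d \<noteq> 0"
    using normalize_quotE[OF assms] by metis
  then show ?thesis using that quot by (metis prod.collapse)
qed

text \<open>The cancelled common factor does not vanish at z because the numerator does not, so the
  reduced denominator keeps its zero.\<close>

lemma rat_map_pole:
  assumes "poly q z = 0" "poly p z \<noteq> 0" "q \<noteq> 0"
  shows "rat_map (to_fract p / to_fract q) (Fin z) = Infty"
proof -
  obtain P Q d where PQ: "quot_of_fract (to_fract p / to_fract q) = (P, Q)" "p = P * d" "q = Q * d" "d \<noteq> 0"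
    using quot_of_fract_divide[OF assms(3)] by blast
  have "poly Q z = 0" using assms(1,2) PQ by auto
  then show ?thesis using PQ(1) by (simp add: rat_map_def)
qed

lemma rat_map_Infty:
  assumes "degree q < degree p" "q \<noteq> 0"
  shows "rat_map (to_fract p / to_fract q) Infty = Infty"
proof -
  obtain P Q d where PQ: "quot_of_fract (to_fract p / to_fract q) = (P, Q)" "p = P * d" "q = Q * d" "d \<noteq> 0"
    using quot_of_fract_divide[OF assms(2)] by blast
  have "P \<noteq> 0" "Q \<noteq> 0" using assms PQ by auto
  then have "degree Q < degree P" using assms(1) PQ by (simp add: degree_mult_eq)
  then show ?thesis using PQ(1) by (simp add: rat_map_def Let_def coeff_eq_0 max_def)
qed

lemma chebyshev_fraction:
  assumes "pderiv p \<noteq> 0"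
  defines "q \<equiv> pderiv p"
  shows "chebyshev p = to_fract (2 * [:0, 1:] * q ^ 3 - (2 * q\<^sup>2 + p * pderiv q) * p) / to_fract (2 * q ^ 3)"
proof -
  have q': "to_fract q \<noteq> 0" using assms by simp
  have two: "to_fract (2 :: complex poly) = 2"
    by (metis one_add_one to_fract_1 to_fract_add)
  have nz: "(2 :: complex poly fract) \<noteq> 0"
    using two by (metis to_fract_eq_0_iff zero_neq_numeral)
  define X where "X = ([:0, 1:] :: complex poly)"
  show ?thesis
    unfolding chebyshev_def L_fract_def q_def [symmetric] X_def [symmetric]
    using q' nz by (simp add: two power3_eq_cube power2_eq_square divide_simps)
qed

lemma p_poly_coeffs: "p_poly a = [:of_real a, 0, - of_real (1 + a), 0, 1:]"
  by (simp add: p_poly_def power2_eq_square one_pCons algebra_simps)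

lemma pderiv_p_poly: "pderiv (p_poly a) = [:0, - 2 * of_real (1 + a), 0, 4:]"
  by (simp add: p_poly_coeffs pderiv_pCons algebra_simps)

lemma pderiv2_p_poly: "pderiv (pderiv (p_poly a)) = [:- 2 * of_real (1 + a), 0, 12:]"
  by (simp add: pderiv_p_poly pderiv_pCons algebra_simps)

text \<open>\<open>p0\<close>, \<open>p1\<close>, \<open>p2\<close> are the polynomial and its first two derivatives, over a field with
  \<open>s = 1 + a\<close>; they are used both for real and for complex arguments.\<close>

definition p0 :: "'a \<Rightarrow> 'a \<Rightarrow> 'a \<Rightarrow> 'a::field" where "p0 a s z = z ^ 4 - s * z\<^sup>2 + a"
definition p1 :: "'a \<Rightarrow> 'a \<Rightarrow> 'a::field" where "p1 s z = 4 * z ^ 3 - 2 * s * z"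
definition p2 :: "'a \<Rightarrow> 'a \<Rightarrow> 'a::field" where "p2 s z = 12 * z\<^sup>2 - 2 * s"
definition cheb :: "'a \<Rightarrow> 'a \<Rightarrow> 'a \<Rightarrow> 'a::field" where
  "cheb a s z = z - (2 * (p1 s z)\<^sup>2 + p0 a s z * p2 s z) * p0 a s z / (2 * p1 s z ^ 3)"

lemma poly_p0: "poly (p_poly a) z = p0 (of_real a) (of_real (1 + a)) z"
  by (simp add: p_poly_coeffs p0_def algebra_simps power2_eq_square power4_eq_xxxx)

lemma poly_p1: "poly (pderiv (p_poly a)) z = p1 (of_real (1 + a)) z"
  by (simp add: pderiv_p_poly p1_def algebra_simps power3_eq_cube)

lemma poly_p2: "poly (pderiv (pderiv (p_poly a))) z = p2 (of_real (1 + a)) z"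
  by (simp add: pderiv2_p_poly p2_def algebra_simps power2_eq_square)

abbreviation cheb_map :: "real \<Rightarrow> rsphere \<Rightarrow> rsphere" where
  "cheb_map a \<equiv> rat_map (chebyshev (p_poly a))"

abbreviation ac :: "real \<Rightarrow> complex" where "ac a \<equiv> of_real a"
abbreviation sc :: "real \<Rightarrow> complex" where "sc a \<equiv> of_real (1 + a)"

section \<open>Poles, the point at infinity and the symmetries of the Chebyshev map\<close>

context
  fixes a :: real
  assumes a: "0 < a" "a < 1"
begin



lemma C_finite: "p1 (sc a) z \<noteq> 0 \<Longrightarrow> cheb_map a (Fin z) = Fin (cheb (ac a) (sc a) z)"
  using rat_map_chebyshev_Fin[of "p_poly a" z] unfolding poly_p0 poly_p1 poly_p2
  by (simp add: cheb_def field_simps eval_nat_numeral)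

lemma p1_zero_iff: "p1 (sc a) z = 0 \<longleftrightarrow> z = 0 \<or> 2 * z\<^sup>2 = (sc a)"
proof -
  have "p1 (sc a) z = 2 * z * (2 * z\<^sup>2 - (sc a))" by (simp add: p1_def algebra_simps eval_nat_numeral)
  then show ?thesis by auto
qed

text \<open>At a critical point other than 0, z^2 = s/2 with s = 1 + a, so p = -(1 - a)^2 / 4 and
  p'' = 4s; at 0 the values are a and -2s. At a zero of p' the numerator of the Chebyshev fraction
  is -p^2 p'', hence every such zero is a pole.\<close>

lemma p0_p2_nonzero:
  assumes "p1 (sc a) z = 0" shows "p0 (ac a) (sc a) z \<noteq> 0" "p2 (sc a) z \<noteq> 0"
proof -
  have s0: "(sc a) \<noteq> 0" using a by (simp only: of_real_eq_0_iff)
  have "z = 0 \<or> 2 * z\<^sup>2 = (sc a)" using assms p1_zero_iff by simp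
  then have "p0 (ac a) (sc a) z \<noteq> 0 \<and> p2 (sc a) z \<noteq> 0"
  proof
    assume "z = 0"
    then show ?thesis using a s0 by (simp add: p0_def p2_def del: of_real_add)
  next
    assume z: "2 * z\<^sup>2 = (sc a)"
    have "4 * p0 (ac a) (sc a) z = (2 * z\<^sup>2)\<^sup>2 - 2 * (sc a) * (2 * z\<^sup>2) + 4 * (ac a)"
      by (simp add: p0_def algebra_simps power2_eq_square power4_eq_xxxx)
    also have "\<dots> = - of_real ((1 - a)\<^sup>2)"
      unfolding z by (simp add: algebra_simps power2_eq_square)
    finally have "4 * p0 (ac a) (sc a) z = - of_real ((1 - a)\<^sup>2)" .
    moreover have "complex_of_real ((1 - a)\<^sup>2) \<noteq> 0" using a by (simp only: of_real_eq_0_iff) simp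
    ultimately have "p0 (ac a) (sc a) z \<noteq> 0" by auto
    moreover have "p2 (sc a) z = 6 * (2 * z\<^sup>2) - 2 * (sc a)" by (simp add: p2_def)
    then have "p2 (sc a) z = 4 * (sc a)" unfolding z by simp
    ultimately show ?thesis using s0 by (simp del: of_real_add)
  qed
  then show "p0 (ac a) (sc a) z \<noteq> 0" "p2 (sc a) z \<noteq> 0" by auto
qed

lemma pderiv_nonzero: "pderiv (p_poly a) \<noteq> 0"
  by (simp add: pderiv_p_poly)

lemma C_pole: "p1 (sc a) z = 0 \<Longrightarrow> cheb_map a (Fin z) = Infty"
  unfolding chebyshev_fraction[OF pderiv_nonzero]
  by (rule rat_map_pole) (use p0_p2_nonzero in \<open>simp_all add: poly_p0 poly_p1 poly_p2 pderiv_nonzero\<close>)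

text \<open>The numerator has coefficient 128 - 44 = 84 at degree 10, while the denominator has
  degree 9.\<close>

lemma C_Infty: "cheb_map a Infty = Infty"
proof -
  define p q r where "p = p_poly a" and "q = pderiv p" and "r = pderiv q"
  have p: "degree p = 4" "lead_coeff p = 1" by (simp_all add: p_def p_poly_coeffs)
  have q: "degree q = 3" "lead_coeff q = 4" by (simp_all add: q_def p_def pderiv_p_poly)
  have r: "degree r = 2" "lead_coeff r = 12" by (simp_all add: r_def q_def p_def pderiv2_p_poly)
  have nz: "p \<noteq> 0" "q \<noteq> 0" "r \<noteq> 0" using p q r by auto
  have two: "(2 :: complex poly) = [:2:]" by (simp add: numeral_poly)
  define T where "T = 2 * q\<^sup>2 + p * r"
  have q2: "degree (q\<^sup>2) = 6" "coeff (q\<^sup>2) 6 = 16"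
    using q nz lead_coeff_power[of q 2] by (simp_all add: degree_power_eq)
  have pr: "degree (p * r) = 6" "coeff (p * r) 6 = 12"
    using p r nz coeff_mult_degree_sum[of p r] by (simp_all add: degree_mult_eq)
  have T: "coeff T 6 = 44" "degree T \<le> 6"
    unfolding T_def two using q2 pr by (auto intro!: degree_add_le)
  then have dT: "degree T = 6" using le_degree[of T 6] by simp
  have Tp: "coeff (T * p) 10 = 44"
    using coeff_mult_degree_sum[of T p] dT T p by simp
  have q3: "degree (q ^ 3) = 9" "coeff (q ^ 3) 9 = 64"
    using q nz lead_coeff_power[of q 3] by (simp_all add: degree_power_eq)
  have "coeff (2 * [:0, 1:] * q ^ 3) 10 = 128"
  proof -
    have "2 * [:0, 1:] * q ^ 3 = pCons 0 (smult 2 (q ^ 3))" unfolding two by simp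
    then show ?thesis using q3 by (simp add: coeff_pCons_Suc[of _ _ 9, simplified])
  qed
  then have "coeff (2 * [:0, 1:] * q ^ 3 - T * p) 10 \<noteq> 0" using Tp by simp
  then have deg: "10 \<le> degree (2 * [:0, 1:] * q ^ 3 - T * p)" by (rule le_degree)
  have deg': "degree (2 * q ^ 3) = 9" unfolding two using q3 by simp
  have "chebyshev p = to_fract (2 * [:0, 1:] * q ^ 3 - T * p) / to_fract (2 * q ^ 3)"
    unfolding p_def q_def r_def T_def by (rule chebyshev_fraction[OF pderiv_nonzero])
  moreover have "rat_map (to_fract (2 * [:0, 1:] * q ^ 3 - T * p) / to_fract (2 * q ^ 3)) Infty = Infty"
  proof (rule rat_map_Infty)
    show "degree (2 * q ^ 3) < degree (2 * [:0, 1:] * q ^ 3 - T * p)" using deg deg' by linarith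
  qed (use nz in simp)
  ultimately show ?thesis by (simp only: flip: p_def)
qed

lemma C_minus: "cheb_map a (extend uminus x) = extend uminus (cheb_map a x)"
proof (cases x)
  case (Fin z)
  have m: "p0 (ac a) (sc a) (- z) = p0 (ac a) (sc a) z" "p1 (sc a) (- z) = - p1 (sc a) z" "p2 (sc a) (- z) = p2 (sc a) z"
    by (simp_all add: p0_def p1_def p2_def)
  show ?thesis
  proof (cases "p1 (sc a) z = 0")
    case True
    then show ?thesis using Fin C_pole[of z] C_pole[of "- z"] m by simp
  next
    case False
    then show ?thesis using Fin C_finite[of z] C_finite[of "- z"] m by (simp add: cheb_def)
  qed
qed (simp add: C_Infty)

lemma C_cnj: "cheb_map a (extend cnj x) = extend cnj (cheb_map a x)"
proof (cases x)
  case (Fin z)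
  have m: "p0 (ac a) (sc a) (cnj z) = cnj (p0 (ac a) (sc a) z)" "p1 (sc a) (cnj z) = cnj (p1 (sc a) z)" "p2 (sc a) (cnj z) = cnj (p2 (sc a) z)"
    by (simp_all add: p0_def p1_def p2_def)
  show ?thesis
  proof (cases "p1 (sc a) z = 0")
    case True
    then show ?thesis using Fin C_pole[of z] C_pole[of "cnj z"] m by simp
  next
    case False
    then show ?thesis using Fin C_finite[of z] C_finite[of "cnj z"] m by (simp add: cheb_def)
  qed
qed (simp add: C_Infty)

lemma C_iterate_commute:
  assumes "\<And>x. cheb_map a (extend \<tau> x) = extend \<tau> (cheb_map a x)"
  shows "(cheb_map a ^^ n) (extend \<tau> x) = extend \<tau> ((cheb_map a ^^ n) x)"
  by (induction n) (simp_all add: assms)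

lemma Julia_minus: "Fin (- z) \<in> Julia_set (cheb_map a) \<longleftrightarrow> Fin z \<in> Julia_set (cheb_map a)"
  using Julia_set_isometry[of "extend uminus" "cheb_map a" "Fin z"]
  by (simp add: dist_extend_uminus extend_involution C_iterate_commute[OF C_minus])

lemma Julia_cnj: "Fin (cnj z) \<in> Julia_set (cheb_map a) \<longleftrightarrow> Fin z \<in> Julia_set (cheb_map a)"
  using Julia_set_isometry[of "extend cnj" "cheb_map a" "Fin z"]
  by (simp add: dist_extend_cnj extend_involution C_iterate_commute[OF C_cnj])

lemma closed_Julia_finite: "closed {z. Fin z \<in> Julia_set (cheb_map a)}"
proof -
  have "closed (Fin -` Julia_set (cheb_map a))"
    unfolding Julia_set_def using open_Fatou_set continuous_on_Fin
    by (intro closed_vimage) (auto simp: closed_def)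
  then show ?thesis by (simp add: vimage_def)
qed

end

section \<open>The repelling fixed point at infinity and the absence of imaginary fixed
  points\<close>

context
  fixes a :: real
  assumes a: "0 < a" "a < 1"
begin


text \<open>Denominator and numerator of the Chebyshev fraction at z = 1/u, multiplied by u^9 and
  u^10. The three inner polynomials are u^3 p'(1/u), u^4 p(1/u) and u^2 p''(1/u).\<close>

abbreviation "cE u \<equiv> 2 * (4 - 2 * (sc a) * u\<^sup>2) ^ 3"
abbreviation "cH u \<equiv> 2 * (4 - 2 * (sc a) * u\<^sup>2) ^ 3 - (2 * (4 - 2 * (sc a) * u\<^sup>2)\<^sup>2
   + (1 - (sc a) * u\<^sup>2 + (ac a) * u ^ 4) * (12 - 2 * (sc a) * u\<^sup>2)) * (1 - (sc a) * u\<^sup>2 + (ac a) * u ^ 4)"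

text \<open>Chebyshev's method in the coordinate \<open>u = 1 / z\<close> near the fixed point at infinity.\<close>

definition cinf :: "complex \<Rightarrow> complex" where
  "cinf u = u * cE u / cH u"

lemma cinf_minus: "cinf (- u) = - cinf u"
  by (simp add: cinf_def)

lemma cinf_cnj: "cinf (cnj u) = cnj (cinf u)"
  by (simp add: cinf_def)

lemma C_inverse:
  assumes u: "u \<noteq> 0" and E: "4 - 2 * (sc a) * u\<^sup>2 \<noteq> 0" and H: "cH u \<noteq> 0"
  shows "cinf u \<noteq> 0" "cheb_map a (Fin (1 / u)) = Fin (1 / cinf u)"
proof -
  show "cinf u \<noteq> 0" using u E H by (simp add: cinf_def)
  define e where "e = 4 - 2 * (sc a) * u\<^sup>2"
  define f where "f = 1 - (sc a) * u\<^sup>2 + (ac a) * u ^ 4"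
  define g where "g = 12 - 2 * (sc a) * u\<^sup>2"
  have 1: "p1 (sc a) (1 / u) = e / u ^ 3"
    using u by (simp add: p1_def e_def power_divide diff_divide_distrib eval_nat_numeral)
  have 0: "p0 (ac a) (sc a) (1 / u) = f / u ^ 4"
    using u by (simp add: p0_def f_def power_divide diff_divide_distrib add_divide_distrib eval_nat_numeral)
  have 2: "p2 (sc a) (1 / u) = g / u\<^sup>2"
    using u by (simp add: p2_def g_def power_divide diff_divide_distrib eval_nat_numeral)
  have e0: "e \<noteq> 0" using E by (simp add: e_def)
  have H': "cH u = 2 * e ^ 3 - (2 * e\<^sup>2 + f * g) * f" by (simp add: e_def f_def g_def)
  have "(2 * (e / u ^ 3)\<^sup>2 + f / u ^ 4 * (g / u\<^sup>2)) * (f / u ^ 4) / (2 * (e / u ^ 3) ^ 3)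
      = ((2 * e\<^sup>2 + f * g) * f / u ^ 10) / (2 * e ^ 3 / u ^ 9)"
    by (simp add: power_divide add_divide_distrib distrib_right flip: power_mult power_add)
  also have "\<dots> = (2 * e\<^sup>2 + f * g) * f / (2 * e ^ 3) / u"
    using u e0 by (simp add: eval_nat_numeral)
  finally have "cheb (ac a) (sc a) (1 / u) = 1 / u - (2 * e\<^sup>2 + f * g) * f / (2 * e ^ 3) / u"
    unfolding cheb_def 0 1 2 by simp
  also have "\<dots> = cH u / (2 * e ^ 3) / u"
    unfolding H' using e0 u by (simp add: diff_divide_distrib)
  also have "\<dots> = 1 / cinf u"
    unfolding cinf_def e_def[symmetric] H' by (simp add: mult.commute)
  finally have "cheb (ac a) (sc a) (1 / u) = 1 / cinf u" .
  moreover have "p1 (sc a) (1 / u) \<noteq> 0" using 1 e0 u by simp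
  ultimately show "cheb_map a (Fin (1 / u)) = Fin (1 / cinf u)" using C_finite[OF a] by simp
qed

lemma cH_tendsto: "((\<lambda>u. cH u) \<longlongrightarrow> 84) (at 0)"
  by (rule tendsto_eq_intros refl | simp)+

lemma cinf_good_ball:
  obtains R where "0 < R" "R \<le> 1" "\<And>u. u \<in> ball 0 R \<Longrightarrow> 4 - 2 * (sc a) * u\<^sup>2 \<noteq> 0 \<and> cH u \<noteq> 0"
proof -
  have "((\<lambda>u. 4 - 2 * (sc a) * u\<^sup>2) \<longlongrightarrow> 4) (at 0)" by (rule tendsto_eq_intros refl | simp)+
  then have "\<forall>\<^sub>F u in at 0. 4 - 2 * (sc a) * u\<^sup>2 \<noteq> 0" by (rule tendsto_imp_eventually_ne) simp
  moreover have "\<forall>\<^sub>F u in at 0. cH u \<noteq> 0" using cH_tendsto by (rule tendsto_imp_eventually_ne) simp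
  ultimately have "\<forall>\<^sub>F u in at 0. 4 - 2 * (sc a) * u\<^sup>2 \<noteq> 0 \<and> cH u \<noteq> 0" by (rule eventually_conj)
  then obtain d where d: "d > 0" "\<And>u. u \<noteq> 0 \<Longrightarrow> cmod u < d \<Longrightarrow> 4 - 2 * (sc a) * u\<^sup>2 \<noteq> 0 \<and> cH u \<noteq> 0"
    unfolding eventually_at by (auto simp: dist_norm)
  have "4 - 2 * (sc a) * u\<^sup>2 \<noteq> 0 \<and> cH u \<noteq> 0" if "u \<in> ball 0 (min d 1)" for u :: complex
    using d(2)[of u] that by (cases "u = 0") auto
  then show thesis using that[of "min d 1"] d(1) by simp
qed

text \<open>The quotient cE/cH begins with (128 - 192 s u^2) / (84 - 102 s u^2) = 32/21 - (64/147) s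
  u^2, where s = 1 + a. The constant K comes from compactness of the smaller closed disc.\<close>

lemma cinf_expansion:
  assumes R: "0 < R" "R \<le> 1" and good: "\<And>u. u \<in> ball 0 R \<Longrightarrow> 4 - 2 * (sc a) * u\<^sup>2 \<noteq> 0 \<and> cH u \<noteq> 0"
  obtains K where "\<And>u. u \<in> ball 0 (R / 2) \<Longrightarrow>
    cmod (cinf u - (of_real (32 / 21) * u + of_real (- (64 / 147) * (1 + a)) * u ^ 3)) \<le> K * cmod u ^ 4"
proof -
  \<comment> \<open>\<open>M\<close> is the polynomial cofactor, in w = u^2, of u^4 in cE minus the
    truncated expansion times cH; \<open>id\<close> below verifies this.\<close>
  define M where "M = (\<lambda>w. 96 * (sc a)\<^sup>2 - 16 * (sc a) ^ 3 * w - 32 / 21 * ((40 * (sc a)\<^sup>2 - 56 * (ac a)) + (- 6 * (sc a) ^ 3 + 60 * (ac a) * (sc a)) * w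
      - (12 * (ac a) * (sc a)\<^sup>2 + 12 * (ac a)\<^sup>2) * w\<^sup>2 + 2 * (ac a)\<^sup>2 * (sc a) * w ^ 3)
    + 64 / 147 * (sc a) * (- 102 * (sc a) + (40 * (sc a)\<^sup>2 - 56 * (ac a)) * w + (- 6 * (sc a) ^ 3 + 60 * (ac a) * (sc a)) * w\<^sup>2
      - (12 * (ac a) * (sc a)\<^sup>2 + 12 * (ac a)\<^sup>2) * w ^ 3 + 2 * (ac a)\<^sup>2 * (sc a) * w ^ 4))"
  define Q where "Q = (\<lambda>u. u * M (u\<^sup>2) / cH u)"
  have id: "cE u - (32 / 21 - 64 / 147 * (sc a) * u\<^sup>2) * cH u = u ^ 4 * M (u\<^sup>2)" for u
  proof -
    have "2 * (4 - 2 * s * w) ^ 3 - (32 / 21 - 64 / 147 * s * w) * (2 * (4 - 2 * s * w) ^ 3 - (2 * (4 - 2 * s * w)\<^sup>2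
        + (1 - s * w + c * w\<^sup>2) * (12 - 2 * s * w)) * (1 - s * w + c * w\<^sup>2))
      = w\<^sup>2 * (96 * s\<^sup>2 - 16 * s ^ 3 * w - 32 / 21 * ((40 * s\<^sup>2 - 56 * c) + (- 6 * s ^ 3 + 60 * c * s) * w
      - (12 * c * s\<^sup>2 + 12 * c\<^sup>2) * w\<^sup>2 + 2 * c\<^sup>2 * s * w ^ 3)
    + 64 / 147 * s * (- 102 * s + (40 * s\<^sup>2 - 56 * c) * w + (- 6 * s ^ 3 + 60 * c * s) * w\<^sup>2
      - (12 * c * s\<^sup>2 + 12 * c\<^sup>2) * w ^ 3 + 2 * c\<^sup>2 * s * w ^ 4))" for s c w :: complex
      by (simp add: field_simps eval_nat_numeral)
    from this[of "sc a" "u\<^sup>2" "ac a"] show ?thesis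
      by (simp add: M_def flip: power_mult)
  qed
  have "continuous_on (cball 0 (R / 2)) Q"
    unfolding Q_def M_def using good R by (intro continuous_intros ballI) (auto simp: subset_iff)
  then have "bounded (Q ` cball 0 (R / 2))"
    using compact_continuous_image compact_cball compact_imp_bounded by blast
  then obtain K where K: "\<And>u. u \<in> cball 0 (R / 2) \<Longrightarrow> cmod (Q u) \<le> K"
    unfolding bounded_iff by (metis imageI)
  show thesis
  proof (rule that[of K])
    fix u :: complex assume u: "u \<in> ball 0 (R / 2)"
    then have "u \<in> ball 0 R" using R by auto
    then have H: "cH u \<noteq> 0" using good by blast
    have "cinf u - (of_real (32 / 21) * u + of_real (- (64 / 147) * (1 + a)) * u ^ 3)
        = u * (cE u - (32 / 21 - 64 / 147 * (sc a) * u\<^sup>2) * cH u) / cH u"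
    proof -
      have "x / h - (32 / 21 * u - 64 / 147 * (sc a) * u ^ 3) = (x - u * (32 / 21 - 64 / 147 * (sc a) * u\<^sup>2) * h) / h"
        if "h \<noteq> 0" for x h :: complex
        using that by (simp add: divide_simps) (simp add: algebra_simps eval_nat_numeral)
      from this[OF H, of "u * cE u"] show ?thesis
        unfolding cinf_def right_diff_distrib mult.assoc[symmetric] by simp
    qed
    also have "\<dots> = u ^ 4 * Q u" unfolding id Q_def by (simp add: mult_ac)
    finally have "cmod (cinf u - (of_real (32 / 21) * u + of_real (- (64 / 147) * (1 + a)) * u ^ 3)) = cmod u ^ 4 * cmod (Q u)"
      by (simp add: norm_mult norm_power)
    also have "\<dots> \<le> cmod u ^ 4 * K" using K[of u] u by (intro mult_left_mono) auto
    finally show "cmod (cinf u - (of_real (32 / 21) * u + of_real (- (64 / 147) * (1 + a)) * u ^ 3)) \<le> K * cmod u ^ 4"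
      by (simp add: mult.commute)
  qed
qed

lemma cinf_deriv: "(cinf has_field_derivative of_real (32 / 21)) (at 0)"
proof -
  have "((\<lambda>u. cE u / cH u) \<longlongrightarrow> 128 / 84) (at 0)"
    by (intro tendsto_divide cH_tendsto) (rule tendsto_eq_intros refl | simp)+
  moreover have "\<forall>\<^sub>F u in at 0. cE u / cH u = (cinf u - cinf 0) / (u - 0)"
    using eventually_neq_at_within[of 0] by eventually_elim (simp add: cinf_def)
  ultimately have "((\<lambda>u. (cinf u - cinf 0) / (u - 0)) \<longlongrightarrow> 128 / 84) (at 0)"
    by (rule Lim_transform_eventually)
  then show ?thesis by (simp add: has_field_derivative_iff)
qed

text \<open>In the coordinate 1/z the map is \<open>cinf\<close>, whose derivative at 0 is 128/84 =
  32/21 > 1.\<close>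

lemma Infty_not_superattracting: "\<not> superattracting_fixed_point (cheb_map a) Infty"
proof
  assume "superattracting_fixed_point (cheb_map a) Infty"
  then have d: "((\<lambda>w. fin_part (rsphere_inv (cheb_map a (rsphere_inv (Fin w))))) has_field_derivative 0) (at 0)"
    by (simp add: superattracting_fixed_point_def)
  obtain R where R: "0 < R" "R \<le> 1" "\<And>u. u \<in> ball 0 R \<Longrightarrow> 4 - 2 * (sc a) * u\<^sup>2 \<noteq> 0 \<and> cH u \<noteq> 0"
    using cinf_good_ball by blast
  have "(cinf has_field_derivative 0) (at 0)"
  proof (rule has_field_derivative_transform_within_open[OF d open_ball])
    fix w :: complex assume w: "w \<in> ball 0 R"
    show "fin_part (rsphere_inv (cheb_map a (rsphere_inv (Fin w)))) = cinf w"
    proof (cases "w = 0")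
      case True
      then show ?thesis using C_Infty[OF a] by (simp add: cinf_def)
    next
      case False
      have "4 - 2 * (sc a) * w\<^sup>2 \<noteq> 0" "cH w \<noteq> 0" using R(3)[OF w] by blast+
      from C_inverse[OF False this] show ?thesis using False by simp
    qed
  qed (use R in auto)
  from DERIV_unique[OF this cinf_deriv] show False by simp
qed

text \<open>On the imaginary axis p > 0, p'' < 0 and (p')^2 \<le> 0, so 2 (p')^2 + p p'' is negative
  and the correction term cannot vanish. The origin is a pole.\<close>

lemma imag_not_fixed: "cheb_map a (Fin (\<i> * of_real y)) \<noteq> Fin (\<i> * of_real y)"
proof (cases "y = 0")
  case True
  then show ?thesis using C_pole[OF a, of 0] by (simp add: p1_def)
next
  case False
  define z where "z = \<i> * complex_of_real y"
  have z2: "z\<^sup>2 = - of_real (y\<^sup>2)" by (simp add: z_def power_mult_distrib)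
  have z4: "z ^ 4 = of_real (y ^ 4)" by (simp add: z_def power_mult_distrib)
  define P where "P = y ^ 4 + (1 + a) * y\<^sup>2 + a"
  have P: "P > 0" using a by (simp add: P_def add_nonneg_pos)
  have p0: "p0 (ac a) (sc a) z = of_real P" by (simp add: p0_def z2 z4 P_def)
  have p2: "p2 (sc a) z = of_real (- (12 * y\<^sup>2 + 2 * (1 + a)))" by (simp add: p2_def z2)
  have p1: "p1 (sc a) z = z * of_real (- (4 * y\<^sup>2 + 2 * (1 + a)))"
  proof -
    have "p1 (sc a) z = z * (4 * z\<^sup>2 - 2 * (sc a))" by (simp add: p1_def algebra_simps eval_nat_numeral)
    then show ?thesis by (simp add: z2)
  qed
  have p1sq: "(p1 (sc a) z)\<^sup>2 = of_real (- (y\<^sup>2 * (4 * y\<^sup>2 + 2 * (1 + a))\<^sup>2))"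
    unfolding p1 power_mult_distrib z2
    by (simp only: power2_minus mult_minus_left flip: of_real_power of_real_mult of_real_minus)
  have pos: "4 * y\<^sup>2 + 2 * (1 + a) > 0" "12 * y\<^sup>2 + 2 * (1 + a) > 0" using a by (simp_all add: add_nonneg_pos)
  have p1n: "p1 (sc a) z \<noteq> 0"
    unfolding p1 using False pos(1) by (simp only: mult_eq_0_iff of_real_eq_0_iff) (simp add: z_def)
  define N where "N = 2 * (- (y\<^sup>2 * (4 * y\<^sup>2 + 2 * (1 + a))\<^sup>2)) + P * (- (12 * y\<^sup>2 + 2 * (1 + a)))"
  have "N < 0"
  proof -
    have "0 \<le> y\<^sup>2 * (4 * y\<^sup>2 + 2 * (1 + a))\<^sup>2" by simp
    moreover have "0 < P * (12 * y\<^sup>2 + 2 * (1 + a))" using P pos by simp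
    ultimately show ?thesis unfolding N_def mult_minus_right by linarith
  qed
  have "2 * (p1 (sc a) z)\<^sup>2 + p0 (ac a) (sc a) z * p2 (sc a) z = of_real N"
    unfolding p1sq p0 p2 N_def by (simp only: of_real_add of_real_mult of_real_numeral)
  then have "(2 * (p1 (sc a) z)\<^sup>2 + p0 (ac a) (sc a) z * p2 (sc a) z) * p0 (ac a) (sc a) z / (2 * p1 (sc a) z ^ 3) \<noteq> 0"
    using \<open>N < 0\<close> P p1n p0 by simp
  then have "cheb (ac a) (sc a) z \<noteq> z" by (simp add: cheb_def)
  then show ?thesis using C_finite[OF a p1n] by (simp add: z_def)
qed

end

lemma basin_iterate: "f x \<in> basin f \<zeta> \<longleftrightarrow> x \<in> basin f \<zeta>"
  unfolding basin_def mem_Collect_eq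
  using filterlim_sequentially_Suc[of "\<lambda>n. (f ^^ n) x" "nhds \<zeta>"] by (simp add: funpow_swap1)

section \<open>Real dynamics beyond the root 1 and its basin\<close>

context
  fixes a :: real
  assumes a: "0 < a" "a < 1"
begin

text \<open>The last inequality says that the Chebyshev step from x does not overshoot 1. With p = t
  q and t = x - 1, so that p' = q + t q' and p'' = 2q' + t q'', it reduces after division by t^2 to
  positivity of t q (4q'^2 - q q'') + 2 t^2 q'^3.\<close>

lemma p0_p1_p2_real_ineqs:
  fixes x :: real
  assumes x: "x > 1"
  shows "p0 a (1 + a) x > 0" "p1 (1 + a) x > 0" "p2 (1 + a) x > 0"
    "(2 * (p1 (1 + a) x)\<^sup>2 + p0 a (1 + a) x * p2 (1 + a) x) * p0 a (1 + a) x < (x - 1) * (2 * p1 (1 + a) x ^ 3)"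
proof -
  have xx: "x < x\<^sup>2" using x by (simp add: power2_eq_square)
  have x2: "1 < x\<^sup>2" using x xx by linarith
  then have ax: "a < x\<^sup>2" using a by linarith
  define t where "t = x - 1"
  define q where "q = x ^ 3 + x\<^sup>2 - a * x - a"
  define q' where "q' = 3 * x\<^sup>2 + 2 * x - a"
  define q'' where "q'' = 6 * x + 2"
  have t: "t > 0" using x by (simp add: t_def)
  have q: "q > 0"
  proof -
    have "q = (x + 1) * (x\<^sup>2 - a)" by (simp add: q_def algebra_simps eval_nat_numeral)
    moreover have "0 < (x + 1) * (x\<^sup>2 - a)" using x ax by (intro mult_pos_pos) auto
    ultimately show ?thesis by simp
  qed
  have q': "q' > 0" using x x2 a unfolding q'_def by linarith
  have p0: "p0 a (1 + a) x = t * q"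
    by (simp add: p0_def t_def q_def algebra_simps eval_nat_numeral)
  have p1: "p1 (1 + a) x = q + t * q'"
    by (simp add: p1_def t_def q_def q'_def algebra_simps eval_nat_numeral)
  have p2: "p2 (1 + a) x = 2 * q' + t * q''"
    by (simp add: p2_def t_def q''_def q'_def algebra_simps eval_nat_numeral)
  show "p0 a (1 + a) x > 0" "p1 (1 + a) x > 0" "p2 (1 + a) x > 0"
    unfolding p0 p1 p2 using t q q' x by (auto simp: q''_def intro!: mult_pos_pos add_pos_pos)
  \<comment> \<open>Bounding q above by x^3 + x^2 and q' below by 3x^2 + x leaves coefficients 6, 8,
    2 against 36, 24, 4.\<close>
  have qq: "q * q'' < 4 * q'\<^sup>2"
  proof -
    have "0 \<le> a * x" using a x by simp
    then have "q \<le> x ^ 3 + x\<^sup>2" using a unfolding q_def by linarith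
    then have "q * q'' \<le> (x ^ 3 + x\<^sup>2) * (6 * x + 2)"
      unfolding q''_def using x by (intro mult_right_mono) auto
    also have "\<dots> = 6 * x ^ 4 + 8 * x ^ 3 + 2 * x\<^sup>2" by (simp add: algebra_simps eval_nat_numeral)
    also have "\<dots> < 4 * (3 * x\<^sup>2 + x)\<^sup>2"
    proof -
      have "0 < x ^ 4" "0 < x ^ 3" "0 < x\<^sup>2" using x by auto
      moreover have "4 * (3 * x\<^sup>2 + x)\<^sup>2 = 36 * x ^ 4 + 24 * x ^ 3 + 4 * x\<^sup>2"
        by (simp add: algebra_simps eval_nat_numeral)
      ultimately show ?thesis by linarith
    qed
    also have "\<dots> \<le> 4 * q'\<^sup>2"
      using x a by (intro mult_left_mono power_mono) (auto simp: q'_def)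
    finally show ?thesis .
  qed
  have "q\<^sup>2 * (2 * q' + t * q'') < 2 * q' * (q + t * q')\<^sup>2"
  proof -
    have "2 * q' * (q + t * q')\<^sup>2 - q\<^sup>2 * (2 * q' + t * q'') = t * q * (4 * q'\<^sup>2 - q * q'') + 2 * t\<^sup>2 * q' ^ 3"
      by (simp add: algebra_simps eval_nat_numeral)
    moreover have "0 < t * q * (4 * q'\<^sup>2 - q * q'')" using t q qq by simp
    moreover have "0 < 2 * t\<^sup>2 * q' ^ 3" using t q' by simp
    ultimately show ?thesis by linarith
  qed
  then have "t\<^sup>2 * (q\<^sup>2 * (2 * q' + t * q'')) < t\<^sup>2 * (2 * q' * (q + t * q')\<^sup>2)"
    using t by (intro mult_strict_left_mono) auto
  then show "(2 * (p1 (1 + a) x)\<^sup>2 + p0 a (1 + a) x * p2 (1 + a) x) * p0 a (1 + a) x < (x - 1) * (2 * p1 (1 + a) x ^ 3)"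
    unfolding p0 p1 p2 t_def[symmetric] by (simp add: algebra_simps eval_nat_numeral)
qed

lemma p0_p1_p2_of_real:
  "p0 (ac a) (sc a) (of_real x) = of_real (p0 a (1 + a) x)"
  "p1 (sc a) (of_real x) = of_real (p1 (1 + a) x)"
  "p2 (sc a) (of_real x) = of_real (p2 (1 + a) x)"
  "cheb (ac a) (sc a) (of_real x) = of_real (cheb a (1 + a) x)"
  by (simp_all add: cheb_def p0_def p1_def p2_def)

lemma cheb_between:
  fixes x :: real
  assumes "x > 1" shows "1 < cheb a (1 + a) x" "cheb a (1 + a) x < x"
proof -
  note p = p0_p1_p2_real_ineqs[OF assms]
  have d: "0 < 2 * p1 (1 + a) x ^ 3" using p by simp
  have "0 < (2 * (p1 (1 + a) x)\<^sup>2 + p0 a (1 + a) x * p2 (1 + a) x) * p0 a (1 + a) x / (2 * p1 (1 + a) x ^ 3)"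
    using p by (intro divide_pos_pos mult_pos_pos add_pos_pos) auto
  then show "cheb a (1 + a) x < x" by (simp add: cheb_def)
  have "(2 * (p1 (1 + a) x)\<^sup>2 + p0 a (1 + a) x * p2 (1 + a) x) * p0 a (1 + a) x / (2 * p1 (1 + a) x ^ 3) < x - 1"
    using p(4) d by (simp add: divide_less_eq)
  then show "1 < cheb a (1 + a) x" by (simp add: cheb_def)
qed

text \<open>The orbit stays real, decreases and is bounded below by 1, so it converges; its limit is
  fixed, and \<open>cheb_between\<close> excludes fixed points above 1.\<close>

lemma real_in_basin_1:
  fixes x :: real
  assumes x: "x > 1"
  shows "Fin (of_real x) \<in> basin (cheb_map a) (Fin 1)"
proof -
  define g :: "real \<Rightarrow> real" where "g = cheb a (1 + a)"
  have gt: "(g ^^ n) x > 1" for n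
    by (induction n) (use x cheb_between in \<open>auto simp: g_def\<close>)
  have it: "(cheb_map a ^^ n) (Fin (of_real x)) = Fin (of_real ((g ^^ n) x))" for n
  proof (induction n)
    case (Suc n)
    have "p1 (sc a) (of_real ((g ^^ n) x)) \<noteq> 0"
      using p0_p1_p2_real_ineqs(2)[OF gt[of n]] by (simp only: p0_p1_p2_of_real of_real_eq_0_iff)
    then show ?case using Suc C_finite[OF a] by (simp add: p0_p1_p2_of_real g_def del: of_real_add)
  qed simp
  have "decseq (\<lambda>n. (g ^^ n) x)"
    by (rule decseq_SucI) (use cheb_between(2)[OF gt] in \<open>auto simp: g_def intro: less_imp_le\<close>)
  moreover have "bdd_below (range (\<lambda>n. (g ^^ n) x))"
    using gt by (intro bdd_belowI[of _ 1]) (auto intro: less_imp_le)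
  ultimately have lim: "(\<lambda>n. (g ^^ n) x) \<longlonglongrightarrow> (INF n. (g ^^ n) x)" (is "_ \<longlonglongrightarrow> ?L")
    by (intro LIMSEQ_decseq_INF)
  have L1: "?L \<ge> 1" using gt by (intro cINF_greatest) (auto intro: less_imp_le)
  have "?L = 1"
  proof (rule ccontr)
    assume "?L \<noteq> 1"
    then have L: "?L > 1" using L1 by simp
    have "isCont g ?L"
      using p0_p1_p2_real_ineqs(2)[OF L] unfolding g_def cheb_def p0_def p1_def p2_def
      by (intro continuous_intros) auto
    from isCont_tendsto_compose[OF this lim] have "(\<lambda>n. (g ^^ Suc n) x) \<longlonglongrightarrow> g ?L" by simp
    with LIMSEQ_Suc[OF lim] have "g ?L = ?L" using LIMSEQ_unique by blast
    then show False using cheb_between(2)[OF L] by (simp add: g_def)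
  qed
  then have "(\<lambda>n. Fin (of_real ((g ^^ n) x))) \<longlonglongrightarrow> Fin (of_real 1)"
    using lim by (intro tendsto_Fin tendsto_of_real) simp
  then show ?thesis by (simp add: basin_def it)
qed

text \<open>Factoring z - 1 out of p gives C(z) - 1 = (z - 1)(1 - (z + 1)(z^2 - a) G z) with G 1 =
  1/p'(1). As p'(1) = 2(1 - a), the second factor tends to 0.\<close>

lemma superattracting_1: "superattracting_fixed_point (cheb_map a) (Fin 1)"
proof -
  have p11: "p1 (sc a) 1 = 2 - 2 * ac a" unfolding p1_def by simp
  have n1: "p1 (sc a) 1 \<noteq> 0"
  proof -
    have "p1 (sc a) 1 = of_real (2 - 2 * a)" unfolding p11 by simp
    then show ?thesis using a by (simp only: of_real_eq_0_iff)
  qed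
  have p01: "p0 (ac a) (sc a) 1 = 0" by (simp add: p0_def)
  have fix1: "cheb (ac a) (sc a) 1 = 1" by (simp add: cheb_def p01 del: of_real_add)
  define G where "G = (\<lambda>z. (2 * (p1 (sc a) z)\<^sup>2 + p0 (ac a) (sc a) z * p2 (sc a) z) / (2 * p1 (sc a) z ^ 3))"
  have G1: "G 1 = 1 / p1 (sc a) 1"
    using n1 by (simp add: G_def p01 eval_nat_numeral del: of_real_add)
  have "isCont G 1"
    using n1 unfolding G_def p0_def p1_def p2_def by (intro continuous_intros) auto
  then have G: "(G \<longlongrightarrow> 1 / p1 (sc a) 1) (at 1)" using G1 by (simp add: isCont_def)
  have "((\<lambda>z. 1 - (z + 1) * (z\<^sup>2 - ac a) * G z) \<longlongrightarrow> 1 - (1 + 1) * (1\<^sup>2 - ac a) * (1 / p1 (sc a) 1)) (at 1)"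
    by (intro tendsto_intros G)
  also have "1 - (1 + 1) * (1\<^sup>2 - ac a) * (1 / p1 (sc a) 1) = 0"
    using n1 unfolding p11 by (simp add: right_diff_distrib)
  finally have "((\<lambda>z. 1 - (z + 1) * (z\<^sup>2 - ac a) * G z) \<longlongrightarrow> 0) (at 1)" .
  moreover have "\<forall>\<^sub>F z in at 1. 1 - (z + 1) * (z\<^sup>2 - ac a) * G z
      = (cheb (ac a) (sc a) z - cheb (ac a) (sc a) 1) / (z - 1)"
    using eventually_neq_at_within[of 1]
  proof eventually_elim
    case (elim z)
    have "p0 (ac a) (sc a) z = (z - 1) * ((z + 1) * (z\<^sup>2 - ac a))"
      by (simp add: p0_def algebra_simps eval_nat_numeral)
    moreover have "cheb (ac a) (sc a) z = z - p0 (ac a) (sc a) z * G z"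
      by (simp add: cheb_def G_def mult.commute)
    ultimately have "cheb (ac a) (sc a) z = z - (z - 1) * ((z + 1) * (z\<^sup>2 - ac a)) * G z"
      by (simp only:)
    then have "cheb (ac a) (sc a) z - 1 = (z - 1) * (1 - (z + 1) * (z\<^sup>2 - ac a) * G z)"
      by (simp add: algebra_simps del: of_real_add)
    then show ?case using elim by (simp add: fix1 del: of_real_add)
  qed
  ultimately have "((\<lambda>z. (cheb (ac a) (sc a) z - cheb (ac a) (sc a) 1) / (z - 1)) \<longlongrightarrow> 0) (at 1)"
    by (rule Lim_transform_eventually)
  then have d: "(cheb (ac a) (sc a) has_field_derivative 0) (at 1)"
    by (simp add: has_field_derivative_iff)
  have "open {z. p1 (sc a) z \<noteq> 0}"
    unfolding p1_def by (intro open_Collect_neq continuous_intros)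
  from has_field_derivative_transform_within_open[OF d this]
  have "((\<lambda>w. fin_part (cheb_map a (Fin w))) has_field_derivative 0) (at 1)"
    using n1 C_finite[OF a] by (simp del: of_real_add)
  then show ?thesis
    using C_finite[OF a n1] fix1 by (simp add: superattracting_fixed_point_def del: of_real_add)
qed

section \<open>The Julia set as the complement of the basins\<close>

context
  assumes Fatou: "Fatou_set (cheb_map a) =
    (\<Union>\<zeta>\<in>{\<zeta>. superattracting_fixed_point (cheb_map a) \<zeta>}. basin (cheb_map a) \<zeta>)"
begin

text \<open>Basins are completely invariant, since dropping the first term of an orbit does not
  change its limit.\<close>

lemma Julia_invariant: "cheb_map a x \<in> Julia_set (cheb_map a) \<longleftrightarrow> x \<in> Julia_set (cheb_map a)"
  by (simp add: Julia_set_def Fatou basin_iterate)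

lemma real_notin_Julia:
  fixes x :: real
  assumes "\<bar>x\<bar> > 1"
  shows "Fin (of_real x) \<notin> Julia_set (cheb_map a)"
proof -
  have *: "Fin (of_real x) \<notin> Julia_set (cheb_map a)" if "x > 1" for x
    using real_in_basin_1[OF that] superattracting_1 by (auto simp: Julia_set_def Fatou)
  show ?thesis
  proof (cases "x > 1")
    case False
    then have "Fin (- of_real x) \<notin> Julia_set (cheb_map a)" using *[of "- x"] assms by simp
    then show ?thesis using Julia_minus[OF a] by simp
  qed (rule *)
qed

text \<open>The map commutes with the reflection in the imaginary axis, so the closed set of fixed points of
  this reflection is forward invariant; it contains no superattracting fixed point.\<close>

lemma imaginary_axis_in_Julia:
  assumes x: "extend uminus (extend cnj x) = x"
  shows "x \<in> Julia_set (cheb_map a)"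
proof (rule ccontr)
  define \<tau> where "\<tau> = (\<lambda>x. extend uminus (extend cnj x))"
  assume "x \<notin> Julia_set (cheb_map a)"
  then obtain \<zeta> where \<zeta>: "superattracting_fixed_point (cheb_map a) \<zeta>" "x \<in> basin (cheb_map a) \<zeta>"
    by (auto simp: Julia_set_def Fatou)
  have lim: "(\<lambda>n. (cheb_map a ^^ n) x) \<longlonglongrightarrow> \<zeta>" using \<zeta>(2) by (simp add: basin_def)
  have inv: "\<tau> ((cheb_map a ^^ n) x) = (cheb_map a ^^ n) x" for n
    by (induction n) (use x in \<open>simp_all add: \<tau>_def C_minus[OF a, symmetric] C_cnj[OF a, symmetric]\<close>)
  have "continuous_on UNIV \<tau>"
    by (auto simp: continuous_on_iff \<tau>_def dist_extend_uminus dist_extend_cnj)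
  then have "isCont \<tau> \<zeta>" using continuous_on_eq_continuous_at by blast
  from isCont_tendsto_compose[OF this lim] have "(\<lambda>n. (cheb_map a ^^ n) x) \<longlonglongrightarrow> \<tau> \<zeta>"
    by (simp add: inv)
  then have fixed: "\<tau> \<zeta> = \<zeta>" using lim LIMSEQ_unique by blast
  show False
  proof (cases \<zeta>)
    case (Fin z)
    have "- cnj z = z" using fixed Fin by (simp add: \<tau>_def)
    then have "z = \<i> * of_real (Im z)" by (simp add: complex_eq_iff)
    then have "cheb_map a \<zeta> \<noteq> \<zeta>" using imag_not_fixed[OF a, of "Im z"] Fin by simp
    then show ?thesis using \<zeta>(1) by (simp add: superattracting_fixed_point_def)
  next
    case Infty
    then show ?thesis using \<zeta>(1) Infty_not_superattracting[OF a] by simp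
  qed
qed

lemma Infty_in_Julia: "Infty \<in> Julia_set (cheb_map a)"
  by (rule imaginary_axis_in_Julia) simp

text \<open>This pole is mapped to \<open>Infty\<close>, which lies in the Julia set. It provides
  the point off the imaginary axis that excludes translations.\<close>

lemma pole_in_Julia: "Fin (of_real (sqrt ((1 + a) / 2))) \<in> Julia_set (cheb_map a)"
proof -
  have "2 * (complex_of_real (sqrt ((1 + a) / 2)))\<^sup>2 = of_real (2 * (sqrt ((1 + a) / 2))\<^sup>2)"
    by (simp only: of_real_mult of_real_power of_real_numeral)
  also have "2 * (sqrt ((1 + a) / 2))\<^sup>2 = 1 + a" using a by simp
  finally have "p1 (sc a) (of_real (sqrt ((1 + a) / 2))) = 0" using p1_zero_iff[OF a] by blast
  then have "cheb_map a (Fin (of_real (sqrt ((1 + a) / 2)))) = Infty" by (rule C_pole[OF a])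
  then show ?thesis using Julia_invariant[of "Fin (of_real (sqrt ((1 + a) / 2)))"] Infty_in_Julia by simp
qed

text \<open>The expansion at infinity with \<kappa> = 32/21 feeds the linearization, and the
  linearized Julia set satisfies the axioms of \<open>scaled_cone\<close>.\<close>

lemma chebyshev_symmetry:
  assumes \<alpha>: "cmod \<alpha> = 1" and sym: "(\<lambda>z. \<alpha> * z + \<beta>) \<in> symmetry_group (chebyshev (p_poly a))"
  shows "\<beta> = 0" "\<alpha> = 1 \<or> \<alpha> = - 1"
proof -
  obtain R0 where R0: "0 < R0" "R0 \<le> 1"
      and good: "\<And>u. u \<in> ball 0 R0 \<Longrightarrow> 4 - 2 * sc a * u\<^sup>2 \<noteq> 0 \<and> cH a u \<noteq> 0"
    by (rule cinf_good_ball[OF a]) (rule that)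
  obtain K where K: "\<And>u. u \<in> ball 0 (R0 / 2) \<Longrightarrow>
      cmod (cinf a u - (of_real (32 / 21) * u + of_real (- (64 / 147) * (1 + a)) * u ^ 3)) \<le> K * cmod u ^ 4"
    by (rule cinf_expansion[OF a R0]) (erule good, rule that)
  have good': "4 - 2 * sc a * u\<^sup>2 \<noteq> 0" "cH a u \<noteq> 0" if "u \<in> ball 0 (R0 / 2)" for u
  proof -
    have "u \<in> ball 0 R0" using that R0 by auto
    then show "4 - 2 * sc a * u\<^sup>2 \<noteq> 0" "cH a u \<noteq> 0" using good by blast+
  qed
  have hol: "cinf a holomorphic_on ball 0 (R0 / 2)"
    unfolding cinf_def[OF a] using good'(2) by (intro holomorphic_intros) auto
  define \<kappa> :: real where "\<kappa> = 32 / 21"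
  \<comment> \<open>Both the cubic coefficient of \<open>cinf\<close> and \<kappa> - \<kappa>^3 are
    negative, so b > 0; the rotation argument depends on this sign.\<close>
  define b where "b = - (64 / 147) * (1 + a) / (\<kappa> - \<kappa> ^ 3)"
  have \<kappa>3: "\<kappa> - \<kappa> ^ 3 < 0" by (simp add: \<kappa>_def eval_nat_numeral)
  have b: "b * (\<kappa> - \<kappa> ^ 3) = - (64 / 147) * (1 + a)" 
  proof -
    have "\<kappa> - \<kappa> ^ 3 \<noteq> 0" using \<kappa>3 by linarith
    from nonzero_eq_divide_eq[OF this] b_def show ?thesis by blast
  qed
  have b0: "b > 0" unfolding b_def using \<kappa>3 a by (intro divide_neg_neg) auto
  obtain \<rho> \<phi> \<Phi> where L: "0 < \<rho>" "continuous_on (ball 0 \<rho>) \<Phi>"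
    "\<And>w. w \<in> ball 0 \<rho> \<Longrightarrow> \<Phi> w \<in> ball 0 (R0 / 2) \<and> cinf a (\<Phi> (w / of_real \<kappa>)) = \<Phi> w"
    "\<And>w. w \<in> ball 0 \<rho> \<Longrightarrow> \<Phi> w = 0 \<longleftrightarrow> w = 0"
    "\<And>w. w \<in> ball 0 \<rho> \<Longrightarrow> \<Phi> (- w) = - \<Phi> w"
    "\<And>w. w \<in> ball 0 \<rho> \<Longrightarrow> \<Phi> (cnj w) = cnj (\<Phi> w)"
    "((\<lambda>w. (\<Phi> w - w) / w ^ 3) \<longlongrightarrow> - of_real b) (at 0)"
    "((\<lambda>u. (\<phi> u - u) / u ^ 3) \<longlongrightarrow> of_real b) (at 0)" "\<phi> 0 = 0"
    "\<forall>\<^sub>F u in nhds 0. \<phi> u \<in> ball 0 \<rho> \<and> \<Phi> (\<phi> u) = u"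
  proof (rule koenigs_linearization[OF hol])
    show "0 < R0 / 2" "R0 / 2 \<le> 1" using R0 by auto
    show "1 < \<kappa>" by (simp add: \<kappa>_def)
    show "cmod (cinf a u - (of_real \<kappa> * u + of_real (- (64 / 147) * (1 + a)) * u ^ 3)) \<le> K * cmod u ^ 4"
      if "u \<in> ball 0 (R0 / 2)" for u using K[OF that] by (simp only: \<kappa>_def)
    show "cinf a (- u) = - cinf a u" for u by (rule cinf_minus[OF a])
    show "cinf a (cnj u) = cnj (cinf a u)" for u by (rule cinf_cnj[OF a])
    show "b * (\<kappa> - \<kappa> ^ 3) = - (64 / 147) * (1 + a)" by (rule b)
  qed (rule that)
  define J where "J = {z. Fin z \<in> Julia_set (cheb_map a)}"
  interpret scaled_cone J \<phi> \<Phi> \<kappa> b \<rho>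
  proof
    show "1 < \<kappa>" by (simp add: \<kappa>_def)
    show "closed J" unfolding J_def by (rule closed_Julia_finite[OF a])
    show "- z \<in> J" if "z \<in> J" for z using that Julia_minus[OF a] by (simp add: J_def)
    show "cnj z \<in> J" if "z \<in> J" for z using that Julia_cnj[OF a] by (simp add: J_def)
    show "\<exists>X::real. \<forall>x::real. X < \<bar>x\<bar> \<longrightarrow> of_real x \<notin> J"
      using real_notin_Julia by (auto simp: J_def)
    show "\<i> * of_real y \<in> J" for y :: real
      unfolding J_def using imaginary_axis_in_Julia[of "Fin (\<i> * of_real y)"] by simp
    show "1 / \<Phi> (w / of_real \<kappa>) \<in> J \<longleftrightarrow> 1 / \<Phi> w \<in> J" if w: "w \<in> ball 0 \<rho>" "w \<noteq> 0" for w
    proof -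
      \<comment> \<open>The map sends 1/u to 1/\<Phi>(w) because \<Phi> conjugates
        \<open>cinf\<close> to multiplication by \<kappa>; invariance of the Julia set then gives
        the equivalence.\<close>
      define u where "u = \<Phi> (w / of_real \<kappa>)"
      have wk: "w / of_real \<kappa> \<in> ball 0 \<rho>" "w / of_real \<kappa> \<noteq> 0"
      proof -
        have "cmod (w / of_real \<kappa>) = cmod w * (21 / 32)" by (simp add: \<kappa>_def norm_divide)
        moreover have "cmod w < \<rho>" using w by simp
        ultimately have "cmod (w / of_real \<kappa>) < \<rho>" using norm_ge_zero[of w] by linarith
        then show "w / of_real \<kappa> \<in> ball 0 \<rho>" by simp
        show "w / of_real \<kappa> \<noteq> 0" using w by (simp add: \<kappa>_def)
      qed
      have u: "u \<noteq> 0" "u \<in> ball 0 (R0 / 2)" "cinf a u = \<Phi> w"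
        using L(3)[OF wk(1)] L(4)[OF wk(1)] wk(2) L(3)[OF w(1)] by (auto simp: u_def)
      have "cheb_map a (Fin (1 / u)) = Fin (1 / \<Phi> w)"
        using C_inverse(2)[OF a u(1) good'[OF u(2)]] u(3) by simp
      then show ?thesis using Julia_invariant[of "Fin (1 / u)"] by (simp add: J_def u_def)
    qed
  qed (use L b0 in auto)
  have J: "J_symmetry \<alpha> \<beta>"
    unfolding J_symmetry_def using sym \<alpha> symmetry_group_iff[OF \<alpha>] by (simp add: J_def)
  show "\<beta> = 0"
  proof (rule translation_part_zero[OF J])
    show "of_real (sqrt ((1 + a) / 2)) \<in> J" using pole_in_Julia by (simp add: J_def)
    show "Re (of_real (sqrt ((1 + a) / 2))) \<noteq> 0" using a by simp
  qed
  with J show "\<alpha> = 1 \<or> \<alpha> = - 1" using rotation_part by simp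
qed

lemma symmetry_group_chebyshev: "symmetry_group (chebyshev (p_poly a)) = {\<lambda>z. z, uminus}"
proof (intro equalityI subsetI)
  fix \<sigma> assume \<sigma>: "\<sigma> \<in> symmetry_group (chebyshev (p_poly a))"
  then obtain \<alpha> \<beta> where \<alpha>: "cmod \<alpha> = 1" and eq: "\<sigma> = (\<lambda>z. \<alpha> * z + \<beta>)"
    by (auto simp: symmetry_group_def hol_isometry_def)
  from chebyshev_symmetry[OF \<alpha> \<sigma>[unfolded eq]] show "\<sigma> \<in> {\<lambda>z. z, uminus}" by (auto simp: eq)
next
  have "uminus \<in> symmetry_group (chebyshev (p_poly a))"
    using symmetry_group_iff[of "- 1" 0 "chebyshev (p_poly a)"] Julia_minus[OF a] by simp
  then show "\<sigma> \<in> symmetry_group (chebyshev (p_poly a))" if "\<sigma> \<in> {\<lambda>z. z, uminus}" for \<sigma>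
    using that id_in_symmetry_group by auto
qed

end

end

theorem theorem3p10:
  fixes a :: real
  assumes "0 < a" and "a < 1"
    and "Fatou_set (rat_map (chebyshev (p_poly a))) =
      (\<Union>\<zeta>\<in>{\<zeta>. superattracting_fixed_point (rat_map (chebyshev (p_poly a))) \<zeta>}.
        basin (rat_map (chebyshev (p_poly a))) \<zeta>)"
  shows "symmetry_group (to_fract (p_poly a)) = symmetry_group (chebyshev (p_poly a))"
  using symmetry_group_p_poly[OF assms(1,2)] symmetry_group_chebyshev[OF assms] by simp

end
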